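(* (i) There is an algorithm which, for a tropical monotone rational function $f$, yields its decomposition (with respect to composition) into tropical monotone binomials and tropical monotone trinomials. The number of composants does not exceed the number of tropical roots of $f$. (ii) There is an algorithm which decomposes a tropical rational function $$f=g_1\circ\cdots\circ g_k\circ h_1\circ\cdots\circ h_m\circ g^{(0)}_{k_0}\circ\cdots\circ g^{(0)}_1,$$ where each $g_i$, $1\le i\le k$, is either a tropical non-monotone rational binomial with $\pm1$ slopes or a tropical non-monotone rational trinomial with $\pm1$ slopes, each $h_j$, $1\le j\le m$, is either a tropical regular monotone binomial or a tropical regular monotone trinomial, and each $g^{(0)}_l$, $1\le l\le k_0$, is a tropical singular monotone trinomial. The number of binomials among $g_1,\dots,g_k$ plus twice the number of trinomials among $g_1,\dots,g_k$ does not exceed the number of blocks of edges of $f$. The number $m$ does not exceed the number of edges of $f$, and the number $k_0$ equals the number of edges of $f$ with zero slopes. (iii) Let $f$ be a tropical monotone rational function (respectively, a tropical polynomial) with the slopes of its edges $a_0,\dots,a_n\ge 1$ (respectively, $a_0>\dots>a_n\ge 1$), and denote by $q_i$, $1\le i\le n$, the denominator of the irreducible fraction equal to $a_i/a_{i-1}$. Then $f$ is a composition of tropical rational binomials (respectively, tropical binomials) if and only if $(q_1\cdots q_n)\mid a_0$.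
   Context: A tropical polynomial is a function $\min_{0\le i\le d}\{ix+a_i\}$ with $a_i\in\mathbb{R}\cup\{\infty\}$. A tropical rational function is a difference of two tropical polynomials; equivalently, it is a continuous piecewise linear function $\mathbb{R}\to\mathbb{R}$ with finitely many linear pieces, all with integer slopes. Its edges are its linear pieces (edges of its graph), ordered from left to right. A tropical root is a point at which the function is not differentiable. A tropical rational function is monotone increasing (respectively, decreasing) if all its slopes are positive (respectively, negative). A block of edges of $f$ is a (maximal) sequence of consecutive edges whose slopes have equal signs, ignoring edges with zero slopes. All slopes here are integers. A tropical rational binomial is a function $\min\{b_1x+\beta_1,\,b_2x+\beta_2\}$ or $\max\{b_1x+\beta_1,\,b_2x+\beta_2\}$ with two edges, nonzero integers $b_1,b_2$ and real $\beta_1,\beta_2$. It is monotone if its slopes have the same sign and non-monotone otherwise; a monotone such function is what is meant by a tropical (regular) monotone binomial. In the polynomial case of (iii), a tropical binomial is a function $\min\{bx+\beta,\,cx+\gamma\}$ with integers $b>c\ge 1$. A regular trinomial is a continuous piecewise linear function with 3 edges having nonzero slopes; if the slopes are decreasing or increasing positive integers, it is called a tropical trinomial. A tropical non-monotone rational trinomial with $\pm1$ slopes is a continuous piecewise linear function with 3 edges, with slopes equal to $1$ or $-1$, not all of the same sign. A singular trinomial is a trinomial whose middle edge has zero slope, where singular trinomials lacking one or two of the edges with nonzero slopes are also admitted; for singular trinomials monotone is understood non-strictly.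
   Formalization: Affine functions that refute it are excluded: in (i) and polynomial (iii) all but the identity, in (ii) all but the identity and constants, in rational (iii) x+b with b≠0. Empty composition = identity; a monotone trinomial has 3 nonzero slopes of one sign, in any order. *)

theory Defs
  imports Complex_Main "HOL-Library.Extended_Real"
begin

section \<open>Tropical functions\<close>

definition tropical_polynomial :: "(real \<Rightarrow> real) \<Rightarrow> bool" where
  "tropical_polynomial f \<longleftrightarrow>
     (\<exists>(d::nat) (a :: nat \<Rightarrow> ereal). (\<forall>i\<le>d. a i \<noteq> -\<infinity>) \<and>
        (\<forall>x. ereal (f x) = (MIN i\<in>{0..d}. ereal (real i * x) + a i)))"

definition tropical_rational :: "(real \<Rightarrow> real) \<Rightarrow> bool" where
  "tropical_rational f \<longleftrightarrow>
     (\<exists>p q. tropical_polynomial p \<and> tropical_polynomial q \<and> f = (\<lambda>x. p x - q x))"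

definition tropical_roots :: "(real \<Rightarrow> real) \<Rightarrow> real set" where
  "tropical_roots f = {x. \<not> f differentiable (at x)}"

definition breaks :: "(real \<Rightarrow> real) \<Rightarrow> real list" where
  "breaks f = sorted_list_of_set (tropical_roots f)"

text \<open>The edge with index \<open>i\<close> lies over the open interval between the breaks with indices
  \<open>i - 1\<close> and \<open>i\<close>; the first and the last edge are unbounded. Edges are maximal, as the function is
  not differentiable at a break.\<close>

definition has_slopes :: "(real \<Rightarrow> real) \<Rightarrow> int list \<Rightarrow> bool" where
  "has_slopes f as \<longleftrightarrow>
     continuous_on UNIV f \<and> finite (tropical_roots f) \<and>
     length as = Suc (length (breaks f)) \<and>
     (\<forall>i<length as. \<forall>x. (0 < i \<longrightarrow> breaks f ! (i - 1) < x) \<and> (i < length (breaks f) \<longrightarrow> x < breaks f ! i) \<longrightarrow>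
        (f has_real_derivative of_int (as ! i)) (at x))"

definition slopes :: "(real \<Rightarrow> real) \<Rightarrow> int list" where
  "slopes f = (THE as. has_slopes f as)"

definition monotone_slopes :: "int list \<Rightarrow> bool" where
  "monotone_slopes as \<longleftrightarrow> (\<forall>a\<in>set as. a > 0) \<or> (\<forall>a\<in>set as. a < 0)"

definition number_of_blocks :: "int list \<Rightarrow> nat" where
  "number_of_blocks as = length (remdups_adj (map sgn (filter (\<lambda>a. a \<noteq> 0) as)))"


section \<open>Binomials and trinomials\<close>

definition binomial_of_slopes :: "int \<Rightarrow> int \<Rightarrow> (real \<Rightarrow> real) \<Rightarrow> bool" where
  "binomial_of_slopes b1 b2 g \<longleftrightarrow> b1 \<noteq> 0 \<and> b2 \<noteq> 0 \<and> b1 \<noteq> b2 \<and>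
     (\<exists>\<beta>1 \<beta>2 :: real.
        g = (\<lambda>x. min (of_int b1 * x + \<beta>1) (of_int b2 * x + \<beta>2)) \<or>
        g = (\<lambda>x. max (of_int b1 * x + \<beta>1) (of_int b2 * x + \<beta>2)))"

definition rational_binomial :: "(real \<Rightarrow> real) \<Rightarrow> bool" where
  "rational_binomial g \<longleftrightarrow> (\<exists>b1 b2. binomial_of_slopes b1 b2 g)"

definition monotone_binomial :: "(real \<Rightarrow> real) \<Rightarrow> bool" where
  "monotone_binomial g \<longleftrightarrow> (\<exists>b1 b2. sgn b1 = sgn b2 \<and> binomial_of_slopes b1 b2 g)"

definition pm1_binomial :: "(real \<Rightarrow> real) \<Rightarrow> bool" where
  "pm1_binomial g \<longleftrightarrow>
     (\<exists>b1 b2. \<bar>b1\<bar> = 1 \<and> \<bar>b2\<bar> = 1 \<and> sgn b1 \<noteq> sgn b2 \<and> binomial_of_slopes b1 b2 g)"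

definition tropical_binomial :: "(real \<Rightarrow> real) \<Rightarrow> bool" where
  "tropical_binomial g \<longleftrightarrow>
     (\<exists>(b::int) (c::int) (\<beta>::real) (\<gamma>::real). b > c \<and> c \<ge> 1 \<and>
        g = (\<lambda>x. min (of_int b * x + \<beta>) (of_int c * x + \<gamma>)))"

definition monotone_trinomial :: "(real \<Rightarrow> real) \<Rightarrow> bool" where
  "monotone_trinomial g \<longleftrightarrow> (\<exists>as. has_slopes g as \<and> length as = 3 \<and> monotone_slopes as)"

definition pm1_trinomial :: "(real \<Rightarrow> real) \<Rightarrow> bool" where
  "pm1_trinomial g \<longleftrightarrow>
     (\<exists>as. has_slopes g as \<and> length as = 3 \<and> (\<forall>a\<in>set as. \<bar>a\<bar> = 1) \<and> \<not> monotone_slopes as)"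

definition singular_monotone_trinomial :: "(real \<Rightarrow> real) \<Rightarrow> bool" where
  "singular_monotone_trinomial g \<longleftrightarrow>
     (\<exists>l r. has_slopes g (l @ [0] @ r) \<and> length l \<le> 1 \<and> length r \<le> 1 \<and> monotone_slopes (l @ r))"

text \<open>\<open>compose [g\<^sub>1, \<dots>, g\<^sub>k]\<close> applies \<open>g\<^sub>k\<close> first; the empty composition is the identity.\<close>

definition compose :: "(real \<Rightarrow> real) list \<Rightarrow> real \<Rightarrow> real" where
  "compose gs = foldr (\<circ>) gs id"


section \<open>Algorithms over the reals\<close>

text \<open>Algorithms operate on finite trees with real entries. Available are exact field arithmetic,
  order tests, branching and unbounded loops, with no constants besides 0 and 1 and no rounding
  operations; this is the Blum-Shub-Smale (real RAM) model with tree-structured memory.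
  \<open>run p x y\<close> means that \<open>p\<close> halts on input \<open>x\<close> with output \<open>y\<close>.\<close>

datatype datum = Number real | Empty | Cell datum datum

datatype program =
    Self | Zero | One | Nothing
  | Tuple program program | First | Second | IsCell
  | Plus | Minus | Times | Divide
  | Then program program
  | Branch program program program
  | While program program

inductive run :: "program \<Rightarrow> datum \<Rightarrow> datum \<Rightarrow> bool" where
  "run Self x x"
| "run Zero x (Number 0)"
| "run One x (Number 1)"
| "run Nothing x Empty"
| "run p x y \<Longrightarrow> run q x z \<Longrightarrow> run (Tuple p q) x (Cell y z)"
| "run First (Cell x y) x"
| "run Second (Cell x y) y"
| "run IsCell (Cell x y) (Number 1)"
| "run IsCell Empty (Number 0)"
| "run IsCell (Number a) (Number 0)"
| "run Plus (Cell (Number a) (Number b)) (Number (a + b))"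
| "run Minus (Cell (Number a) (Number b)) (Number (a - b))"
| "run Times (Cell (Number a) (Number b)) (Number (a * b))"
| "b \<noteq> 0 \<Longrightarrow> run Divide (Cell (Number a) (Number b)) (Number (a / b))"
| "run p x y \<Longrightarrow> run q y z \<Longrightarrow> run (Then p q) x z"
| "run c x (Number a) \<Longrightarrow> a > 0 \<Longrightarrow> run p x y \<Longrightarrow> run (Branch c p q) x y"
| "run c x (Number a) \<Longrightarrow> \<not> a > 0 \<Longrightarrow> run q x y \<Longrightarrow> run (Branch c p q) x y"
| "run c x (Number a) \<Longrightarrow> \<not> a > 0 \<Longrightarrow> run (While c p) x x"
| "run c x (Number a) \<Longrightarrow> a > 0 \<Longrightarrow> run p x y \<Longrightarrow> run (While c p) y z \<Longrightarrow> run (While c p) x z"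

inductive_cases run_elims:
  "run Self x y" "run Zero x y" "run One x y" "run Nothing x y" "run (Tuple p q) x y"
  "run First x y" "run Second x y" "run IsCell x y" "run Plus x y" "run Minus x y"
  "run Times x y" "run Divide x y" "run (Then p q) x y" "run (Branch c p q) x y"
  "run (While c p) x y"

lemma run_deterministic: "run p x y \<Longrightarrow> run p x z \<Longrightarrow> z = y"
proof (induction p x y arbitrary: z rule: run.induct)
  case (5 p x y q z' z)
  from "5.prems" show ?case by (rule run_elims(5)) (metis "5.IH")
next
  case (15 p x y q z' z)
  from "15.prems" show ?case by (rule run_elims(13)) (metis "15.IH")
next
  case (16 c x a p y q z)
  from "16.prems" show ?case by (rule run_elims(14)) (metis "16.IH" "16.hyps"(2) datum.inject(1))+
next
  case (17 c x a q y p z)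
  from "17.prems" show ?case by (rule run_elims(14)) (metis "17.IH" "17.hyps"(2) datum.inject(1))+
next
  case (18 c x a p z)
  from "18.prems" show ?case by (rule run_elims(15)) (metis "18.IH" "18.hyps"(2) datum.inject(1))+
next
  case (19 c x a p y z' z)
  from "19.prems" show ?case by (rule run_elims(15)) (metis "19.IH" "19.hyps"(2) datum.inject(1))+
qed (erule run_elims; simp)+

fun list_datum :: "datum list \<Rightarrow> datum" where
  "list_datum [] = Empty"
| "list_datum (x # xs) = Cell x (list_datum xs)"

text \<open>A piecewise linear function is given by its breaks and slopes, from left to right, and its
  value at 0.\<close>

definition function_datum :: "(real \<Rightarrow> real) \<Rightarrow> datum" where
  "function_datum f =
     Cell (list_datum (map Number (breaks f)))
       (Cell (list_datum (map (\<lambda>a. Number (of_int a)) (slopes f))) (Number (f 0)))"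

definition functions_datum :: "(real \<Rightarrow> real) list \<Rightarrow> datum" where
  "functions_datum gs = list_datum (map function_datum gs)"


section \<open>The divisibility criterion\<close>

definition ratio_denominator :: "(real \<Rightarrow> real) \<Rightarrow> nat \<Rightarrow> int" where
  "ratio_denominator f i = snd (quotient_of (of_int (slopes f ! i) / of_int (slopes f ! (i - 1))))"

end

theory Submission
  imports Defs "HOL-Library.While_Combinator"
begin

text \<open>
A continuous piecewise linear function is determined by its leftmost slope, its kinks (the breaks,
each with the slope to its right) and its value at 0; conversely a tropical rational function has
such a description with integer slopes (\<open>tropical_rational_is_pl\<close>), since away from finitely many
points a minimum of lines coincides locally with one line. All constructions take place on these data.

Everything about monotone inner functions rests on one principle, \<open>pl_factor\<close>. Let \<open>v\<close> be a
nondecreasing piecewise linear function with \<open>v 0 = 0\<close> and write every slope of \<open>f\<close> as a product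
\<open>d * w\<close>, where \<open>w\<close> is the slope of \<open>v\<close> on that edge. Then \<open>f = f' \<circ> v\<close>, where \<open>f'\<close> has the
breaks \<open>v t\<close>, the slopes \<open>d\<close> and the value of \<open>f\<close> at 0. Four choices of the factors are used.

\<^item> For monotone \<open>f\<close> with at least three breaks, split the slopes \<open>a\<close> of the first two edges as
  \<open>sgn a * \<bar>a\<bar>\<close> and all others as \<open>a * 1\<close>. The first two edges of \<open>f'\<close> then have the same slope, so
  \<open>f'\<close> has fewer breaks, and \<open>v\<close>, with slopes \<open>\<bar>a\<^sub>0\<bar>, \<bar>a\<^sub>1\<bar>, 1\<close>, is a binomial or trinomial. One stops
  at two breaks, and so the number of factors is at most the number of breaks.
\<^item> For an edge with slope 0, let \<open>w\<close> be 0 on it and 1 elsewhere: \<open>v\<close> is a singular trinomial that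
  collapses this edge. An affine function left over at the end is absorbed into the last factor.
\<^item> Splitting each slope as \<open>sgn a * \<bar>a\<bar>\<close> separates a function without constant edges into an
  increasing function, which is treated as above, followed by a zigzag with slopes \<open>1\<close> and \<open>-1\<close>.
\<^item> If \<open>a\<^sub>1 / a\<^sub>0 = p / q\<close> in lowest terms, then the inner slopes \<open>q, p, p, \<dots>\<close> belong to a binomial and
  remove the first break. The divisibility condition says exactly that \<open>p\<close> divides all later slopes,
  and it is inherited by \<open>f'\<close> (\<open>binomial_decomposition\<close>).

A zigzag is simplified by a non-monotone inner function (\<open>pl_fold\<close>). Take a bounded edge \<open>[p, q]\<close>
that is not longer than its neighbours. Near it the graph consists of three strokes of equal height,
so the zigzag factors through the fold with slopes \<open>1, -1, 1\<close> and breaks \<open>p, q\<close>, which costs one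
trinomial and removes two breaks. With \<open>m\<close> turning points, this gives total cost \<open>m\<close>, one less than
the number of blocks.

For the necessity of the divisibility condition, call slopes good if they can be written as
\<open>P x * R x\<close> where \<open>P\<close> increases and \<open>R\<close> decreases along the line with respect to divisibility
(\<open>divisor_chains\<close>). Binomials have good slopes, and composition preserves this: an increasing inner
function multiplies the chains, and a decreasing one interchanges those of the outer function first.
If \<open>f\<close> is injective, all binomials in a decomposition are bijective, so \<open>f\<close> has good slopes; then each
denominator \<open>q\<^sub>i\<close> divides the drop of \<open>R\<close> at the break \<open>i\<close>, so that their product divides \<open>R\<close> on the
first edge and hence \<open>a\<^sub>0\<close>.

The algorithms use only additions, multiplications, comparisons, folds over lists and loops that
decrease a natural number, so they are computable in the given machine model by closure properties.
\<close>

section \<open>Piecewise linear functions given by their kinks\<close>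

text \<open>The increment from \<open>x\<close> to \<open>y\<close> of a function with leftmost slope \<open>a\<close> and the given kinks. Both ends are
  clamped to the two sides of the first break. Increments are additive and do not depend on the value
  at a base point. The formula also makes sense for repeated breaks (edges of length 0) and for kinks
  that do not change the slope.\<close>

fun rise :: "real \<Rightarrow> (real \<times> real) list \<Rightarrow> real \<Rightarrow> real \<Rightarrow> real" where
  "rise a [] x y = a * (y - x)"
| "rise a ((t, b) # ks) x y = a * (min y t - min x t) + rise b ks (max x t) (max y t)"

type_synonym kinked = "real \<times> (real \<times> real) list \<times> real"

fun pl :: "kinked \<Rightarrow> real \<Rightarrow> real" where
  "pl (a, ks, c) x = c + rise a ks 0 x"

abbreviation slope_list :: "real \<Rightarrow> (real \<times> real) list \<Rightarrow> real list" where
  "slope_list a ks \<equiv> a # map snd ks"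

definition reduced :: "real \<Rightarrow> (real \<times> real) list \<Rightarrow> bool" where
  "reduced a ks \<longleftrightarrow> sorted_wrt (<) (map fst ks) \<and> distinct_adj (slope_list a ks)"

lemma rise_refl [simp]: "rise a ks x x = 0"
  by (induction ks arbitrary: a x) (auto simp: algebra_simps)

lemma rise_add: "rise a ks x y + rise a ks y z = rise a ks x z"
  by (induction ks arbitrary: a x y z) (auto simp: algebra_simps)

lemma pl_0 [simp]: "pl (a, ks, c) 0 = c"
  by simp

lemma pl_diff: "pl (a, ks, c) y - pl (a, ks, c) x = rise a ks x y"
  using rise_add[of a ks 0 x y] by simp

lemma rise_scale: "rise (m * a) (map (\<lambda>(t, b). (t, m * b)) ks) x y = m * rise a ks x y"
  by (induction ks arbitrary: a x y) (auto simp: algebra_simps)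

lemma rise_before:
  assumes "\<And>s b. (s, b) \<in> set ks \<Longrightarrow> x \<le> s \<and> y \<le> s"
  shows "rise a ks x y = a * (y - x)"
  using assms by (cases ks) (fastforce simp: min_def max_def)+

lemma rise_nonneg:
  "\<lbrakk>0 \<le> a; \<And>t b. (t, b) \<in> set ks \<Longrightarrow> 0 \<le> b; x \<le> y\<rbrakk> \<Longrightarrow> 0 \<le> rise a ks x y"
proof (induction ks arbitrary: a x y)
  case (Cons k ks)
  obtain t b where k: "k = (t, b)" by force
  have "0 \<le> rise b ks (max x t) (max y t)"
    using Cons.prems k by (intro Cons.IH) auto
  moreover have "0 \<le> a * (min y t - min x t)"
    using Cons.prems by (intro mult_nonneg_nonneg) auto
  ultimately show ?case by (simp add: k)
qed auto

lemma rise_pos: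
  "\<lbrakk>0 < a; \<And>t b. (t, b) \<in> set ks \<Longrightarrow> 0 < b; x < y\<rbrakk> \<Longrightarrow> 0 < rise a ks x y"
proof (induction ks arbitrary: a x y)
  case (Cons k ks)
  obtain t b where k: "k = (t, b)" by force
  have b: "0 \<le> b" "0 < b" "\<And>t b. (t, b) \<in> set ks \<Longrightarrow> 0 < b"
    using Cons.prems k by (auto intro: less_imp_le)
  show ?case
  proof (cases "t \<le> x")
    case True
    then show ?thesis using Cons.IH[OF b(2,3)] Cons.prems(3) by (simp add: k max_absorb1 min_absorb2)
  next
    case False
    then have "0 < a * (min y t - min x t)"
      using Cons.prems by (intro mult_pos_pos) auto
    moreover have "0 \<le> rise b ks (max x t) (max y t)"
      using b Cons.prems(3) by (intro rise_nonneg) (auto intro: less_imp_le)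
    ultimately show ?thesis by (simp add: k)
  qed
qed auto

lemma pl_mono:
  assumes "0 \<le> a" "\<And>t b. (t, b) \<in> set ks \<Longrightarrow> 0 \<le> b"
  shows "mono (pl (a, ks, c))"
proof (rule monoI)
  fix x y :: real assume "x \<le> y"
  then have "0 \<le> rise a ks x y" using assms by (intro rise_nonneg) auto
  with pl_diff[of a ks c y x] show "pl (a, ks, c) x \<le> pl (a, ks, c) y"
    by linarith
qed

lemma pl_strict_mono:
  assumes "0 < a" "\<And>t b. (t, b) \<in> set ks \<Longrightarrow> 0 < b"
  shows "strict_mono (pl (a, ks, c))"
proof (rule strict_monoI)
  fix x y :: real assume "x < y"
  then have "0 < rise a ks x y" using assms by (intro rise_pos) auto
  with pl_diff[of a ks c y x] show "pl (a, ks, c) x < pl (a, ks, c) y"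
    by linarith
qed

subsection \<open>Pruning\<close>

fun prune :: "real \<Rightarrow> (real \<times> real) list \<Rightarrow> (real \<times> real) list" where
  "prune a [] = []"
| "prune a ((t, b) # ks) = (if b = a then prune a ks else (t, b) # prune b ks)"

text \<open>A point to the left of all breaks may serve as a break with equal slopes on both sides. Read backwards,
  this removes a kink that does not change the slope.\<close>

lemma rise_insert_break:
  assumes "\<And>s b. (s, b) \<in> set ks \<Longrightarrow> t \<le> s"
  shows "rise a ks x y = a * (min y t - min x t) + rise a ks (max x t) (max y t)"
proof (cases ks)
  case (Cons k r)
  obtain s b where k: "k = (s, b)" by force
  have "t \<le> s" using assms Cons k by auto
  then have "max (max x t) s = max x s" "max (max y t) s = max y s"
    "min y s - min x s = (min y t - min x t) + (min (max y t) s - min (max x t) s)"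
    by (auto simp: min_def max_def)
  then show ?thesis by (simp add: Cons k distrib_left)
qed (auto simp: algebra_simps)

lemma set_prune: "set (prune a ks) \<subseteq> set ks"
  by (induction a ks rule: prune.induct) auto

lemma rise_prune:
  assumes "sorted (map fst ks)"
  shows "rise a (prune a ks) x y = rise a ks x y"
  using assms
proof (induction a ks arbitrary: x y rule: prune.induct)
  case (2 a t b ks)
  then show ?case
    using rise_insert_break[of ks t a x y] by fastforce
qed simp

lemma sorted_prune: "sorted_wrt (<) (map fst ks) \<Longrightarrow> sorted_wrt (<) (map fst (prune a ks))"
  by (induction a ks rule: prune.induct) (use set_prune in fastforce)+

lemma slope_list_prune: "slope_list a (prune a ks) = remdups_adj (slope_list a ks)"
  by (induction a ks rule: prune.induct) auto

lemma reduced_prune: "sorted_wrt (<) (map fst ks) \<Longrightarrow> reduced a (prune a ks)"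
  unfolding reduced_def slope_list_prune by (simp add: sorted_prune)

lemma reduced_Cons:
  "reduced a ((t, b) # ks) \<longleftrightarrow> a \<noteq> b \<and> (\<forall>(s, d) \<in> set ks. t < s) \<and> reduced b ks"
  by (auto simp: reduced_def)

subsection \<open>Edges, breaks and slopes\<close>

lemma rise_deriv:
  assumes "sorted_wrt (<) (map fst ks)" "i \<le> length ks"
    "0 < i \<Longrightarrow> fst (ks ! (i - 1)) < x" "i < length ks \<Longrightarrow> x < fst (ks ! i)"
  shows "(rise a ks z has_real_derivative (slope_list a ks ! i)) (at x)"
  using assms
proof (induction ks arbitrary: a z i)
  case Nil
  then show ?case by (auto intro!: derivative_eq_intros)
next
  case (Cons k ks)
  obtain t b where k: "k = (t, b)" by force
  show ?case
  proof (cases i)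
    case 0
    then have "x < t" using Cons.prems k by simp
    have "((\<lambda>y. a * (y - min z t) + rise b ks (max z t) t) has_real_derivative a) (at x)"
      by (auto intro!: derivative_eq_intros)
    then have "(rise a (k # ks) z has_real_derivative a) (at x)"
      by (rule has_field_derivative_transform_within_open[where S = "{..<t}"])
        (use \<open>x < t\<close> in \<open>auto simp: k min_absorb1 max_absorb2\<close>)
    then show ?thesis using 0 by simp
  next
    case (Suc j)
    have "t < x"
    proof (cases j)
      case 0
      then show ?thesis using Cons.prems Suc k by simp
    next
      case (Suc l)
      then have "fst (ks ! l) < x" "l < length ks" using Cons.prems \<open>i = Suc j\<close> by auto
      moreover have "t < fst (ks ! l)" using Cons.prems(1) k \<open>l < length ks\<close> by auto
      ultimately show ?thesis by simp
    qed
    have "(rise b ks (max z t) has_real_derivative (slope_list b ks ! j)) (at x)"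
      using Cons.prems Suc by (intro Cons.IH) (auto split: nat.split simp: nth_Cons')
    then have "((\<lambda>y. a * (t - min z t) + rise b ks (max z t) y) has_real_derivative (slope_list b ks ! j)) (at x)"
      by (auto intro!: derivative_eq_intros)
    then have "(rise a (k # ks) z has_real_derivative (slope_list b ks ! j)) (at x)"
      by (rule has_field_derivative_transform_within_open[where S = "{t<..}"])
        (use \<open>t < x\<close> in \<open>auto simp: k min_absorb2 max_absorb1\<close>)
    moreover have "slope_list a (k # ks) ! i = slope_list b ks ! j" using Suc k by simp
    ultimately show ?thesis by (simp only:)
  qed
qed

text \<open>The difference quotient at \<open>t\<close> is constantly \<open>a\<close> on the left and \<open>b\<close> on the right, so it has no limit.\<close>

lemma kink_not_differentiable:
  fixes f :: "real \<Rightarrow> real"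
  assumes "a \<noteq> b" "l < t" "t < r"
    "\<And>y. l < y \<Longrightarrow> y \<le> t \<Longrightarrow> f y - f t = a * (y - t)"
    "\<And>y. t \<le> y \<Longrightarrow> y < r \<Longrightarrow> f y - f t = b * (y - t)"
  shows "\<not> f differentiable (at t)"
proof
  assume "f differentiable (at t)"
  then obtain D where "(f has_real_derivative D) (at t)"
    using real_differentiable_def by blast
  then have D: "((\<lambda>y. (f y - f t) / (y - t)) \<longlongrightarrow> D) (at t)"
    by (simp add: has_field_derivative_iff)
  have "((\<lambda>y. (f y - f t) / (y - t)) \<longlongrightarrow> D) (at_left t)"
    using D by (rule tendsto_mono[rotated]) (simp add: at_le)
  moreover have "\<forall>\<^sub>F y in at_left t. (f y - f t) / (y - t) = a"
    using eventually_at_left_real[OF assms(2)] by eventually_elim (use assms(4) in auto)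
  then have "((\<lambda>y. (f y - f t) / (y - t)) \<longlongrightarrow> a) (at_left t)"
    by (rule tendsto_eventually)
  ultimately have "D = a" by (rule tendsto_unique[rotated]) simp
  have "((\<lambda>y. (f y - f t) / (y - t)) \<longlongrightarrow> D) (at_right t)"
    using D by (rule tendsto_mono[rotated]) (simp add: at_le)
  moreover have "\<forall>\<^sub>F y in at_right t. (f y - f t) / (y - t) = b"
    using eventually_at_right_real[OF assms(3)] by eventually_elim (use assms(5) in auto)
  then have "((\<lambda>y. (f y - f t) / (y - t)) \<longlongrightarrow> b) (at_right t)"
    by (rule tendsto_eventually)
  ultimately have "D = b" by (rule tendsto_unique[rotated]) simp
  with \<open>D = a\<close> \<open>a \<noteq> b\<close> show False by simp
qed

lemma rise_not_differentiable:
  assumes "reduced a ks" "(t, d) \<in> set ks"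
  shows "\<not> rise a ks z differentiable (at t)"
  using assms
proof (induction ks arbitrary: a z)
  case (Cons k ks)
  obtain s b where k: "k = (s, b)" by force
  note red = Cons.prems(1)[unfolded k reduced_Cons]
  show ?case
  proof (cases "(t, d) \<in> set ks")
    case True
    then have "s < t" using red by auto
    have "\<not> rise b ks (max z s) differentiable (at t)"
      using Cons.IH red True by blast
    moreover have "rise b ks (max z s) differentiable (at t)"
      if "rise a (k # ks) z differentiable (at t)"
    proof -
      from that obtain D where D: "(rise a (k # ks) z has_real_derivative D) (at t)"
        using real_differentiable_def by blast
      then have "((\<lambda>y. rise a (k # ks) z y - a * (s - min z s)) has_real_derivative D) (at t)"
        by (auto intro!: derivative_eq_intros)
      then have "(rise b ks (max z s) has_real_derivative D) (at t)"
        by (rule has_field_derivative_transform_within_open[where S = "{s<..}"])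
          (use \<open>s < t\<close> in \<open>auto simp: k min_absorb2 max_absorb1\<close>)
      then show ?thesis using real_differentiable_def by blast
    qed
    ultimately show ?thesis by blast
  next
    case False
    then have [simp]: "t = s" using Cons.prems k by auto
    define r where "r = (case ks of [] \<Rightarrow> s + 1 | k # _ \<Rightarrow> fst k)"
    have "s < r" using red by (auto simp: r_def split: list.split)
    have r: "y \<le> u" if "(u, e) \<in> set ks" "y < r" for y u e
      using that red by (fastforce simp: r_def reduced_def split: list.splits)
    show ?thesis unfolding \<open>t = s\<close>
    proof (rule kink_not_differentiable[of a b "s - 1" s r])
      fix y assume "s - 1 < y" "y \<le> s"
      then show "rise a (k # ks) z y - rise a (k # ks) z s = a * (y - s)"
        by (simp add: k min_absorb1 max_absorb2 algebra_simps)
    next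
      fix y assume y: "s \<le> y" "y < r"
      have "rise b ks s y = b * (y - s)"
        using red r y by (intro rise_before) (auto intro: less_imp_le)
      then show "rise a (k # ks) z y - rise a (k # ks) z s = b * (y - s)"
        using rise_add[of b ks "max z s" s y] y by (simp add: k min_absorb2 max_absorb1)
    qed (use red \<open>s < r\<close> in auto)
  qed
qed simp

lemma edge_of_point:
  assumes "sorted_wrt (<) ts" "x \<notin> set ts"
  obtains i where "i \<le> length ts" "0 < i \<Longrightarrow> ts ! (i - 1) < x" "i < length ts \<Longrightarrow> (x::real) < ts ! i"
  using assms
proof (induction ts arbitrary: thesis)
  case Nil
  then show ?case by auto
next
  case (Cons t ts)
  show ?case
  proof (cases "x < t")
    case True
    then show ?thesis by (intro Cons.prems(1)[of 0]) auto
  next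
    case False
    then have "t < x" using Cons.prems by auto
    obtain i where i: "i \<le> length ts" "0 < i \<Longrightarrow> ts ! (i - 1) < x" "i < length ts \<Longrightarrow> x < ts ! i"
      using Cons.IH Cons.prems by auto
    show ?thesis by (rule Cons.prems(1)[of "Suc i"]) (use i \<open>t < x\<close> in \<open>auto simp: nth_Cons'\<close>)
  qed
qed

lemma continuous_rise: "continuous_on UNIV (rise a ks z)"
proof (induction ks arbitrary: a z)
  case (Cons k ks)
  obtain t b where k: "k = (t, b)" by force
  have "rise a (k # ks) z = (\<lambda>y. a * (min y t - min z t) + rise b ks (max z t) (max y t))"
    by (auto simp: k)
  then show ?case
    by (auto intro!: continuous_intros continuous_on_compose2[OF Cons.IH])
qed (auto intro!: continuous_intros)

lemma continuous_pl: "continuous_on UNIV (pl F)"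
proof -
  obtain a ks c where "F = (a, ks, c)" by (cases F)
  then have "pl F = (\<lambda>x. c + rise a ks 0 x)" by auto
  then show ?thesis by (auto intro!: continuous_intros continuous_rise)
qed

lemma pl_has_deriv_iff:
  "(pl (a, ks, c) has_real_derivative D) (at x) \<longleftrightarrow> (rise a ks 0 has_real_derivative D) (at x)"
proof -
  have "pl (a, ks, c) = (\<lambda>x. rise a ks 0 x + c)" by auto
  moreover have "(rise a ks 0 has_real_derivative D) (at x)"
    if "((\<lambda>x. rise a ks 0 x + c) has_real_derivative D) (at x)"
    using DERIV_diff[OF that DERIV_const[of c]] by simp
  ultimately show ?thesis by (auto intro!: derivative_eq_intros)
qed

lemma tropical_roots_pl:
  assumes "reduced a ks"
  shows "tropical_roots (pl (a, ks, c)) = fst ` set ks"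
proof -
  have "pl (a, ks, c) differentiable (at x) \<longleftrightarrow> x \<notin> fst ` set ks" for x
  proof
    show "x \<notin> fst ` set ks" if "pl (a, ks, c) differentiable (at x)"
      using that rise_not_differentiable[OF assms]
      unfolding real_differentiable_def pl_has_deriv_iff by fastforce
  next
    assume "x \<notin> fst ` set ks"
    moreover have s: "sorted_wrt (<) (map fst ks)" using assms by (simp add: reduced_def)
    ultimately obtain i where "i \<le> length ks" "0 < i \<Longrightarrow> map fst ks ! (i - 1) < x"
      "i < length ks \<Longrightarrow> x < map fst ks ! i"
      using edge_of_point[of "map fst ks" x] by auto
    then have "(rise a ks 0 has_real_derivative (slope_list a ks ! i)) (at x)"
      using s by (intro rise_deriv) auto
    then show "pl (a, ks, c) differentiable (at x)"
      unfolding real_differentiable_def pl_has_deriv_iff by blast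
  qed
  then show ?thesis by (auto simp: tropical_roots_def)
qed

lemma breaks_pl:
  assumes "reduced a ks"
  shows "breaks (pl (a, ks, c)) = map fst ks"
proof -
  have "sorted_wrt (<) (map fst ks)" using assms by (simp add: reduced_def)
  then have "sorted_list_of_set (set (map fst ks)) = map fst ks"
    by (intro sorted_list_of_set.idem_if_sorted_distinct) (auto simp: strict_sorted_iff)
  then show ?thesis by (simp add: breaks_def tropical_roots_pl[OF assms])
qed

text \<open>Every edge contains a point, and there the derivative determines the slope.\<close>

lemma has_slopes_unique:
  assumes "has_slopes f as" "has_slopes f bs"
  shows "as = bs"
proof (rule nth_equalityI)
  show len: "length as = length bs" using assms by (simp add: has_slopes_def)
  fix i assume i: "i < length as"
  let ?T = "breaks f"
  have sT: "sorted_wrt (<) ?T" by (simp add: breaks_def)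
  have "\<exists>x. (0 < i \<longrightarrow> ?T ! (i - 1) < x) \<and> (i < length ?T \<longrightarrow> x < ?T ! i)"
  proof (cases "0 < i \<and> i < length ?T")
    case True
    then have "?T ! (i - 1) < ?T ! i" using sorted_wrt_nth_less[OF sT, of "i - 1" i] by auto
    then show ?thesis using dense[of "?T ! (i - 1)" "?T ! i"] by auto
  next
    case False
    then show ?thesis
      using lt_ex[of "?T ! i"] gt_ex[of "?T ! (i - 1)"] by (cases "0 < i") auto
  qed
  then obtain x where "(0 < i \<longrightarrow> ?T ! (i - 1) < x) \<and> (i < length ?T \<longrightarrow> x < ?T ! i)" by blast
  then have "(f has_real_derivative of_int (as ! i)) (at x)" "(f has_real_derivative of_int (bs ! i)) (at x)"
    using assms i len unfolding has_slopes_def by auto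
  then show "as ! i = bs ! i" using DERIV_unique by fastforce
qed

lemma slopes_eq: "has_slopes f as \<Longrightarrow> slopes f = as"
  unfolding slopes_def using has_slopes_unique by blast

lemma has_slopes_pl:
  assumes "reduced a ks" "slope_list a ks = map of_int as"
  shows "has_slopes (pl (a, ks, c)) as"
proof -
  have len: "length as = Suc (length ks)" using arg_cong[OF assms(2), of length] by simp
  have "(pl (a, ks, c) has_real_derivative of_int (as ! i)) (at x)"
    if "i < length as" "0 < i \<longrightarrow> map fst ks ! (i - 1) < x" "i < length ks \<longrightarrow> x < map fst ks ! i" for i x
  proof -
    have "(rise a ks 0 has_real_derivative (slope_list a ks ! i)) (at x)"
      using that assms len by (intro rise_deriv) (auto simp: reduced_def)
    then show ?thesis unfolding pl_has_deriv_iff assms(2) using that by simp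
  qed
  then show ?thesis
    unfolding has_slopes_def breaks_pl[OF assms(1)]
    using continuous_pl len tropical_roots_pl[OF assms(1)] by auto
qed

section \<open>Tropical rational functions are given by kinks\<close>

definition locally_affine_at :: "(real \<Rightarrow> real) \<Rightarrow> real \<Rightarrow> bool" where
  "locally_affine_at f x \<longleftrightarrow> (\<exists>k::int. \<forall>\<^sub>F y in nhds x. f y = f x + of_int k * (y - x))"

lemma locally_affine_at_diff:
  assumes "locally_affine_at f x" "locally_affine_at g x"
  shows "locally_affine_at (\<lambda>y. f y - g y) x"
proof -
  obtain k l :: int where "\<forall>\<^sub>F y in nhds x. f y = f x + of_int k * (y - x)"
    "\<forall>\<^sub>F y in nhds x. g y = g x + of_int l * (y - x)"
    using assms by (auto simp: locally_affine_at_def)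
  then have "\<forall>\<^sub>F y in nhds x. f y - g y = f x - g x + of_int (k - l) * (y - x)"
    by eventually_elim (simp add: algebra_simps)
  then show ?thesis unfolding locally_affine_at_def by blast
qed

text \<open>The slope is locally constant, hence constant on a connected set; the mean value theorem turns a
  constant derivative into an affine function.\<close>

lemma locally_affine_on_interval:
  assumes "open I" "connected I" "I \<noteq> {}" "\<And>x. x \<in> I \<Longrightarrow> locally_affine_at f x"
  obtains k :: int where "\<And>x y. x \<in> I \<Longrightarrow> y \<in> I \<Longrightarrow> f y - f x = of_int k * (y - x)"
proof -
  obtain \<kappa> :: "real \<Rightarrow> int" where
    \<kappa>: "\<And>x. x \<in> I \<Longrightarrow> \<forall>\<^sub>F y in nhds x. f y = f x + of_int (\<kappa> x) * (y - x)"
    using assms(4) unfolding locally_affine_at_def by metis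
  have near: "\<forall>\<^sub>F y in nhds x. (f has_real_derivative of_int (\<kappa> x)) (at y)" if "x \<in> I" for x
    using eventually_eventually[THEN iffD2, OF \<kappa>[OF that]]
  proof eventually_elim
    case (elim y)
    have "((\<lambda>y. f x + of_int (\<kappa> x) * (y - x)) has_real_derivative of_int (\<kappa> x)) (at y)"
      by (auto intro!: derivative_eq_intros)
    then show ?case by (subst DERIV_cong_ev[OF refl elim refl])
  qed
  have deriv: "(f has_real_derivative of_int (\<kappa> x)) (at x)" if "x \<in> I" for x
    using near[OF that] by (rule eventually_nhds_x_imp_x)
  have const: "\<kappa> x = \<kappa> y" if "x \<in> I" "y \<in> I" for x y
  proof (rule connected_local_const[OF assms(2) that], rule ballI)
    fix z assume "z \<in> I"
    from near[OF this] have "\<forall>\<^sub>F y in nhds z. y \<in> I \<longrightarrow> \<kappa> z = \<kappa> y"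
      by eventually_elim (use deriv DERIV_unique in fastforce)
    then show "\<forall>\<^sub>F y in at z within I. \<kappa> z = \<kappa> y"
      by (auto simp: eventually_at_filter elim: eventually_mono)
  qed
  obtain x0 where "x0 \<in> I" using assms(3) by blast
  define k where "k = \<kappa> x0"
  have d: "(f has_real_derivative of_int k) (at x)" if "x \<in> I" for x
    using deriv[OF that] const[OF that \<open>x0 \<in> I\<close>] by (simp add: k_def)
  have less: "f y - f x = of_int k * (y - x)" if xy: "x \<in> I" "y \<in> I" "x < y" for x y
  proof -
    have "{x..y} \<subseteq> I" using assms(2) xy(1,2) by (rule connected_contains_Icc)
    then obtain z where "f y - f x = (y - x) * of_int k"
      using MVT2[of x y f "\<lambda>_. of_int k"] xy(3) d by (auto simp: subset_iff)
    then show ?thesis by simp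
  qed
  show ?thesis
  proof (rule that)
    fix x y assume "x \<in> I" "y \<in> I"
    then show "f y - f x = of_int k * (y - x)"
      using less[of x y] less[of y x] by (cases x y rule: linorder_cases) (auto simp: algebra_simps)
  qed
qed

text \<open>This extends an affine formula from an open edge to its end points, by continuity.\<close>

lemma affine_on_limit_points:
  fixes f :: "real \<Rightarrow> real"
  assumes "continuous_on UNIV f" "\<And>x y. x \<in> I \<Longrightarrow> y \<in> I \<Longrightarrow> f y - f x = k * (y - x)"
    "\<And>e. 0 < e \<Longrightarrow> \<exists>z\<in>I. x - e < z \<and> z < x + e"
    "\<And>e. 0 < e \<Longrightarrow> \<exists>z\<in>I. y - e < z \<and> z < y + e"
  shows "f y - f x = k * (y - x)"
proof -
  have *: "f z - k * z = f w - k * w" if "w \<in> I" and z: "\<And>e. 0 < e \<Longrightarrow> \<exists>u\<in>I. z - e < u \<and> u < z + e" for w z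
  proof (rule ccontr)
    assume "f z - k * z \<noteq> f w - k * w"
    moreover have "open {u. f u - k * u \<noteq> f w - k * w}"
      by (intro open_Collect_neq continuous_intros assms(1))
    ultimately obtain e where "0 < e" "\<And>u. dist u z < e \<Longrightarrow> f u - k * u \<noteq> f w - k * w"
      unfolding open_dist by blast
    moreover from z[OF this(1)] obtain u where "u \<in> I" "dist u z < e"
      by (auto simp: dist_real_def)
    moreover have "f u - k * u = f w - k * w"
      using assms(2)[OF \<open>w \<in> I\<close> \<open>u \<in> I\<close>] by (simp add: right_diff_distrib)
    ultimately show False by blast
  qed
  obtain w where "w \<in> I" using assms(3)[of 1] by auto
  from *[OF this assms(3)] *[OF this assms(4)] show ?thesis by (simp add: algebra_simps)
qed

text \<open>The edges to the right of \<open>l\<close> are collected one at a time, starting from the rightmost one.\<close>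

lemma kinks_right_of:
  assumes f: "continuous_on UNIV f" and "sorted_wrt (<) (l # ts)"
    "\<And>x. l < x \<Longrightarrow> x \<notin> set ts \<Longrightarrow> locally_affine_at f x"
  shows "\<exists>a ks. map fst ks = ts \<and> set (slope_list a ks) \<subseteq> \<int> \<and>
    (\<forall>x y. l \<le> x \<longrightarrow> l \<le> y \<longrightarrow> f y - f x = rise a ks x y)"
  using assms(2,3)
proof (induction ts arbitrary: l)
  case Nil
  obtain k :: int where k: "\<And>x y. x \<in> {l<..} \<Longrightarrow> y \<in> {l<..} \<Longrightarrow> f y - f x = of_int k * (y - x)"
    by (rule locally_affine_on_interval[of "{l<..}" f]) (use Nil in \<open>auto intro: gt_ex\<close>)
  have "f y - f x = of_int k * (y - x)" if "l \<le> x" "l \<le> y" for x y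
  proof (rule affine_on_limit_points[OF f k, of "{l<..}"])
    show "\<exists>z\<in>{l<..}. x - e < z \<and> z < x + e" if "0 < e" for e
      using that \<open>l \<le> x\<close> by (intro bexI[of _ "x + e / 2"]) auto
    show "\<exists>z\<in>{l<..}. y - e < z \<and> z < y + e" if "0 < e" for e
      using that \<open>l \<le> y\<close> by (intro bexI[of _ "y + e / 2"]) auto
  qed
  then show ?case
    by (intro exI[of _ "of_int k"] exI[of _ "[]"]) auto
next
  case (Cons t ts)
  obtain b ks where ks: "map fst ks = ts" "set (slope_list b ks) \<subseteq> \<int>"
    "\<And>x y. t \<le> x \<Longrightarrow> t \<le> y \<Longrightarrow> f y - f x = rise b ks x y"
    using Cons.IH[of t] Cons.prems by auto
  have "l < t" using Cons.prems by auto
  have left: "locally_affine_at f x" if "x \<in> {l<..<t}" for x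
    using that Cons.prems by (intro Cons.prems(2)) fastforce+
  obtain k :: int where k: "\<And>x y. x \<in> {l<..<t} \<Longrightarrow> y \<in> {l<..<t} \<Longrightarrow> f y - f x = of_int k * (y - x)"
    by (rule locally_affine_on_interval[of "{l<..<t}" f])
      (use left dense[OF \<open>l < t\<close>] in auto)
  have k': "f y - f x = of_int k * (y - x)" if "l \<le> x" "x \<le> t" "l \<le> y" "y \<le> t" for x y
  proof (rule affine_on_limit_points[OF f k, of "{l<..<t}"])
    have "\<exists>z\<in>{l<..<t}. u - e < z \<and> z < u + e" if "l \<le> u" "u \<le> t" "0 < e" for u e
      using that \<open>l < t\<close> dense[of "max l (u - e)" "min t (u + e)"] by fastforce
    then show "\<exists>z\<in>{l<..<t}. x - e < z \<and> z < x + e"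
      "\<exists>z\<in>{l<..<t}. y - e < z \<and> z < y + e" if "0 < e" for e
      using that \<open>l \<le> x\<close> \<open>x \<le> t\<close> \<open>l \<le> y\<close> \<open>y \<le> t\<close> by blast+
  qed
  have "f y - f x = rise (of_int k) ((t, b) # ks) x y" if "l \<le> x" "l \<le> y" for x y
  proof -
    have "f y - f x = (f (min y t) - f (min x t)) + (f (max y t) - f (max x t))"
      by (auto simp: min_def max_def)
    then show ?thesis using k'[of "min x t" "min y t"] ks(3)[of "max x t" "max y t"] that \<open>l < t\<close>
      by simp
  qed
  then show ?case
    by (intro exI[of _ "of_int k"] exI[of _ "(t, b) # ks"]) (use ks in auto)
qed

lemma piecewise_affine_is_pl:
  assumes f: "continuous_on UNIV f" and "finite S" "\<And>x. x \<notin> S \<Longrightarrow> locally_affine_at f x"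
  obtains a ks where "reduced a ks" "set (slope_list a ks) \<subseteq> \<int>" "f = pl (a, ks, f 0)"
proof -
  (* the additional point 0 ensures that there is a first break *)
  define T where "T = sorted_list_of_set (insert 0 S)"
  have T: "sorted_wrt (<) T" "set T = insert 0 S" using assms(2) by (auto simp: T_def simp del: sorted_list_of_set_insert_remove)
  then obtain t ts where T_eq: "T = t # ts" by (cases T) auto
  obtain b ks where ks: "map fst ks = ts" "set (slope_list b ks) \<subseteq> \<int>"
    "\<And>x y. t \<le> x \<Longrightarrow> t \<le> y \<Longrightarrow> f y - f x = rise b ks x y"
  proof -
    have "locally_affine_at f x" if "t < x" "x \<notin> set ts" for x
    proof -
      have "x \<notin> set T" using that by (simp add: T_eq)
      then show ?thesis using T(2) assms(3) by auto
    qed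
    then show thesis using kinks_right_of[OF f, of t ts] T(1) T_eq that by blast
  qed
  have left: "locally_affine_at f x" if "x < t" for x
  proof -
    have "x \<notin> set T" using that T(1) unfolding T_eq by auto
    then show ?thesis using T(2) assms(3) by auto
  qed
  obtain k :: int where k: "\<And>x y. x \<in> {..<t} \<Longrightarrow> y \<in> {..<t} \<Longrightarrow> f y - f x = of_int k * (y - x)"
    by (rule locally_affine_on_interval[of "{..<t}" f])
      (use left lt_ex in auto)
  have k': "f y - f x = of_int k * (y - x)" if "x \<le> t" "y \<le> t" for x y
  proof (rule affine_on_limit_points[OF f k, of "{..<t}"])
    show "\<exists>z\<in>{..<t}. x - e < z \<and> z < x + e" if "0 < e" for e
      using that \<open>x \<le> t\<close> by (intro bexI[of _ "x - e / 2"]) auto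
    show "\<exists>z\<in>{..<t}. y - e < z \<and> z < y + e" if "0 < e" for e
      using that \<open>y \<le> t\<close> by (intro bexI[of _ "y - e / 2"]) auto
  qed
  have rise: "f y - f x = rise (of_int k) ((t, b) # ks) x y" for x y
  proof -
    have "f y - f x = (f (min y t) - f (min x t)) + (f (max y t) - f (max x t))"
      by (auto simp: min_def max_def)
    then show ?thesis using k'[of "min x t" "min y t"] ks(3)[of "max x t" "max y t"]
      by simp
  qed
  let ?ks = "prune (of_int k) ((t, b) # ks)"
  have s: "sorted_wrt (<) (map fst ((t, b) # ks))" using T T_eq ks(1) by auto
  then have s': "sorted (map fst ((t, b) # ks))" by (rule strict_sorted_imp_sorted)
  have "f x = pl (of_int k, ?ks, f 0) x" for x
    unfolding pl.simps rise_prune[OF s'] using rise[of x 0] by simp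
  moreover have "set (slope_list (of_int k) ?ks) \<subseteq> \<int>"
    unfolding slope_list_prune using ks(2) by auto
  ultimately show thesis using that[OF reduced_prune[OF s]] by blast
qed

lemma tropical_polynomial_lines:
  assumes "tropical_polynomial p"
  obtains I :: "nat set" and b :: "nat \<Rightarrow> real" where "finite I" "I \<noteq> {}"
    "\<And>x. p x = (MIN i\<in>I. real i * x + b i)"
proof -
  obtain d and a :: "nat \<Rightarrow> ereal" where a: "\<And>i. i \<le> d \<Longrightarrow> a i \<noteq> -\<infinity>"
    and p: "\<And>x. ereal (p x) = (MIN i\<in>{0..d}. ereal (real i * x) + a i)"
    using assms by (auto simp: tropical_polynomial_def)
  define I where "I = {i. i \<le> d \<and> a i \<noteq> \<infinity>}"
  define b where "b i = real_of_ereal (a i)" for i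
  have b: "a i = ereal (b i)" if "i \<in> I" for i
    using that a[of i] by (cases "a i") (auto simp: I_def b_def)
  have fin: "finite I" by (simp add: I_def)
  have ge: "p x \<le> real i * x + b i" if "i \<in> I" for x i
  proof -
    have "ereal (p x) \<le> ereal (real i * x) + a i"
      unfolding p using that by (intro Min_le) (auto simp: I_def)
    then show ?thesis using b[OF that] by simp
  qed
  have at: "\<exists>i\<in>I. p x = real i * x + b i" for x
  proof -
    have "ereal (p x) \<in> (\<lambda>i. ereal (real i * x) + a i) ` {0..d}"
      unfolding p by (intro Min_in) auto
    then obtain i where i: "i \<le> d" "ereal (p x) = ereal (real i * x) + a i" by auto
    then have "i \<in> I" by (auto simp: I_def)
    with i b show ?thesis by auto
  qed
  show ?thesis
  proof (rule that[OF fin])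
    show "I \<noteq> {}" using at[of 0] by auto
    show "p x = (MIN i\<in>I. real i * x + b i)" for x
      by (rule Min_eqI[symmetric]) (use fin ge at in \<open>auto simp: image_iff\<close>)
  qed
qed

text \<open>Away from the finitely many intersections of two of its lines, a minimum of lines is
  attained by a single one of them, also nearby.\<close>

lemma tropical_polynomial_piecewise:
  assumes "tropical_polynomial p"
  shows "continuous_on UNIV p" "\<exists>S. finite S \<and> (\<forall>x. x \<notin> S \<longrightarrow> locally_affine_at p x)"
proof -
  obtain I :: "nat set" and b where I: "finite I" "I \<noteq> {}" and p: "\<And>x. p x = (MIN i\<in>I. real i * x + b i)"
    using tropical_polynomial_lines[OF assms] by metis
  let ?l = "\<lambda>i x. real i * x + b i"
  have cont: "continuous_on UNIV (\<lambda>x. MIN i\<in>J. ?l i x)" if "finite J" "J \<noteq> {}" for J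
    using that by (induction rule: finite_ne_induct) (auto intro!: continuous_intros)
  have "p = (\<lambda>x. MIN i\<in>I. ?l i x)" using p by auto
  then show "continuous_on UNIV p" using cont[OF I] by simp
  (* all crossings of two lines; the pairs i = j only add the point 0 *)
  define S where "S = (\<lambda>(i, j). (b j - b i) / (real i - real j)) ` (I \<times> I)"
  have "finite S" using I by (auto simp: S_def)
  moreover have "locally_affine_at p x" if "x \<notin> S" for x
  proof -
    have "p x \<in> (\<lambda>i. ?l i x) ` I" unfolding p using I by (intro Min_in) auto
    then obtain i where i: "i \<in> I" "p x = ?l i x" by auto
    have "\<forall>\<^sub>F y in nhds x. ?l i y < ?l j y" if j: "j \<in> I" "j \<noteq> i" for j
    proof -
      have "p x \<le> ?l j x" unfolding p using I j by (intro Min_le) auto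
      moreover have "?l i x \<noteq> ?l j x"
      proof
        assume "?l i x = ?l j x"
        then have "x = (b j - b i) / (real i - real j)" using j by (simp add: field_simps)
        then show False using \<open>x \<notin> S\<close> i j by (force simp: S_def)
      qed
      ultimately have "0 < ?l j x - ?l i x" using i by simp
      moreover have "((\<lambda>y. ?l j y - ?l i y) \<longlongrightarrow> ?l j x - ?l i x) (nhds x)"
        by (intro tendsto_intros) (auto simp: filterlim_ident)
      ultimately have "\<forall>\<^sub>F y in nhds x. 0 < ?l j y - ?l i y" by (rule order_tendstoD(1)[rotated])
      then show ?thesis by (auto elim: eventually_mono)
    qed
    then have "\<forall>\<^sub>F y in nhds x. \<forall>j\<in>I - {i}. ?l i y < ?l j y"
      using I by (intro eventually_ball_finite) auto
    then have "\<forall>\<^sub>F y in nhds x. p y = p x + of_int (int i) * (y - x)"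
    proof eventually_elim
      case (elim y)
      have "p y = ?l i y" unfolding p
        by (rule Min_eqI) (use I i elim in \<open>auto simp: less_imp_le dest: bspec\<close>)
      then show ?case using i by (simp add: algebra_simps)
    qed
    then show ?thesis unfolding locally_affine_at_def by blast
  qed
  ultimately show "\<exists>S. finite S \<and> (\<forall>x. x \<notin> S \<longrightarrow> locally_affine_at p x)" by blast
qed

lemma tropical_rational_is_pl:
  assumes "tropical_rational f"
  obtains a ks where "reduced a ks" "set (slope_list a ks) \<subseteq> \<int>" "f = pl (a, ks, f 0)"
proof -
  obtain p q where pq: "tropical_polynomial p" "tropical_polynomial q" "f = (\<lambda>x. p x - q x)"
    using assms by (auto simp: tropical_rational_def)
  obtain S T where "finite S" "\<And>x. x \<notin> S \<Longrightarrow> locally_affine_at p x"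
    "finite T" "\<And>x. x \<notin> T \<Longrightarrow> locally_affine_at q x"
    using pq tropical_polynomial_piecewise(2) by metis
  then have "finite (S \<union> T)" "\<And>x. x \<notin> S \<union> T \<Longrightarrow> locally_affine_at f x"
    using locally_affine_at_diff by (auto simp: pq(3))
  moreover have "continuous_on UNIV f"
    unfolding pq(3) using pq(1,2) by (intro continuous_intros tropical_polynomial_piecewise(1))
  ultimately show thesis using piecewise_affine_is_pl that by blast
qed

lemma tropical_polynomial_rational:
  assumes "tropical_polynomial f"
  shows "tropical_rational f"
proof -
  have "tropical_polynomial (\<lambda>_. 0)"
    unfolding tropical_polynomial_def by (intro exI[of _ 0] exI[of _ "\<lambda>_. 0"]) simp
  then show ?thesis using assms unfolding tropical_rational_def
    by (intro exI[of _ f] exI[of _ "\<lambda>_. 0"]) simp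
qed

section \<open>Two ways of factoring out an inner function\<close>

text \<open>A triple \<open>(t, w, d)\<close> labels the edge to the right of the break \<open>t\<close> with the slope \<open>w\<close> of the inner and
  the slope \<open>d\<close> of the outer function. Since \<open>v\<close> is nondecreasing, it commutes with clamping:
  \<open>v (min x t) = min (v x) (v t)\<close>. So the part of the increment that belongs to an edge is multiplied
  by \<open>w\<close> under \<open>v\<close> and by \<open>d\<close> under the outer function. The set \<open>A\<close> shrinks to a half line in the
  induction, where the edges passed so far do not contribute to the increments of \<open>v\<close>.\<close>

lemma rise_reparam:
  assumes "mono v" "sorted (map fst ls)"
    "\<And>x y. x \<in> A \<Longrightarrow> y \<in> A \<Longrightarrow> v y - v x = rise u (map (\<lambda>(t, w, d). (t, w)) ls) x y"
    "fst ` set ls \<subseteq> A" "x \<in> A" "y \<in> A"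
  shows "rise (a * u) (map (\<lambda>(t, w, d). (t, d * w)) ls) x y
    = rise a (map (\<lambda>(t, w, d). (v t, d)) ls) (v x) (v y)"
  using assms(2-)
proof (induction ls arbitrary: a u A x y)
  case Nil
  then show ?case by simp
next
  case (Cons l ls)
  obtain t w b where l: "l = (t, w, b)" by (cases l) auto
  let ?vs = "map (\<lambda>(t, w, d). (t, w)) ls"
  have t: "t \<in> A" using Cons.prems(3) l by auto
  have mm: "min (v z) (v t) = v (min z t)" "max (v z) (v t) = v (max z t)" for z
    using monoD[OF assms(1), of z t] monoD[OF assms(1), of t z] by (auto simp: min_def max_def)
  have minA: "min z t \<in> A" if "z \<in> A" for z using that t by (simp add: min_def)
  have "v (min y t) - v (min x t) = u * (min y t - min x t)"
    using Cons.prems(2)[OF minA[OF Cons.prems(4)] minA[OF Cons.prems(5)]] l by (simp add: max_absorb2)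
  moreover have "rise (b * w) (map (\<lambda>(t, w, d). (t, d * w)) ls) (max x t) (max y t)
    = rise b (map (\<lambda>(t, w, d). (v t, d)) ls) (v (max x t)) (v (max y t))"
  proof (rule Cons.IH[of "A \<inter> {t..}"])
    show "sorted (map fst ls)" using Cons.prems(1) by simp
    show "v y - v x = rise w ?vs x y" if "x \<in> A \<inter> {t..}" "y \<in> A \<inter> {t..}" for x y
      using Cons.prems(2)[of x y] that l by (simp add: max_absorb1 min_absorb2)
    show "fst ` set ls \<subseteq> A \<inter> {t..}" using Cons.prems(1,3) l by auto
    show "max x t \<in> A \<inter> {t..}" "max y t \<in> A \<inter> {t..}"
      using Cons.prems(4,5) t by (auto simp: max_def)
  qed
  ultimately have "a * u * (min y t - min x t) = a * (v (min y t) - v (min x t))"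
    "rise (b * w) (map (\<lambda>(t, w, d). (t, d * w)) ls) (max x t) (max y t)
      = rise b (map (\<lambda>(t, w, d). (v t, d)) ls) (v (max x t)) (v (max y t))"
    by simp_all
  then show ?case by (simp only: l mm list.map prod.case rise.simps)
qed

text \<open>The normalization \<open>v 0 = 0\<close> makes the values of both sides at 0 agree without any evaluation of
  the given function.\<close>

theorem pl_factor:
  assumes "sorted (map fst ls)" "0 \<le> u" "\<And>t w d. (t, w, d) \<in> set ls \<Longrightarrow> 0 \<le> w"
  defines "v \<equiv> pl (u, map (\<lambda>(t, w, d). (t, w)) ls, 0)"
  shows "pl (a * u, map (\<lambda>(t, w, d). (t, d * w)) ls, c)
    = pl (a, map (\<lambda>(t, w, d). (v t, d)) ls, c) \<circ> v"
proof
  fix x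
  have "mono v" unfolding v_def by (rule pl_mono) (use assms(2,3) in auto)
  then have "rise (a * u) (map (\<lambda>(t, w, d). (t, d * w)) ls) 0 x
    = rise a (map (\<lambda>(t, w, d). (v t, d)) ls) (v 0) (v x)"
    using assms(1) by (rule rise_reparam[where A = UNIV]) (simp_all only: v_def pl_diff UNIV_I subset_UNIV)
  moreover have "v 0 = 0" by (simp add: v_def)
  ultimately show "pl (a * u, map (\<lambda>(t, w, d). (t, d * w)) ls, c) x
    = (pl (a, map (\<lambda>(t, w, d). (v t, d)) ls, c) \<circ> v) x"
    by simp
qed

lemma rise_split:
  assumes "\<And>s b. (s, b) \<in> set K \<Longrightarrow> s \<le> p" "\<And>s b. (s, b) \<in> set M \<Longrightarrow> p \<le> s"
  shows "rise a (K @ M) x y = rise a K (min x p) (min y p)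
    + rise (last (slope_list a K)) M (max x p) (max y p)"
  using assms(1)
proof (induction K arbitrary: a x y)
  case Nil
  then show ?case using rise_insert_break[of M p a x y] assms(2) by auto
next
  case (Cons k K)
  obtain t b where k: "k = (t, b)" by force
  have "t \<le> p" using Cons.prems k by auto
  then have "min (max z t) p = max (min z p) t" "max (max z t) p = max z p"
    "min (min z p) t = min z t" for z
    by (auto simp: min_def max_def)
  moreover have "rise b (K @ M) (max x t) (max y t) = rise b K (min (max x t) p) (min (max y t) p)
    + rise (last (slope_list b K)) M (max (max x t) p) (max (max y t) p)"
  proof (rule Cons.IH)
    show "s \<le> p" if "(s, d) \<in> set K" for s d using Cons.prems[of s d] that by simp
  qed
  ultimately show ?case by (simp add: k)
qed

lemma rise_shift: "rise a (map (\<lambda>(t, b). (t + k, b)) ks) (x + k) (y + k) = rise a ks x y"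
proof (induction ks arbitrary: a x y)
  case (Cons l ks)
  obtain t b where l: "l = (t, b)" by force
  have "min (z + k) (t + k) = min z t + k" "max (z + k) (t + k) = max z t + k" for z
    by (auto simp: min_def max_def)
  then show ?case by (simp add: l Cons.IH)
qed simp

fun alternate :: "real \<Rightarrow> real list \<Rightarrow> (real \<times> real) list" where
  "alternate a [] = []"
| "alternate a (t # ts) = (t, - a) # alternate (- a) ts"

lemma alternate_append:
  "alternate a (P @ R) = alternate a P @ alternate (last (slope_list a (alternate a P))) R"
  by (induction P arbitrary: a) auto

lemma fst_alternate [simp]: "map fst (alternate a ts) = ts"
  by (induction ts arbitrary: a) auto

lemma snd_alternate_map [simp]: "map snd (alternate a (map g ts)) = map snd (alternate a ts)"
  by (induction ts arbitrary: a) auto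

lemma alternate_shift:
  "alternate a (map (\<lambda>t. t + k) ts) = map (\<lambda>(t, b). (t + k, b)) (alternate a ts)"
  by (induction ts arbitrary: a) auto

lemma in_alternateD: "(s, b) \<in> set (alternate a ts) \<Longrightarrow> s \<in> set ts"
  using set_map[of fst "alternate a ts"] by (metis fst_alternate fst_conv image_eqI)

text \<open>Every increment is a difference of two increments from \<open>p\<close>, and those split at \<open>q\<close>.\<close>

lemma additive_eqI:
  fixes F G :: "real \<Rightarrow> real \<Rightarrow> real"
  assumes "\<And>x y z. F x y + F y z = F x z" "\<And>x y z. G x y + G y z = G x z" and "p \<le> q"
    and left: "\<And>x y. x \<le> p \<Longrightarrow> y \<le> p \<Longrightarrow> F x y = G x y"
    and mid: "\<And>x y. \<lbrakk>p \<le> x; p \<le> y; x \<le> q; y \<le> q\<rbrakk> \<Longrightarrow> F x y = G x y"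
    and right: "\<And>x y. q \<le> x \<Longrightarrow> q \<le> y \<Longrightarrow> F x y = G x y"
  shows "F x y = G x y"
proof -
  have *: "F p z = G p z" for z
  proof (cases "q \<le> z")
    case True
    then have "F p q = G p q" "F q z = G q z" using mid right \<open>p \<le> q\<close> by auto
    with assms(1,2)[of p q z] show ?thesis by simp
  next
    case False
    then show ?thesis using left[of p z] mid[of p z] by (cases "z \<le> p") auto
  qed
  from assms(1,2)[of p x y] *[of x] *[of y] show ?thesis by simp
qed

text \<open>The map \<open>g\<close> is a translation to the left of \<open>p\<close> and to the right of \<open>q\<close>, and a reflection between
  them. Its image of \<open>[p, q]\<close> is an interval of the same length, and the assumptions on \<open>P\<close> and \<open>R\<close> say
  that the images of all other breaks lie outside the interior of this interval. So on each of the three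
  pieces, the outer zigzag repeats the given one up to the translation or reflection.\<close>

lemma rise_fold:
  assumes "p < q" "\<And>s. s \<in> set P \<Longrightarrow> s \<le> p - (q - p)" "\<And>s. s \<in> set R \<Longrightarrow> q + (q - p) \<le> s"
  defines "g \<equiv> pl (1, [(p, -1), (q, 1)], 0)"
  shows "rise a (alternate a (P @ p # q # R)) x y
    = rise a (alternate a (map g P @ map g R)) (g x) (g y)"
proof -
  define k where "k = g p - p"
  define k' where "k' = g q - q"
  have g_le: "g x = x + k" if "x \<le> p" for x
    using pl_diff[of 1 "[(p, -1), (q, 1)]" 0 x p] that \<open>p < q\<close>
    by (simp add: g_def k_def min_absorb1 max_absorb2)
  have g_mid: "g x = (p + k) - (x - p)" if "p \<le> x" "x \<le> q" for x
    using pl_diff[of 1 "[(p, -1), (q, 1)]" 0 x p] that \<open>p < q\<close>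
    by (simp add: g_def k_def min_absorb1 min_absorb2 max_absorb1 max_absorb2)
  have g_ge: "g x = x + k'" if "q \<le> x" for x
    using pl_diff[of 1 "[(p, -1), (q, 1)]" 0 x q] that \<open>p < q\<close>
    by (simp add: g_def k'_def min_absorb1 min_absorb2 max_absorb1 max_absorb2)
  have gp: "g p = p + k" by (simp add: k_def)
  have gq: "g q = (p + k) - (q - p)" using g_mid[of q] \<open>p < q\<close> by simp
  have k': "q + k' = g q" by (simp add: k'_def)
  define \<tau> where "\<tau> = last (slope_list a (alternate a P))"
  define M where "M = alternate \<tau> (p # q # R)"
  have M: "M = (p, - \<tau>) # (q, \<tau>) # alternate \<tau> R" by (simp add: M_def)
  have leP: "s \<le> p" "g s \<le> g q" if "s \<in> set P" for s
    using assms(2)[OF that] g_le[of s] gp gq \<open>p < q\<close> by auto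
  have geR: "q \<le> s" "g p \<le> g s" if "s \<in> set R" for s
    using assms(3)[OF that] g_ge[of s] gp gq k' \<open>p < q\<close> by auto
  have gP: "s \<le> g q" if "s \<in> set (map g P)" for s
    using that leP(2) by auto
  have gR: "g p \<le> s" if "s \<in> set (map g R)" for s
    using that geR(2) by auto
  have mapP: "map g P = map (\<lambda>t. t + k) P"
    by (rule map_cong[OF refl]) (rule g_le[OF leP(1)])
  have mapR: "map g R = map (\<lambda>t. t + k') R"
    by (rule map_cong[OF refl]) (rule g_ge[OF geR(1)])
  have shiftP: "rise a (alternate a (map g P)) (g x) (g y) = rise a (alternate a P) x y"
    if "x \<le> p" "y \<le> p" for x y
    unfolding g_le[OF that(1)] g_le[OF that(2)] mapP alternate_shift
    by (rule rise_shift)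
  have shiftR: "rise b (alternate b (map g R)) (g x) (g y) = rise b (alternate b R) x y"
    if "q \<le> x" "q \<le> y" for b x y
    unfolding g_ge[OF that(1)] g_ge[OF that(2)] mapR alternate_shift
    by (rule rise_shift)
  have \<tau>': "\<tau> = last (slope_list a (alternate a (map g P)))" by (simp add: \<tau>_def del: last.simps)
  have L: "rise a (alternate a (P @ p # q # R)) x y
      = rise a (alternate a P) (min x p) (min y p) + rise \<tau> M (max x p) (max y p)" for x y
    unfolding alternate_append \<tau>_def M_def
  proof (rule rise_split)
    show "s \<le> p" if "(s, b) \<in> set (alternate a P)" for s b
      using leP(1) in_alternateD[OF that] by blast
    show "p \<le> s" if "(s, b) \<in> set (alternate (last (slope_list a (alternate a P))) (p # q # R))" for s b
      using in_alternateD[OF that] geR(1) \<open>p < q\<close> by fastforce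
  qed
  have R: "rise a (alternate a (map g P @ map g R)) x y
      = rise a (alternate a (map g P)) (min x m) (min y m)
        + rise \<tau> (alternate \<tau> (map g R)) (max x m) (max y m)" if "g q \<le> m" "m \<le> g p" for x y m
    unfolding alternate_append \<tau>'[symmetric] unfolding \<tau>'
  proof (rule rise_split)
    show "s \<le> m" if "(s, b) \<in> set (alternate a (map g P))" for s b
      using gP in_alternateD[OF that] \<open>g q \<le> m\<close> by fastforce
    show "m \<le> s" if "(s, b) \<in> set (alternate (last (slope_list a (alternate a (map g P)))) (map g R))" for s b
      using gR in_alternateD[OF that] \<open>m \<le> g p\<close> by fastforce
  qed
  have gpq: "g q \<le> g p" using gp gq \<open>p < q\<close> by simp
  show ?thesis
  proof (rule additive_eqI[where p = p and q = q and F = "rise a (alternate a (P @ p # q # R))"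
        and G = "\<lambda>x y. rise a (alternate a (map g P @ map g R)) (g x) (g y)"])
    fix x y assume xy: "x \<le> p" "y \<le> p"
    then have "g x \<le> g p" "g y \<le> g p" using gp g_le[of x] g_le[of y] by simp_all
    then show "rise a (alternate a (P @ p # q # R)) x y
      = rise a (alternate a (map g P @ map g R)) (g x) (g y)"
      unfolding L R[OF gpq order_refl] using xy
      by (simp add: min_absorb1 max_absorb2 shiftP)
  next
    fix x y assume xy: "p \<le> x" "p \<le> y" "x \<le> q" "y \<le> q"
    have b: "g q \<le> g x" "g q \<le> g y" "g x \<le> g p" "g y \<le> g p"
      using g_mid[of x] g_mid[of y] xy gp gq by simp_all
    have "rise \<tau> (alternate \<tau> (map g R)) (g x) (g y) = \<tau> * (g y - g x)"
    proof (rule rise_before)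
      show "g x \<le> s \<and> g y \<le> s" if "(s, b) \<in> set (alternate \<tau> (map g R))" for s b
        using gR[OF in_alternateD[OF that]] b by linarith
    qed
    moreover have "rise \<tau> M x y = - \<tau> * (y - x)"
      using xy by (simp add: M min_absorb1 min_absorb2 max_absorb1 max_absorb2)
    moreover have "g y - g x = - (y - x)" using g_mid[of x] g_mid[of y] xy by simp
    ultimately have "rise \<tau> M x y = rise \<tau> (alternate \<tau> (map g R)) (g x) (g y)"
      by (simp only: mult_minus_left mult_minus_right)
    then show "rise a (alternate a (P @ p # q # R)) x y
      = rise a (alternate a (map g P @ map g R)) (g x) (g y)"
      unfolding L R[OF order_refl gpq] using b xy by (simp add: min_absorb2 max_absorb1)
  next
    fix x y assume xy: "q \<le> x" "q \<le> y"
    have b: "g q \<le> g x" "g q \<le> g y" using g_ge[of x] g_ge[of y] xy k' by simp_all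
    have "rise \<tau> M x y = rise \<tau> (alternate \<tau> R) x y"
      using xy \<open>p < q\<close> by (simp add: M min_absorb2 max_absorb1)
    then show "rise a (alternate a (P @ p # q # R)) x y
      = rise a (alternate a (map g P @ map g R)) (g x) (g y)"
      unfolding L R[OF order_refl gpq] using b xy \<open>p < q\<close>
      by (simp add: min_absorb2 max_absorb1 shiftR)
  qed (use \<open>p < q\<close> in \<open>simp_all only: rise_add less_imp_le\<close>)
qed

theorem pl_fold:
  assumes "p < q" "\<And>s. s \<in> set P \<Longrightarrow> s \<le> p - (q - p)" "\<And>s. s \<in> set R \<Longrightarrow> q + (q - p) \<le> s"
  defines "g \<equiv> pl (1, [(p, -1), (q, 1)], 0)"
  shows "pl (a, alternate a (P @ p # q # R), c) = pl (a, alternate a (map g P @ map g R), c) \<circ> g"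
proof
  fix x
  have "g 0 = 0" by (simp add: g_def)
  then show "pl (a, alternate a (P @ p # q # R), c) x
    = (pl (a, alternate a (map g P @ map g R), c) \<circ> g) x"
    using rise_fold[of p q P R a 0 x, folded g_def] assms(1-3) by simp
qed

section \<open>Binomials and trinomials in terms of kinks\<close>

lemma kinked_form:
  "pl (a, [(t, b)], c) x = (c - a * min 0 t - b * max 0 t) + a * min x t + b * max x (t :: real)"
  by (simp add: algebra_simps)

text \<open>The lines meet over \<open>t\<close>, and there the sign of their difference changes.\<close>

lemma line_pair:
  fixes a b :: real
  assumes "a \<noteq> b" "t = (\<beta> - \<alpha>) / (a - b)"
  shows "(if b < a then min (a * x + \<alpha>) (b * x + \<beta>) else max (a * x + \<alpha>) (b * x + \<beta>))
    = (\<alpha> - b * t) + a * min x t + b * max x t"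
proof -
  have at: "a * t + \<alpha> = b * t + \<beta>" using assms by (simp add: field_simps)
  have eq: "(a * x + \<alpha>) - (b * x + \<beta>) = (a - b) * (x - t)" using at by (simp add: algebra_simps)
  show ?thesis
  proof (cases "x \<le> t")
    case True
    then have "b < a \<Longrightarrow> (a - b) * (x - t) \<le> 0" "\<not> b < a \<Longrightarrow> 0 \<le> (a - b) * (x - t)"
      by (simp_all add: mult_nonneg_nonpos mult_nonpos_nonpos)
    then have "(if b < a then min (a * x + \<alpha>) (b * x + \<beta>) else max (a * x + \<alpha>) (b * x + \<beta>)) = a * x + \<alpha>"
      unfolding eq[symmetric] by (simp add: min_absorb1 max_absorb1)
    then show ?thesis using True by (simp add: min_absorb1 max_absorb2)
  next
    case False
    then have "b < a \<Longrightarrow> 0 \<le> (a - b) * (x - t)" "\<not> b < a \<Longrightarrow> (a - b) * (x - t) \<le> 0"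
      by (simp_all add: mult_nonneg_nonneg mult_nonpos_nonneg)
    then have "(if b < a then min (a * x + \<alpha>) (b * x + \<beta>) else max (a * x + \<alpha>) (b * x + \<beta>)) = b * x + \<beta>"
      unfolding eq[symmetric] by (simp add: min_absorb2 max_absorb2)
    then show ?thesis using False at by (simp add: min_absorb2 max_absorb1)
  qed
qed

lemma pl_line_pair:
  fixes a b :: real
  assumes "a \<noteq> b"
  obtains \<alpha> \<beta> where "pl (a, [(t, b)], c)
    = (\<lambda>x. if b < a then min (a * x + \<alpha>) (b * x + \<beta>) else max (a * x + \<alpha>) (b * x + \<beta>))"
proof
  let ?\<alpha> = "c - a * min 0 t - b * max 0 t + b * t"
  let ?\<beta> = "?\<alpha> + (a - b) * t"
  have "t = (?\<beta> - ?\<alpha>) / (a - b)" using assms by simp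
  from line_pair[OF assms this] show "pl (a, [(t, b)], c) = (\<lambda>x. if b < a
    then min (a * x + ?\<alpha>) (b * x + ?\<beta>) else max (a * x + ?\<alpha>) (b * x + ?\<beta>))"
    unfolding kinked_form by (simp add: fun_eq_iff)
qed

lemma line_pair_pl:
  fixes a b :: real
  assumes "a \<noteq> b"
  obtains t c where "(\<lambda>x. if b < a then min (a * x + \<alpha>) (b * x + \<beta>) else max (a * x + \<alpha>) (b * x + \<beta>))
    = pl (a, [(t, b)], c)"
proof -
  define t where "t = (\<beta> - \<alpha>) / (a - b)"
  define c where "c = (\<alpha> - b * t) + a * min 0 t + b * max 0 t"
  have "(\<lambda>x. if b < a then min (a * x + \<alpha>) (b * x + \<beta>) else max (a * x + \<alpha>) (b * x + \<beta>))
    = pl (a, [(t, b)], c)"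
    unfolding line_pair[OF assms t_def] by (rule ext, simp only: kinked_form, simp add: c_def)
  then show thesis by (rule that)
qed

lemma binomial_pl:
  assumes "a \<noteq> 0" "b \<noteq> 0" "a \<noteq> b"
  shows "binomial_of_slopes a b (pl (of_int a, [(t, of_int b)], c))"
proof -
  obtain \<alpha> \<beta> where "pl (of_int a, [(t, of_int b)], c) = (\<lambda>x. if of_int b < (of_int a :: real)
     then min (of_int a * x + \<alpha>) (of_int b * x + \<beta>) else max (of_int a * x + \<alpha>) (of_int b * x + \<beta>))"
  proof -
    have "of_int a \<noteq> (of_int b :: real)" using assms(3) by simp
    from pl_line_pair[OF this, of t c] show thesis using that by blast
  qed
  then have "pl (of_int a, [(t, of_int b)], c) = (\<lambda>x. min (of_int a * x + \<alpha>) (of_int b * x + \<beta>)) \<or>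
    pl (of_int a, [(t, of_int b)], c) = (\<lambda>x. max (of_int a * x + \<alpha>) (of_int b * x + \<beta>))"
    by (cases "b < a") (simp_all only: of_int_less_iff if_True if_False simp_thms)
  then show ?thesis using assms unfolding binomial_of_slopes_def by blast
qed

lemma binomial_is_pl:
  assumes "binomial_of_slopes b1 b2 g"
  obtains a b t c where "{a, b} = {b1, b2}" "g = pl (of_int a, [(t, of_int b)], c)"
proof -
  obtain \<beta>1 \<beta>2 :: real where
    g: "g = (\<lambda>x. min (of_int b1 * x + \<beta>1) (of_int b2 * x + \<beta>2)) \<or>
     g = (\<lambda>x. max (of_int b1 * x + \<beta>1) (of_int b2 * x + \<beta>2))" and "b1 \<noteq> b2"
    using assms by (auto simp: binomial_of_slopes_def)
  define L where "L a b \<alpha> \<beta> x = (if of_int b < (of_int a :: real)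
    then min (of_int a * x + \<alpha>) (of_int b * x + \<beta>) else max (of_int a * x + \<alpha>) (of_int b * x + \<beta>))"
    for a b :: int and \<alpha> \<beta> x :: real
  have "L b1 b2 \<beta>1 \<beta>2 = (if b2 < b1 then (\<lambda>x. min (of_int b1 * x + \<beta>1) (of_int b2 * x + \<beta>2))
      else (\<lambda>x. max (of_int b1 * x + \<beta>1) (of_int b2 * x + \<beta>2)))"
    by (simp add: L_def fun_eq_iff)
  moreover have "L b2 b1 \<beta>2 \<beta>1 = (if b1 < b2 then (\<lambda>x. min (of_int b1 * x + \<beta>1) (of_int b2 * x + \<beta>2))
      else (\<lambda>x. max (of_int b1 * x + \<beta>1) (of_int b2 * x + \<beta>2)))"
    by (simp add: L_def fun_eq_iff min.commute max.commute)
  ultimately have "g = L b1 b2 \<beta>1 \<beta>2 \<or> g = L b2 b1 \<beta>2 \<beta>1"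
    using g \<open>b1 \<noteq> b2\<close> by (cases "b2 < b1") auto
  then obtain a b \<alpha> \<beta> where ab: "{a, b} = {b1, b2}" "g = L a b \<alpha> \<beta>"
    by blast
  then have "of_int a \<noteq> (of_int b :: real)" using \<open>b1 \<noteq> b2\<close> by (auto simp: doubleton_eq_iff)
  then obtain t c where eq: "(\<lambda>x. if of_int b < (of_int a :: real)
    then min (of_int a * x + \<alpha>) (of_int b * x + \<beta>) else max (of_int a * x + \<alpha>) (of_int b * x + \<beta>))
    = pl (of_int a, [(t, of_int b)], c)"
    using line_pair_pl[of "of_int a" "of_int b" \<alpha> \<beta>] by blast
  show thesis
  proof (rule that[OF ab(1)])
    show "g = pl (of_int a, [(t, of_int b)], c)"
      unfolding ab(2) L_def[abs_def] by (rule eq)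
  qed
qed

definition proper :: "real \<Rightarrow> (real \<times> real) list \<Rightarrow> bool" where
  "proper a ks \<longleftrightarrow> reduced a ks \<and> set (slope_list a ks) \<subseteq> \<int>"

fun proper_data :: "kinked \<Rightarrow> bool" where
  "proper_data (a, ks, c) \<longleftrightarrow> proper a ks"

lemma proper_slopes:
  assumes "proper a ks"
  shows "has_slopes (pl (a, ks, c)) (slopes (pl (a, ks, c)))"
    "map of_int (slopes (pl (a, ks, c))) = slope_list a ks"
proof -
  let ?as = "map floor (slope_list a ks)"
  have "map of_int ?as = slope_list a ks"
    unfolding map_map using assms by (intro map_idI) (auto simp: proper_def elim!: Ints_cases)
  moreover from this have "has_slopes (pl (a, ks, c)) ?as"
    using assms by (intro has_slopes_pl) (auto simp: proper_def)
  ultimately show "has_slopes (pl (a, ks, c)) (slopes (pl (a, ks, c)))"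
    "map of_int (slopes (pl (a, ks, c))) = slope_list a ks"
    by (simp_all add: slopes_eq)
qed

lemma length_slopes_pl: "proper a ks \<Longrightarrow> length (slopes (pl (a, ks, c))) = Suc (length ks)"
  using arg_cong[OF proper_slopes(2)[of a ks c], of length] by simp

definition one_sign :: "real list \<Rightarrow> bool" where
  "one_sign xs \<longleftrightarrow> (\<forall>x\<in>set xs. 0 < x) \<or> (\<forall>x\<in>set xs. x < 0)"

lemma monotone_slopes_iff: "monotone_slopes as \<longleftrightarrow> one_sign (map of_int as)"
  by (auto simp: monotone_slopes_def one_sign_def)

lemma monotone_piece:
  assumes "proper a ks" "one_sign (slope_list a ks)" "ks \<noteq> []" "length ks \<le> 2"
  shows "monotone_binomial (pl (a, ks, c)) \<or> monotone_trinomial (pl (a, ks, c))"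
proof (cases "length ks = 1")
  case True
  then obtain t b where ks: "ks = [(t, b)]" by (cases ks) auto
  obtain i j :: int where ij: "a = of_int i" "b = of_int j"
    using assms(1) ks by (auto simp: proper_def elim!: Ints_cases)
  have "i \<noteq> j" "i \<noteq> 0" "j \<noteq> 0" "sgn i = sgn j"
    using assms(1,2) by (auto simp: proper_def reduced_def ks ij one_sign_def sgn_if)
  then show ?thesis using binomial_pl[of i j t c] unfolding monotone_binomial_def ks ij by blast
next
  case False
  then have "length ks = 2" using assms(3,4) by (cases ks; cases "tl ks") auto
  then have "length (slopes (pl (a, ks, c))) = 3" using length_slopes_pl[OF assms(1)] by simp
  then show ?thesis
    using proper_slopes[OF assms(1), of c] assms(2)
    unfolding monotone_trinomial_def monotone_slopes_iff by metis
qed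

lemma pm1_binomial_pl:
  assumes "a = 1 \<or> a = -1"
  shows "pm1_binomial (pl (a, alternate a [t], c))"
proof -
  define i :: int where "i = (if a = 1 then 1 else -1)"
  have i: "a = of_int i" "- a = of_int (- i)" "i = 1 \<or> i = -1"
    using assms by (auto simp: i_def)
  have "binomial_of_slopes i (- i) (pl (of_int i, [(t, of_int (- i))], c))"
    using i(3) by (intro binomial_pl) auto
  moreover have "sgn i \<noteq> sgn (- i)" using i(3) by auto
  moreover have "\<bar>i\<bar> = 1" "\<bar>- i\<bar> = 1" using i(3) by auto
  ultimately have "pm1_binomial (pl (of_int i, [(t, of_int (- i))], c))"
    unfolding pm1_binomial_def by blast
  then show ?thesis using i(1) by simp
qed

lemma pm1_trinomial_pl:
  assumes "a = 1 \<or> a = -1" "s < t"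
  shows "pm1_trinomial (pl (a, alternate a [s, t], c))"
proof -
  define i :: int where "i = (if a = 1 then 1 else -1)"
  have i: "a = of_int i" "i = 1 \<or> i = -1" using assms by (auto simp: i_def)
  have red: "reduced a (alternate a [s, t])" using assms by (auto simp: reduced_def)
  have "slope_list a (alternate a [s, t]) = map of_int [i, - i, i]"
    using i(1) by simp
  from has_slopes_pl[OF red this, of c] show ?thesis
    unfolding pm1_trinomial_def using i(2) by (intro exI[of _ "[i, - i, i]"]) (auto simp: monotone_slopes_def)
qed

lemma pm1_binomial_not_trinomial: "pm1_binomial g \<Longrightarrow> \<not> pm1_trinomial g"
proof
  assume "pm1_binomial g" "pm1_trinomial g"
  then obtain b1 b2 as where g: "binomial_of_slopes b1 b2 g" "has_slopes g as" "length as = 3"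
    by (auto simp: pm1_binomial_def pm1_trinomial_def)
  obtain a b t c where ab: "{a, b} = {b1, b2}" "g = pl (of_int a, [(t, of_int b)], c)"
    using binomial_is_pl[OF g(1)] .
  have "b1 \<noteq> b2" using g(1) by (auto simp: binomial_of_slopes_def)
  then have "reduced (of_int a) [(t, of_int b)]"
    using ab(1) by (auto simp: reduced_def doubleton_eq_iff)
  then have "has_slopes g [a, b]" unfolding ab(2) by (rule has_slopes_pl) simp
  with g has_slopes_unique have "as = [a, b]" by blast
  with g(3) show False by simp
qed

section \<open>Factorizations in reduced form\<close>

text \<open>The inner and outer function of a factorization with labelled edges; pruning leaves only the
  genuine breaks.\<close>

definition inner :: "real \<Rightarrow> (real \<times> real \<times> real) list \<Rightarrow> kinked" where
  "inner u ls = (u, prune u (map (\<lambda>(t, w, d). (t, w)) ls), 0)"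

definition outer :: "real \<Rightarrow> real \<Rightarrow> (real \<times> real \<times> real) list \<Rightarrow> real \<Rightarrow> kinked" where
  "outer u b ls c = (b, prune b (map (\<lambda>(t, w, d). (pl (inner u ls) t, d)) ls), c)"

text \<open>An edge with inner slope 0 is collapsed to a point, so the outer slope assigned to it is arbitrary. It
  has to repeat the slope \<open>p\<close> before it: then pruning removes its kink, and no two breaks of the outer
  function coincide.\<close>

fun collapse_ok :: "real \<Rightarrow> (real \<times> real \<times> real) list \<Rightarrow> bool" where
  "collapse_ok p [] \<longleftrightarrow> True"
| "collapse_ok p ((t, w, d) # ls) \<longleftrightarrow> 0 \<le> w \<and> (w = 0 \<longrightarrow> d = p) \<and> collapse_ok d ls"

lemma collapse_ok_nonneg: "collapse_ok p ls \<Longrightarrow> (t, w, d) \<in> set ls \<Longrightarrow> 0 \<le> w"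
  by (induction p ls rule: collapse_ok.induct) auto

lemma collapse_ok_pos: "(\<And>t w d. (t, w, d) \<in> set ls \<Longrightarrow> 0 < w) \<Longrightarrow> collapse_ok p ls"
proof (induction p ls rule: collapse_ok.induct)
  case (2 p t w d ls)
  have "0 < w" by (rule "2.prems"[of t w d]) simp
  moreover have "collapse_ok d ls" using "2.prems" by (intro "2.IH") auto
  ultimately show ?case by simp
qed simp

lemma map_fst_triple: "map fst (map (\<lambda>(t, w, d). (t, w)) ls) = map fst ls"
  "map fst (map (\<lambda>(t, w, d). (h t, d)) ls) = map h (map fst ls)"
  by (auto simp: case_prod_beta)

lemma pl_prune:
  assumes "sorted (map fst ks)"
  shows "pl (a, prune a ks, c) = pl (a, ks, c)"
  using rise_prune[OF assms] by auto

lemma pl_inner: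
  assumes "sorted_wrt (<) (map fst ls)"
  shows "pl (inner u ls) = pl (u, map (\<lambda>(t, w, d). (t, w)) ls, 0)"
proof -
  have "sorted (map fst (map (\<lambda>(t, w, d). (t, w)) ls))"
    unfolding map_fst_triple using assms by (rule strict_sorted_imp_sorted)
  then show ?thesis unfolding inner_def by (rule pl_prune)
qed

lemma mono_pl_inner:
  assumes "sorted_wrt (<) (map fst ls)" "0 \<le> u" "collapse_ok b ls"
  shows "mono (pl (inner u ls))"
  unfolding pl_inner[OF assms(1)]
  by (rule pl_mono) (use assms(2) collapse_ok_nonneg[OF assms(3)] in auto)

lemma outer_inner:
  assumes "sorted_wrt (<) (map fst ls)" "0 \<le> u" "collapse_ok b ls"
  shows "pl (b * u, map (\<lambda>(t, w, d). (t, d * w)) ls, c) = pl (outer u b ls c) \<circ> pl (inner u ls)"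
proof -
  have s: "sorted (map fst ls)" using assms(1) by (rule strict_sorted_imp_sorted)
  then have "sorted (map (pl (inner u ls)) (map fst ls))"
    using mono_pl_inner[OF assms] by (auto simp: sorted_map monoD elim!: sorted_wrt_mono_rel[rotated])
  then have "pl (outer u b ls c) = pl (b, map (\<lambda>(t, w, d). (pl (inner u ls) t, d)) ls, c)"
    unfolding outer_def by (intro pl_prune) (simp only: map_fst_triple)
  moreover note pl_factor[OF s assms(2), of b c] collapse_ok_nonneg[OF assms(3)]
  ultimately show ?thesis by (simp only: pl_inner[OF assms(1)])
qed

lemma rise_pos_left:
  assumes "0 < a" "\<And>s b. (s, b) \<in> set ks \<Longrightarrow> t < s \<and> 0 \<le> b" "t < x"
  shows "0 < rise a ks t x"
proof (cases ks)
  case Nil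
  then show ?thesis using assms by simp
next
  case (Cons k r)
  obtain s b where k: "k = (s, b)" by force
  have "t < s" "0 \<le> b" using assms(2) Cons k by auto
  moreover have "0 \<le> rise b r (max t s) (max x s)"
    using assms(2) Cons k \<open>t < x\<close> by (intro rise_nonneg) auto
  moreover have "0 < a * (min x s - min t s)"
    using assms(1,3) \<open>t < s\<close> by (intro mult_pos_pos) auto
  ultimately show ?thesis by (simp add: Cons k)
qed

text \<open>A kink survives pruning only if the slope changes there; then the edge after it is not collapsed and
  \<open>v\<close> separates it from all later kinks.\<close>

lemma sorted_reparam:
  assumes "mono v" "sorted_wrt (<) (map fst ls)" "collapse_ok p ls"
    "\<And>x y. x \<in> A \<Longrightarrow> y \<in> A \<Longrightarrow> v y - v x = rise u (map (\<lambda>(t, w, d). (t, w)) ls) x y"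
    "fst ` set ls \<subseteq> A"
  shows "sorted_wrt (<) (map fst (prune p (map (\<lambda>(t, w, d). (v t, d)) ls)))"
  using assms(2-)
proof (induction ls arbitrary: p u A)
  case Nil
  then show ?case by simp
next
  case (Cons l ls)
  obtain t w d where l: "l = (t, w, d)" by (cases l) auto
  let ?vs = "map (\<lambda>(t, w, d). (t, w)) ls" and ?ds = "map (\<lambda>(t, w, d). (v t, d)) ls"
  have A: "v y - v x = rise w ?vs x y" if "x \<in> A \<inter> {t..}" "y \<in> A \<inter> {t..}" for x y
    using Cons.prems(3)[of x y] that l by (simp add: max_absorb1 min_absorb2)
  have gt: "t < fst k" if "k \<in> set ls" for k using Cons.prems(1) l that by auto
  have sub: "fst ` set ls \<subseteq> A \<inter> {t..}" using Cons.prems(4) gt l by (auto intro: less_imp_le)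
  have IH: "sorted_wrt (<) (map fst (prune d ?ds))"
    by (rule Cons.IH[OF _ _ A sub]) (use Cons.prems(1,2) l in auto)
  show ?case
  proof (cases "d = p")
    case True
    then show ?thesis using IH l by simp
  next
    case False
    then have w: "0 < w" using Cons.prems(2) l by auto
    have "v t < s" if "(s, e) \<in> set (prune d ?ds)" for s e
    proof -
      have "(s, e) \<in> set ?ds" using that set_prune by blast
      then obtain t' w' where t': "(t', w', e) \<in> set ls" "s = v t'" by auto
      have "0 < rise w ?vs t t'"
      proof (rule rise_pos_left[OF w])
        show "t < s \<and> 0 \<le> b" if "(s, b) \<in> set ?vs" for s b
          using that gt collapse_ok_nonneg[of d ls] Cons.prems(2) l by fastforce
        show "t < t'" using gt[OF t'(1)] by simp
      qed
      moreover have "v t' - v t = rise w ?vs t t'"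
        using A[of t t'] sub t'(1) Cons.prems(4) l by force
      ultimately show ?thesis using t'(2) by simp
    qed
    then show ?thesis using IH False l by auto
  qed
qed

lemma reduced_outer:
  assumes "sorted_wrt (<) (map fst ls)" "0 \<le> u" "collapse_ok b ls" "outer u b ls c = (b', js, c')"
  shows "reduced b' js"
proof -
  have "sorted_wrt (<) (map fst (prune b (map (\<lambda>(t, w, d). (pl (inner u ls) t, d)) ls)))"
    by (rule sorted_reparam[OF mono_pl_inner[OF assms(1-3)] assms(1,3), of UNIV u])
      (simp_all only: pl_inner[OF assms(1)] pl_diff subset_UNIV)
  moreover have "b' = b" "js = prune b (map (\<lambda>(t, w, d). (pl (inner u ls) t, d)) ls)"
    using assms(4) by (auto simp: outer_def)
  ultimately show ?thesis unfolding reduced_def by (simp add: slope_list_prune[unfolded list.map])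
qed

lemma slope_list_outer:
  assumes "outer u b ls c = (b', js, c')"
  shows "b' = b" "c' = c" "slope_list b' js = remdups_adj (b # map (snd \<circ> snd) ls)"
  using assms by (auto simp: outer_def slope_list_prune[unfolded list.map] case_prod_beta comp_def)

lemma slope_list_inner:
  assumes "inner u ls = (u', vs, c')"
  shows "u' = u" "c' = 0" "slope_list u' vs = remdups_adj (u # map (fst \<circ> snd) ls)"
  using assms by (auto simp: inner_def slope_list_prune[unfolded list.map] case_prod_beta comp_def)

lemma reduced_inner:
  assumes "sorted_wrt (<) (map fst ls)" "inner u ls = (u', vs, c')"
  shows "reduced u' vs"
  using assms reduced_prune[of "map (\<lambda>(t, w, d). (t, w)) ls" u]
  unfolding map_fst_triple by (auto simp: inner_def)

lemma compose_Nil [simp]: "compose [] = id"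
  and compose_Cons [simp]: "compose (g # gs) = g \<circ> compose gs"
  by (simp_all add: compose_def)

section \<open>Decomposing monotone functions\<close>

text \<open>The first two edges get the inner slopes \<open>\<bar>a\<^sub>0\<bar>, \<bar>a\<^sub>1\<bar>\<close> and the common outer slope \<open>sgn a\<^sub>1\<close>, all others the
  inner slope 1. The first edge has no break of its own, so its labels are passed separately.\<close>

definition peel_labels :: "(real \<times> real) list \<Rightarrow> (real \<times> real \<times> real) list" where
  "peel_labels ks = (case ks of [] \<Rightarrow> [] | (t, b) # r \<Rightarrow> (t, \<bar>b\<bar>, sgn b) # map (\<lambda>(s, d). (s, 1, d)) r)"

definition peel_sign :: "(real \<times> real) list \<Rightarrow> real" where
  "peel_sign ks = (case ks of [] \<Rightarrow> 1 | (t, b) # r \<Rightarrow> sgn b)"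

definition mono_step :: "kinked list \<times> kinked \<Rightarrow> kinked list \<times> kinked" where
  "mono_step = (\<lambda>(acc, a, ks, c). (inner \<bar>a\<bar> (peel_labels ks) # acc,
     outer \<bar>a\<bar> (peel_sign ks) (peel_labels ks) c))"

definition mono_cond :: "kinked list \<times> kinked \<Rightarrow> bool" where
  "mono_cond = (\<lambda>(acc, a, ks, c). 2 < length ks)"

definition mono_loop :: "kinked \<Rightarrow> kinked list" where
  "mono_loop F = (case while mono_cond mono_step ([], F) of (acc, G) \<Rightarrow> G # acc)"

text \<open>A linear function \<open>a * x\<close> with \<open>a > 1\<close> is not a binomial, but it is the composition of
  \<open>max {x, a * x}\<close> and \<open>min {a * x, x}\<close>, whose kinks at 0 cancel.\<close>

definition mono_decomposition :: "kinked \<Rightarrow> kinked list" where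
  "mono_decomposition F = (case F of (a, ks, c) \<Rightarrow>
     if ks = [] then (if a = 1 then [] else [(1, [(0, a)], 0), (a, [(0, 1)], 0)]) else mono_loop F)"

lemma length_prune: "length (prune a ks) \<le> length ks"
  by (induction a ks rule: prune.induct) auto

lemma prune_Nil_iff: "prune a ks = [] \<longleftrightarrow> (\<forall>b\<in>snd ` set ks. b = a)"
  by (induction a ks rule: prune.induct) auto

lemma mono_step_decreases:
  assumes "mono_cond s"
  shows "length (fst (snd (snd (mono_step s)))) < length (fst (snd (snd s)))"
proof -
  obtain acc a t b ks c where s: "s = (acc, a, (t, b) # ks, c)"
    using assms by (cases s; cases "fst (snd (snd s))") (auto simp: mono_cond_def)
  show ?thesis
    by (simp add: s mono_step_def outer_def peel_labels_def peel_sign_def case_prod_beta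
        le_imp_less_Suc order_trans[OF length_prune])
qed

definition monotone_invariant :: "kinked \<Rightarrow> kinked list \<times> kinked \<Rightarrow> bool" where
  "monotone_invariant F = (\<lambda>(acc, a, ks, c). pl F = pl (a, ks, c) \<circ> compose (map pl acc) \<and>
     proper a ks \<and> one_sign (slope_list a ks) \<and> ks \<noteq> [] \<and>
     length acc + length ks \<le> length (fst (snd F)) \<and>
     (\<forall>g\<in>set acc. proper_data g \<and> (monotone_binomial (pl g) \<or> monotone_trinomial (pl g))))"

text \<open>With at least three breaks left, the third break of the outer function is genuine, as neither of its
  adjacent slopes has been changed. So the loop never arrives at an affine function.\<close>

lemma mono_step_invariant:
  assumes "monotone_invariant F s" "mono_cond s"
  shows "monotone_invariant F (mono_step s)"
proof -
  obtain acc a t1 a1 t2 a2 t3 a3 r c where s: "s = (acc, a, (t1, a1) # (t2, a2) # (t3, a3) # r, c)"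
  proof -
    obtain acc a ks c where s: "s = (acc, a, ks, c)" by (cases s) auto
    then have "2 < length ks" using assms(2) by (simp add: mono_cond_def)
    then obtain k1 k2 k3 r where "ks = k1 # k2 # k3 # r"
      by (cases ks; cases "tl ks"; cases "tl (tl ks)") auto
    with s that show thesis by (cases k1; cases k2; cases k3) blast
  qed
  define ks where "ks = (t1, a1) # (t2, a2) # (t3, a3) # r"
  define ls where "ls = peel_labels ks"
  note inv = assms(1)[unfolded monotone_invariant_def s prod.case, folded ks_def]
  have red: "reduced a ks" and int: "set (slope_list a ks) \<subseteq> \<int>" and sg: "one_sign (slope_list a ks)"
    using inv by (auto simp: proper_def)
  have ls: "ls = (t1, \<bar>a1\<bar>, sgn a1) # map (\<lambda>(s, d). (s, 1, d)) ((t2, a2) # (t3, a3) # r)"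
    by (simp add: ls_def ks_def peel_labels_def)
  have fst_ls: "map fst ls = map fst ks" by (auto simp: ls ks_def)
  have sorted: "sorted_wrt (<) (map fst ls)" unfolding fst_ls using red by (simp add: reduced_def)
  have ne: "a \<noteq> a1" "a1 \<noteq> a2" "a2 \<noteq> a3" "a \<noteq> 0" "a1 \<noteq> 0" and sgn: "sgn a = sgn a1"
    using red sg by (auto simp: reduced_def ks_def one_sign_def)
  have ok: "collapse_ok (sgn a1) ls" by (rule collapse_ok_pos) (use ne in \<open>auto simp: ls\<close>)
  have prod: "map (\<lambda>(t, w, d). (t, d * w)) ls = ks"
    by (simp add: ls ks_def sgn_mult_abs comp_def case_prod_beta)
  have prod0: "sgn a1 * \<bar>a\<bar> = a" unfolding sgn[symmetric] by (rule sgn_mult_abs)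
  have comp: "pl (a, ks, c) = pl (outer \<bar>a\<bar> (sgn a1) ls c) \<circ> pl (inner \<bar>a\<bar> ls)"
    using outer_inner[OF sorted abs_ge_zero ok, of a c] unfolding prod prod0 .
  obtain u vs where v: "inner \<bar>a\<bar> ls = (u, vs, 0)" by (simp add: inner_def)
  obtain b js where o: "outer \<bar>a\<bar> (sgn a1) ls c = (b, js, c)" by (simp add: outer_def)
  have "\<bar>a\<bar> \<noteq> \<bar>a1\<bar>" using ne sgn by (metis sgn_mult_abs)
  then have "vs = (t1, \<bar>a1\<bar>) # prune \<bar>a1\<bar> ((t2, 1) # map (\<lambda>k. (fst k, 1)) ((t3, a3) # r))"
    using v by (auto simp: inner_def ls comp_def case_prod_beta)
  moreover have "prune 1 (map (\<lambda>k. (fst k, 1)) ((t3, a3) # r)) = []"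
    unfolding prune_Nil_iff by auto
  ultimately have vs: "vs \<noteq> []" "length vs \<le> 2" by auto
  have "set (slope_list u vs) \<subseteq> {\<bar>a\<bar>, \<bar>a1\<bar>, 1}"
    unfolding slope_list_inner(3)[OF v] remdups_adj_set by (auto simp: ls)
  moreover have "\<bar>a\<bar> \<in> \<int>" "\<bar>a1\<bar> \<in> \<int>" using int by (auto simp: ks_def)
  ultimately have "proper u vs" "one_sign (slope_list u vs)"
    using reduced_inner[OF sorted v] ne unfolding proper_def one_sign_def by fastforce+
  then have g: "proper u vs" "monotone_binomial (pl (u, vs, 0)) \<or> monotone_trinomial (pl (u, vs, 0))"
    using monotone_piece vs by blast+
  have ojs: "slope_list b js = remdups_adj (sgn a1 # sgn a1 # a2 # a3 # map snd r)"
    unfolding slope_list_outer(3)[OF o] by (simp add: ls comp_def case_prod_beta)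
  have set_js: "set (slope_list b js) = {sgn a1, a2, a3} \<union> snd ` set r"
    unfolding ojs remdups_adj_set by auto
  have "sgn a1 \<in> \<int>" by (simp add: sgn_if)
  then have "proper b js" using reduced_outer[OF sorted _ ok o] int
    unfolding proper_def set_js by (auto simp: ks_def)
  moreover have "one_sign (slope_list b js)"
    using sg unfolding one_sign_def set_js by (auto simp: ks_def sgn_if)
  moreover have "js \<noteq> []"
  proof
    assume "js = []"
    then have "set (slope_list b js) = {b}" by simp
    with set_js ne(3) show False by auto
  qed
  moreover have "length js < length ks"
    using mono_step_decreases[OF assms(2)] o
    by (simp add: s mono_step_def ks_def[symmetric] ls_def[symmetric] peel_sign_def)
      (simp add: ks_def)
  ultimately show ?thesis
    using inv g comp o v
    by (simp add: monotone_invariant_def mono_step_def s ks_def[symmetric] ls_def[symmetric] comp_assoc)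
      (simp add: ks_def peel_sign_def o)
qed

theorem mono_loop_correct:
  fixes c :: real
  assumes "proper a ks" "one_sign (slope_list a ks)" "ks \<noteq> []"
  defines "gs \<equiv> mono_loop (a, ks, c)"
  shows "pl (a, ks, c) = compose (map pl gs)" "length gs \<le> length ks"
    "\<forall>g\<in>set gs. proper_data g \<and> (monotone_binomial (pl g) \<or> monotone_trinomial (pl g))"
proof -
  obtain acc G where w: "while mono_cond mono_step ([], (a, ks, c)) = (acc, G)"
    by (cases "while mono_cond mono_step ([], (a, ks, c))") blast
  have "monotone_invariant (a, ks, c) (acc, G) \<and> \<not> mono_cond (acc, G)"
    unfolding w[symmetric]
  proof (rule while_rule[where P = "monotone_invariant (a, ks, c)"
        and r = "measure (\<lambda>s. length (fst (snd (snd s))))"])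
    show "monotone_invariant (a, ks, c) ([], a, ks, c)"
      using assms(1-3) by (simp add: monotone_invariant_def)
  qed (auto simp: mono_step_invariant mono_step_decreases)
  moreover obtain a' ks' c' where G: "G = (a', ks', c')" by (cases G)
  ultimately have inv: "monotone_invariant (a, ks, c) (acc, a', ks', c')" and "length ks' \<le> 2"
    by (auto simp: mono_cond_def)
  then have "proper_data G \<and> (monotone_binomial (pl G) \<or> monotone_trinomial (pl G))"
    unfolding G by (intro conjI monotone_piece) (auto simp: monotone_invariant_def)
  moreover have gs: "gs = G # acc" by (simp add: gs_def mono_loop_def w)
  ultimately show "\<forall>g\<in>set gs. proper_data g \<and> (monotone_binomial (pl g) \<or> monotone_trinomial (pl g))"
    using inv by (auto simp: monotone_invariant_def)
  show "pl (a, ks, c) = compose (map pl gs)"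
    using inv by (simp add: gs G monotone_invariant_def)
  have "0 < length ks'" "length acc + length ks' \<le> length ks"
    using inv by (simp_all add: monotone_invariant_def)
  then show "length gs \<le> length ks" unfolding gs list.size by linarith
qed

lemma linear_decomposition:
  assumes "0 \<le> a"
  shows "pl (a, [], c) = compose (map pl [(1, [(0, a)], c), (a, [(0, 1)], 0)])"
proof
  fix x :: real
  have "0 \<le> a * min x 0 \<longleftrightarrow> a = 0 \<or> 0 \<le> x" "0 \<le> a * x \<longleftrightarrow> a = 0 \<or> 0 \<le> x"
    using assms by (auto simp: zero_le_mult_iff min_def)
  then show "pl (a, [], c) x = compose (map pl [(1, [(0, a)], c), (a, [(0, 1)], 0)]) x"
    using assms by (cases "0 \<le> x") (auto simp: min_def max_def)
qed

theorem mono_decomposition_correct: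
  assumes "proper a ks" "one_sign (slope_list a ks)" "ks \<noteq> [] \<or> 0 < a \<and> c = 0"
  defines "gs \<equiv> mono_decomposition (a, ks, c)"
  shows "pl (a, ks, c) = compose (map pl gs)" "ks \<noteq> [] \<Longrightarrow> length gs \<le> length ks" "length gs \<le> max 2 (length ks)"
    "\<forall>g\<in>set gs. proper_data g \<and> (monotone_binomial (pl g) \<or> monotone_trinomial (pl g))"
proof -
  let ?pieces = "\<forall>g\<in>set gs. proper_data g \<and> (monotone_binomial (pl g) \<or> monotone_trinomial (pl g))"
  have "pl (a, ks, c) = compose (map pl gs) \<and> (ks \<noteq> [] \<longrightarrow> length gs \<le> length ks) \<and>
    length gs \<le> max 2 (length ks) \<and> ?pieces"
  proof (cases "ks = []")
    case True
    then have a: "0 < a" "c = 0" "a \<in> \<int>" using assms(1,3) by (auto simp: proper_def)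
    show ?thesis
    proof (cases "a = 1")
      case False
      have "proper 1 [(0, a)]" "proper a [(0, 1)]" "one_sign [1, a]" "one_sign [a, 1]"
        using a False by (auto simp: proper_def reduced_def one_sign_def)
      then have "proper_data g \<and> (monotone_binomial (pl g) \<or> monotone_trinomial (pl g))" if "g \<in> {(1, [(0, a)], 0), (a, [(0, 1)], 0)}" for g
        using that monotone_piece[of 1 "[(0, a)]" 0] monotone_piece[of a "[(0, 1)]" 0] by auto
      moreover have "gs = [(1, [(0, a)], 0), (a, [(0, 1)], 0)]"
        using True False by (simp add: gs_def mono_decomposition_def)
      ultimately show ?thesis using linear_decomposition[of a 0] a True by (auto simp del: pl.simps)
    qed (use a True in \<open>auto simp: gs_def mono_decomposition_def\<close>)
  next
    case False
    then show ?thesis using mono_loop_correct[OF assms(1,2) False, of c]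
      by (simp add: gs_def mono_decomposition_def)
  qed
  then show "pl (a, ks, c) = compose (map pl gs)" "ks \<noteq> [] \<Longrightarrow> length gs \<le> length ks"
    "length gs \<le> max 2 (length ks)" ?pieces by blast+
qed

section \<open>Decomposing zigzags\<close>

text \<open>The scan moves to the right as long as the next bounded edge is shorter. The first list of the state
  holds the breaks passed, in reverse order.\<close>

definition scan_cond :: "real list \<times> real list \<Rightarrow> bool" where
  "scan_cond = (\<lambda>(P, ts). case ts of p # q # r # R \<Rightarrow> r - q < q - p | _ \<Rightarrow> False)"

definition scan_step :: "real list \<times> real list \<Rightarrow> real list \<times> real list" where
  "scan_step = (\<lambda>(P, ts). case ts of [] \<Rightarrow> (P, []) | p # R \<Rightarrow> (p # P, R))"

definition scan :: "real list \<Rightarrow> real list \<times> real list" where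
  "scan ts = while scan_cond scan_step ([], ts)"

text \<open>Where the scan stops, the edge \<open>[p, q]\<close> is shorter than the one before it, because the scan moved on, and
  not longer than the one after it, if that edge is bounded.\<close>

lemma scan_correct:
  assumes "sorted_wrt (<) ts" "2 \<le> length ts"
  obtains P p q R where "scan ts = (P, p # q # R)" "ts = rev P @ p # q # R"
    "\<And>s. s \<in> set P \<Longrightarrow> s \<le> p - (q - p)" "\<And>s. s \<in> set R \<Longrightarrow> q + (q - p) \<le> s"
proof -
  define I where "I = (\<lambda>(P, us). \<exists>p q R. us = p # q # R \<and> ts = rev P @ us \<and> (\<forall>s\<in>set P. s \<le> p - (q - p)))"
  have "I (scan ts) \<and> \<not> scan_cond (scan ts)"
    unfolding scan_def
  proof (rule while_rule[where P = I and r = "measure (\<lambda>s. length (snd s))"])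
    show "I ([], ts)" using assms(2) by (cases ts; cases "tl ts") (auto simp: I_def)
  next
    fix s assume I: "I s" and c: "scan_cond s"
    obtain P p q R where s: "s = (P, p # q # R)" and ts: "ts = rev P @ p # q # R"
      and P: "\<forall>u\<in>set P. u \<le> p - (q - p)" using I by (auto simp: I_def)
    obtain r R' where R: "R = r # R'" "r - q < q - p"
      using c by (cases R) (auto simp: s scan_cond_def)
    have "p < q" using assms(1) by (auto simp: ts sorted_wrt_append)
    then have "\<forall>u\<in>set (p # P). u \<le> q - (r - q)" using P R(2) by fastforce
    then show "I (scan_step s)" by (simp add: I_def s scan_step_def ts R(1))
    show "(scan_step s, s) \<in> measure (\<lambda>s. length (snd s))" by (simp add: s scan_step_def)
  qed auto
  then obtain P p q R where s: "scan ts = (P, p # q # R)" and ts: "ts = rev P @ p # q # R"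
    and P: "\<forall>s\<in>set P. s \<le> p - (q - p)" and c: "\<not> scan_cond (P, p # q # R)"
    by (auto simp: I_def)
  have "q + (q - p) \<le> s" if "s \<in> set R" for s
  proof -
    obtain r R' where R: "R = r # R'" using \<open>s \<in> set R\<close> by (cases R) auto
    have "q - p \<le> r - q" using c by (simp add: R scan_cond_def)
    moreover have "r \<le> s" using that assms(1) by (auto simp: ts R sorted_wrt_append)
    ultimately show ?thesis by simp
  qed
  then show thesis using that s ts P by blast
qed

definition fold_map :: "real \<Rightarrow> real \<Rightarrow> kinked" where
  "fold_map p q = (1, [(p, -1), (q, 1)], 0)"

definition zigzag_step :: "kinked list \<times> real list \<Rightarrow> kinked list \<times> real list" where
  "zigzag_step = (\<lambda>(acc, ts). case scan ts of (P, us) \<Rightarrow> (case us of [] \<Rightarrow> (acc, []) |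
     p # vs \<Rightarrow> (case vs of [] \<Rightarrow> (acc, []) |
       q # R \<Rightarrow> (fold_map p q # acc, map (pl (fold_map p q)) (rev P @ R)))))"

definition zigzag_cond :: "kinked list \<times> real list \<Rightarrow> bool" where
  "zigzag_cond = (\<lambda>(acc, ts). 2 < length ts)"

text \<open>Folding at inner breaks does not change the leftmost slope, so only the breaks are transformed.\<close>

definition zigzag_decomposition :: "real \<Rightarrow> real list \<Rightarrow> real \<Rightarrow> kinked list" where
  "zigzag_decomposition a ts c =
     (case while zigzag_cond zigzag_step ([], ts) of (acc, us) \<Rightarrow> (a, alternate a us, c) # acc)"

lemma scan_length: "length (fst (scan ts)) + length (snd (scan ts)) = length ts"
  unfolding scan_def
proof (rule while_rule[where P = "\<lambda>s. length (fst s) + length (snd s) = length ts" and r = "measure (\<lambda>s. length (snd s))"])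
  fix s assume a: "length (fst s) + length (snd s) = length ts" "scan_cond s"
  obtain P p us where s: "s = (P, p # us)"
    using a(2) by (cases s; cases "snd s") (auto simp: scan_cond_def)
  show "length (fst (scan_step s)) + length (snd (scan_step s)) = length ts"
    "(scan_step s, s) \<in> measure (\<lambda>s. length (snd s))"
    using a(1) by (simp_all add: s scan_step_def)
qed auto

lemma zigzag_step_decreases:
  assumes "zigzag_cond s"
  shows "length (snd (zigzag_step s)) < length (snd s)"
proof -
  obtain acc ts where s: "s = (acc, ts)" by (cases s)
  obtain P us where u: "scan ts = (P, us)" by fastforce
  have "0 < length ts" "length P + length us = length ts"
    using assms scan_length[of ts] u by (auto simp: s zigzag_cond_def)
  then show ?thesis
    by (auto simp: s zigzag_step_def u split: list.split)
qed

definition zigzag_invariant :: "real \<Rightarrow> real list \<Rightarrow> real \<Rightarrow> kinked list \<times> real list \<Rightarrow> bool" where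
  "zigzag_invariant a ts c = (\<lambda>(acc, us).
     pl (a, alternate a ts, c) = pl (a, alternate a us, c) \<circ> compose (map pl acc) \<and>
     sorted_wrt (<) us \<and> us \<noteq> [] \<and> 2 * length acc + length us = length ts \<and>
     (\<forall>g\<in>set acc. proper_data g \<and> pm1_trinomial (pl g)))"

lemma zigzag_step_invariant:
  assumes "zigzag_invariant a ts c s" "zigzag_cond s"
  shows "zigzag_invariant a ts c (zigzag_step s)"
proof -
  obtain acc us where s: "s = (acc, us)" by (cases s)
  note inv = assms(1)[unfolded zigzag_invariant_def s prod.case]
  have len: "2 < length us" using assms(2) by (simp add: s zigzag_cond_def)
  obtain P p q R where sc: "scan us = (P, p # q # R)" "us = rev P @ p # q # R"
    "\<And>s. s \<in> set P \<Longrightarrow> s \<le> p - (q - p)" "\<And>s. s \<in> set R \<Longrightarrow> q + (q - p) \<le> s"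
    using scan_correct[of us thesis] inv len by (meson less_imp_le_nat)
  have pq: "p < q" using inv sc(2) by (auto simp: sorted_wrt_append)
  let ?g = "pl (fold_map p q)"
  let ?P = "rev P"
  have step: "zigzag_step s = (fold_map p q # acc, map ?g (?P @ R))"
    by (simp add: s zigzag_step_def sc(1))
  have "pl (a, alternate a us, c) = pl (a, alternate a (map ?g ?P @ map ?g R), c) \<circ> ?g"
    unfolding sc(2) fold_map_def by (rule pl_fold[OF pq]) (use sc(3,4) in auto)
  then have "pl (a, alternate a ts, c)
      = pl (a, alternate a (map ?g (?P @ R)), c) \<circ> compose (map pl (fold_map p q # acc))"
    using inv by (simp add: comp_assoc)
  moreover have "sorted_wrt (<) (map ?g (?P @ R))"
  proof -
    have le: "?g y - ?g x = y - x" if "x \<le> p" "y \<le> p" for x y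
      using that pq by (simp only: fold_map_def pl_diff) (simp add: min_absorb1 max_absorb2)
    have ge: "?g y - ?g x = y - x" if "q \<le> x" "q \<le> y" for x y
      using that pq by (simp only: fold_map_def pl_diff) (simp add: min_absorb2 max_absorb1)
    have mid: "?g q - ?g p = p - q"
      using pq by (simp only: fold_map_def pl_diff) (simp add: min_absorb1 min_absorb2 max_absorb1 max_absorb2)
    have P: "s \<le> p" "s < p" if "s \<in> set P" for s using sc(3)[OF that] pq by auto
    have R: "q \<le> s" if "s \<in> set R" for s using sc(4)[OF that] pq by auto
    have "sorted_wrt (<) ?P" "sorted_wrt (<) R"
      using inv unfolding sc(2) by (auto simp: sorted_wrt_append)
    moreover have "?g x < ?g y" if "x \<in> set ?P" "y \<in> set ?P" "x < y" for x y
      using le[of x y] P that by simp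
    moreover have "?g x < ?g y" if "x \<in> set R" "y \<in> set R" "x < y" for x y
      using ge[of x y] R that by simp
    ultimately have "sorted_wrt (<) (map ?g ?P)" "sorted_wrt (<) (map ?g R)"
      unfolding sorted_wrt_map by (metis (no_types, lifting) sorted_wrt_mono_rel)+
    moreover have "?g x < ?g y" if "x \<in> set P" "y \<in> set R" for x y
      using le[of p x] P[OF that(1)] sc(3)[OF that(1)] ge[of q y] R[OF that(2)] sc(4)[OF that(2)] mid pq
      by simp
    ultimately show ?thesis by (simp add: sorted_wrt_append)
  qed
  moreover have "pm1_trinomial ?g"
    using pm1_trinomial_pl[of 1 p q 0] pq by (simp add: fold_map_def)
  moreover have "rev P @ R \<noteq> []" "2 * length (fold_map p q # acc) + length (?P @ R) = length ts"
    using inv len by (auto simp: sc(2))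
  moreover have "proper_data (fold_map p q)"
    using pq by (simp add: fold_map_def proper_def reduced_def)
  ultimately show ?thesis
    unfolding step zigzag_invariant_def using inv by auto
qed


lemma proper_alternate:
  "a = 1 \<or> a = -1 \<Longrightarrow> sorted_wrt (<) ts \<Longrightarrow> proper a (alternate a ts)"
proof (induction ts arbitrary: a)
  case (Cons t ts)
  have "\<forall>k \<in> set (alternate (- a) ts). t < fst k"
    using Cons.prems(2) in_alternateD by fastforce
  moreover have a: "- a = 1 \<or> - a = -1" "a \<noteq> - a" "a \<in> \<int>" using Cons.prems(1) by auto
  moreover have "proper (- a) (alternate (- a) ts)"
    using Cons.prems(2) by (intro Cons.IH[OF a(1)]) simp
  ultimately show ?case by (auto simp: proper_def reduced_Cons case_prod_beta)
qed (auto simp: proper_def reduced_def)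

theorem zigzag_decomposition_correct:
  fixes c :: real
  assumes "a = 1 \<or> a = -1" "sorted_wrt (<) ts" "ts \<noteq> []"
  defines "gs \<equiv> zigzag_decomposition a ts c"
  shows "pl (a, alternate a ts, c) = compose (map pl gs)"
    "\<forall>g\<in>set gs. proper_data g \<and> (pm1_binomial (pl g) \<or> pm1_trinomial (pl g))"
    "length (filter pm1_binomial (map pl gs)) + 2 * length (filter pm1_trinomial (map pl gs)) = length ts"
proof -
  obtain acc us where w: "while zigzag_cond zigzag_step ([], ts) = (acc, us)"
    by (cases "while zigzag_cond zigzag_step ([], ts)") blast
  have "zigzag_invariant a ts c (acc, us) \<and> \<not> zigzag_cond (acc, us)"
    unfolding w[symmetric]
  proof (rule while_rule[where P = "zigzag_invariant a ts c" and r = "measure (\<lambda>s. length (snd s))"])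
    show "zigzag_invariant a ts c ([], ts)"
      using assms(2,3) by (simp add: zigzag_invariant_def)
  qed (auto simp: zigzag_step_invariant zigzag_step_decreases)
  then have inv: "pl (a, alternate a ts, c) = pl (a, alternate a us, c) \<circ> compose (map pl acc)"
    "sorted_wrt (<) us" "us \<noteq> []" "2 * length acc + length us = length ts"
    "\<forall>g\<in>set acc. proper_data g \<and> pm1_trinomial (pl g)" and "length us \<le> 2"
    by (auto simp: zigzag_invariant_def zigzag_cond_def)
  have gs: "gs = (a, alternate a us, c) # acc" by (simp add: gs_def zigzag_decomposition_def w)
  have acc: "filter pm1_trinomial (map pl acc) = map pl acc" "filter pm1_binomial (map pl acc) = []"
    using inv(5) pm1_binomial_not_trinomial by (auto simp: filter_empty_conv filter_id_conv)
  show "pl (a, alternate a ts, c) = compose (map pl gs)"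
    unfolding gs list.map compose_Cons by (rule inv(1))
  consider (one) t where "us = [t]" | (two) s t where "us = [s, t]" "s < t"
    using inv(2,3) \<open>length us \<le> 2\<close> by (cases us; cases "tl us") auto
  then have G: "pm1_binomial (pl (a, alternate a us, c)) \<and> length us = 1 \<or>
    pm1_trinomial (pl (a, alternate a us, c)) \<and> length us = 2"
    by cases (use assms(1) pm1_binomial_pl pm1_trinomial_pl in \<open>auto simp del: pl.simps alternate.simps\<close>)
  moreover have "proper a (alternate a us)"
    using assms(1) inv(2) by (rule proper_alternate)
  ultimately show "\<forall>g\<in>set gs. proper_data g \<and> (pm1_binomial (pl g) \<or> pm1_trinomial (pl g))"
    unfolding gs using inv(5) by auto
  show "length (filter pm1_binomial (map pl gs)) + 2 * length (filter pm1_trinomial (map pl gs)) = length ts"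
    using G pm1_binomial_not_trinomial[of "pl (a, alternate a us, c)"] inv(4)
    unfolding gs list.map filter.simps acc by auto
qed

section \<open>Collapsing constant edges\<close>

text \<open>Here \<open>p\<close> is the slope of the previous edge. Only the first constant edge is collapsed, and it gets the
  outer slope \<open>p\<close>.\<close>

fun collapse_labels :: "real \<Rightarrow> (real \<times> real) list \<Rightarrow> (real \<times> real \<times> real) list" where
  "collapse_labels p [] = []"
| "collapse_labels p ((t, b) # ks) = (if b = 0 then (t, 0, p) # map (\<lambda>(s, d). (s, 1, d)) ks
     else (t, 1, b) # collapse_labels b ks)"

text \<open>If the first edge is constant, its outer slope is taken from the second one. The value 1, without a
  second edge or for a second slope 0, is nonzero; so every step decreases the number of zero slopes,
  even for lists of slopes with equal neighbours.\<close>

definition next_slope :: "(real \<times> real) list \<Rightarrow> real" where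
  "next_slope ks = (case ks of [] \<Rightarrow> 1 | (t, b) # r \<Rightarrow> if b = 0 then 1 else b)"

definition collapse_step :: "kinked list \<times> kinked \<Rightarrow> kinked list \<times> kinked" where
  "collapse_step = (\<lambda>(acc, a, ks, c).
     if a = 0 then (inner 0 (map (\<lambda>(s, d). (s, 1, d)) ks) # acc,
       outer 0 (next_slope ks) (map (\<lambda>(s, d). (s, 1, d)) ks) c)
     else (inner 1 (collapse_labels a ks) # acc, outer 1 a (collapse_labels a ks) c))"

definition zeros :: "real list \<Rightarrow> nat" where
  "zeros xs = length (filter (\<lambda>x. x = 0) xs)"

definition collapse_cond :: "kinked list \<times> kinked \<Rightarrow> bool" where
  "collapse_cond = (\<lambda>(acc, a, ks, c). 0 \<in> set (slope_list a ks))"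

definition blocks :: "real list \<Rightarrow> nat" where
  "blocks xs = length (remdups_adj (map sgn (filter (\<lambda>x. x \<noteq> 0) xs)))"

lemma zeros_Cons: "zeros (x # xs) = (if x = 0 then 1 else 0) + zeros xs"
  by (simp add: zeros_def)

lemma zeros_remdups_adj_le: "zeros (remdups_adj xs) \<le> zeros xs"
  by (induction xs rule: remdups_adj.induct) (auto simp: zeros_def)

text \<open>Merging equal neighbours keeps the number of zeros if no two zeros are adjacent.\<close>

abbreviation isolated_zeros :: "real list \<Rightarrow> bool" where
  "isolated_zeros \<equiv> successively (\<lambda>x y. x = 0 \<longrightarrow> y \<noteq> 0)"

lemma zeros_remdups_adj: "isolated_zeros xs \<Longrightarrow> zeros (remdups_adj xs) = zeros xs"
  by (induction xs rule: remdups_adj.induct) (auto simp: zeros_def)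

lemma distinct_adj_isolated_zeros: "distinct_adj xs \<Longrightarrow> isolated_zeros xs"
  unfolding distinct_adj_def by (erule successively_mono) auto

lemma isolated_zeros_Cons: "x \<noteq> 0 \<Longrightarrow> isolated_zeros (x # xs) \<longleftrightarrow> isolated_zeros xs"
  by (cases xs) auto

lemma collapse_labels_prod: "map (\<lambda>(t, w, d). (t, d * w)) (collapse_labels p ks) = ks"
  by (induction p ks rule: collapse_labels.induct) (auto simp: comp_def case_prod_beta)

lemma collapse_labels_fst: "map fst (collapse_labels p ks) = map fst ks"
  by (induction p ks rule: collapse_labels.induct) (auto simp: comp_def case_prod_beta)

lemma collapse_labels_values:
  "(t, w, d) \<in> set (collapse_labels p ks) \<Longrightarrow> d = p \<or> (\<exists>s. (s, d) \<in> set ks)"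
  by (induction p ks rule: collapse_labels.induct) (auto split: if_splits)

lemma ones_ok: "collapse_ok p (map (\<lambda>(s, d). (s, 1, d)) ks)"
  by (rule collapse_ok_pos) auto

lemma collapse_labels_ok: "collapse_ok p (collapse_labels p ks)"
  by (induction p ks rule: collapse_labels.induct) (auto simp: ones_ok)

lemma collapse_labels_zeros:
  "p \<noteq> 0 \<Longrightarrow> 0 \<in> snd ` set ks \<Longrightarrow> Suc (zeros (map (snd \<circ> snd) (collapse_labels p ks))) = zeros (map snd ks)"
  by (induction p ks rule: collapse_labels.induct) (auto simp: zeros_Cons comp_def case_prod_beta)

lemma collapse_labels_weights:
  assumes "0 \<in> snd ` set ks"
  shows "\<exists>i j. map (fst \<circ> snd) (collapse_labels p ks) = replicate i 1 @ 0 # replicate j 1"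
  using assms
proof (induction p ks rule: collapse_labels.induct)
  case (2 p t b ks)
  show ?case
  proof (cases "b = 0")
    case True
    then show ?thesis
      by (intro exI[of _ 0] exI[of _ "length ks"]) (simp add: comp_def case_prod_beta map_replicate_const)
  next
    case False
    with "2.prems" have "0 \<in> snd ` set ks" by auto
    with "2.IH"[OF False] obtain i j
      where "map (fst \<circ> snd) (collapse_labels b ks) = replicate i 1 @ 0 # replicate j 1" by blast
    with False show ?thesis by (rule_tac exI[of _ "Suc i"], rule_tac exI[of _ j]) (simp add: comp_def)
  qed
qed simp

lemma remdups_adj_replicate_Cons:
  "remdups_adj (replicate j x) = (if j = 0 then [] else [x])"
  by (induction j rule: induct_nat_012) auto

text \<open>These are the four shapes of a singular trinomial, up to a common factor of its slopes.\<close>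

lemma remdups_adj_one_zero:
  "\<exists>l r. remdups_adj (replicate i 1 @ 0 # replicate j 1) = l @ [0] @ r \<and>
     (l = [] \<or> l = [1::real]) \<and> (r = [] \<or> r = [1])"
proof -
  have "remdups_adj (0 # replicate j (1::real)) = 0 # (if j = 0 then [] else [1])"
    by (cases j) (simp_all add: remdups_adj_replicate_Cons[of "Suc _", simplified])
  then show ?thesis
  proof (induction i)
    case (Suc i)
    then obtain l r where "remdups_adj (replicate i 1 @ 0 # replicate j 1) = l @ [0] @ r"
      "l = [] \<or> l = [1::real]" "r = [] \<or> r = [1]" by auto
    then show ?case
      by (intro exI[of _ "[1]"] exI[of _ r]) (auto simp: remdups_adj_Cons split: list.splits)
  qed auto
qed

definition singular_data :: "kinked \<Rightarrow> bool" where
  "singular_data = (\<lambda>(u, vs, c). proper u vs \<and> c = 0 \<and>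
     (\<exists>l r. slope_list u vs = l @ [0] @ r \<and> (l = [] \<or> l = [1]) \<and> (r = [] \<or> r = [1])))"

lemma singular_data_scaled:
  assumes "singular_data (u, vs, d)" "m \<in> \<int>" "m \<noteq> 0"
  shows "proper (m * u) (map (\<lambda>(t, b). (t, m * b)) vs)"
    "singular_monotone_trinomial (pl (m * u, map (\<lambda>(t, b). (t, m * b)) vs, c))"
proof -
  obtain k :: int where k: "m = of_int k" "k \<noteq> 0" using assms(2,3) by (auto elim!: Ints_cases)
  obtain l r :: "real list" where lr: "slope_list u vs = l @ [0] @ r" "l = [] \<or> l = [1]" "r = [] \<or> r = [1]"
    and red: "reduced u vs" using assms(1) by (auto simp: singular_data_def proper_def)
  let ?vs = "map (\<lambda>(t, b). (t, m * b)) vs"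
  have sl: "slope_list (m * u) ?vs = map ((*) m) (slope_list u vs)" by (auto simp: case_prod_beta)
  have red': "reduced (m * u) ?vs"
    using red unfolding reduced_def sl using assms(3)
    by (auto intro!: distinct_adj_mapI inj_onI simp del: list.map simp: case_prod_beta comp_def)
  moreover have ints: "slope_list (m * u) ?vs
      = map of_int (map (\<lambda>_. k) l @ [0] @ map (\<lambda>_. k) r)"
    unfolding sl lr(1) using lr(2,3) k by auto
  ultimately have "has_slopes (pl (m * u, ?vs, c)) (map (\<lambda>_. k) l @ [0] @ map (\<lambda>_. k) r)"
    by (rule has_slopes_pl)
  moreover have "monotone_slopes (map (\<lambda>_. k) l @ map (\<lambda>_. k) r)"
    using k(2) by (auto simp: monotone_slopes_def)
  moreover have "length l \<le> 1" "length r \<le> 1" using lr by auto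
  ultimately show "singular_monotone_trinomial (pl (m * u, ?vs, c))" unfolding singular_monotone_trinomial_def
    by (intro exI[of _ "map (\<lambda>_. k) l"] exI[of _ "map (\<lambda>_. k) r"]) simp
  show "proper (m * u) ?vs"
    unfolding proper_def ints using red' by auto
qed

lemma remdups_adj_Cons_cong: "remdups_adj xs = remdups_adj ys \<Longrightarrow> remdups_adj (x # xs) = remdups_adj (x # ys)"
  by (simp add: remdups_adj_Cons)

lemma remdups_adj_map_remdups_adj: "remdups_adj (map h (remdups_adj xs)) = remdups_adj (map h xs)"
proof (induction xs rule: remdups_adj.induct)
  case (3 x y xs)
  show ?case
  proof (cases "x = y")
    case False
    then have "remdups_adj (x # y # xs) = x # remdups_adj (y # xs)" by simp
    then show ?thesis
      using remdups_adj_Cons_cong[OF "3.IH"(2)[OF False], of "h x"] by (simp only: list.map)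
  qed (use 3 in simp)
qed auto

lemma remdups_adj_filter_remdups_adj:
  "remdups_adj (filter P (remdups_adj xs)) = remdups_adj (filter P xs)"
proof (induction xs rule: remdups_adj.induct)
  case (3 x y xs)
  show ?case
  proof (cases "x = y")
    case False
    then have "remdups_adj (x # y # xs) = x # remdups_adj (y # xs)" by simp
    then show ?thesis
      using "3.IH"(2)[OF False] remdups_adj_Cons_cong[OF "3.IH"(2)[OF False], of x]
      by (simp only: filter.simps split: if_split) simp
  qed (use 3 in simp)
qed auto

lemma blocks_remdups_adj: "blocks (remdups_adj xs) = blocks xs"
  unfolding blocks_def
  by (metis remdups_adj_filter_remdups_adj remdups_adj_map_remdups_adj)

text \<open>Replacing a zero by the previous slope repeats a sign and so keeps the number of blocks.\<close>

lemma collapse_labels_blocks: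
  "p \<noteq> 0 \<Longrightarrow> blocks (p # map (snd \<circ> snd) (collapse_labels p ks)) = blocks (p # map snd ks)"
proof -
  have "p \<noteq> 0 \<Longrightarrow> remdups_adj (map sgn (filter (\<lambda>x. x \<noteq> 0) (p # map (snd \<circ> snd) (collapse_labels p ks))))
    = remdups_adj (map sgn (filter (\<lambda>x. x \<noteq> 0) (p # map snd ks)))"
  proof (induction p ks rule: collapse_labels.induct)
    case (2 p t b ks)
    show ?case
    proof (cases "b = 0")
      case True
      then show ?thesis using "2.prems" by (simp add: comp_def case_prod_beta)
    next
      case False
      then show ?thesis using remdups_adj_Cons_cong[OF "2.IH"[OF False False], of "sgn p"] "2.prems" by simp
    qed
  qed simp
  then show "p \<noteq> 0 \<Longrightarrow> ?thesis" by (simp add: blocks_def)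
qed

lemma collapse_labels_isolated_zeros:
  "distinct_adj (map snd ks) \<Longrightarrow> p \<noteq> 0 \<Longrightarrow> isolated_zeros (map (snd \<circ> snd) (collapse_labels p ks))"
proof (induction p ks rule: collapse_labels.induct)
  case (2 p t b ks)
  then have "distinct_adj (map snd ks)" by (auto dest: distinct_adj_ConsD)
  then show ?case using 2
    by (cases "b = 0") (simp_all add: isolated_zeros_Cons comp_def case_prod_beta distinct_adj_isolated_zeros)
qed simp

text \<open>The maximum with 1 accounts for a constant function: it has no block, but collapses to a function
  with slope 1.\<close>

definition collapse_invariant :: "kinked \<Rightarrow> kinked list \<times> kinked \<Rightarrow> bool" where
  "collapse_invariant F = (\<lambda>(acc, a, ks, c). pl F = pl (a, ks, c) \<circ> compose (map pl acc) \<and>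
     proper a ks \<and> length acc + zeros (slope_list a ks) = zeros (slope_list (fst F) (fst (snd F))) \<and>
     length ks \<le> length (fst (snd F)) \<and>
     blocks (slope_list a ks) \<le> max 1 (blocks (slope_list (fst F) (fst (snd F)))) \<and>
     (\<forall>g\<in>set acc. singular_data g))"

lemma collapse_factor:
  assumes inv: "collapse_invariant F (acc, a, ks, c)"
    and fst_ls: "map fst ls = map fst ks" and prod: "map (\<lambda>(t, w, d). (t, d * w)) ls = ks"
    and "b * u = a" "collapse_ok b ls" and u: "0 \<le> u" "b \<in> \<int>"
    and ws: "u # map (fst \<circ> snd) ls = replicate i 1 @ 0 # replicate j 1"
    and ds: "set (map (snd \<circ> snd) ls) \<subseteq> \<int>" "isolated_zeros (b # map (snd \<circ> snd) ls)"
    and z: "Suc (zeros (b # map (snd \<circ> snd) ls)) = zeros (slope_list a ks)"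
    and bl: "blocks (b # map (snd \<circ> snd) ls) \<le> max 1 (blocks (slope_list a ks))"
  shows "collapse_invariant F (inner u ls # acc, outer u b ls c)"
proof -
  have "reduced a ks" using inv by (simp add: collapse_invariant_def proper_def)
  then have sorted: "sorted_wrt (<) (map fst ls)" unfolding fst_ls by (simp add: reduced_def)
  obtain vs where v: "inner u ls = (u, vs, 0)" by (simp add: inner_def)
  obtain js where o: "outer u b ls c = (b, js, c)" by (simp add: outer_def)
  have "pl (a, ks, c) = pl (b, js, c) \<circ> pl (u, vs, 0)"
    using outer_inner[OF sorted u(1) assms(5), of c] unfolding prod \<open>b * u = a\<close> v o .
  moreover have "proper b js"
    using reduced_outer[OF sorted u(1) assms(5) o] ds(1) u(2)
    unfolding proper_def slope_list_outer(3)[OF o] remdups_adj_set by simp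
  moreover have "zeros (slope_list b js) = zeros (b # map (snd \<circ> snd) ls)"
    unfolding slope_list_outer(3)[OF o] using ds(2) by (rule zeros_remdups_adj)
  moreover have "blocks (slope_list b js) = blocks (b # map (snd \<circ> snd) ls)"
    unfolding slope_list_outer(3)[OF o] by (rule blocks_remdups_adj)
  moreover have "length js \<le> length ks"
  proof -
    have "js = prune b (map (\<lambda>(t, w, d). (pl (inner u ls) t, d)) ls)"
      using o by (simp add: outer_def)
    then have "length js \<le> length ls" using length_prune by (metis length_map)
    then show ?thesis using arg_cong[OF fst_ls, of length] by simp
  qed
  moreover have "singular_data (u, vs, 0)"
  proof -
    obtain l r where lr: "slope_list u vs = l @ [0] @ r" "l = [] \<or> l = [1]" "r = [] \<or> r = [1]"
      using remdups_adj_one_zero[of i j] slope_list_inner(3)[OF v] unfolding ws by auto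
    then have "set (slope_list u vs) \<subseteq> {0, 1}" unfolding lr(1) by auto
    then have "proper u vs" unfolding proper_def using reduced_inner[OF sorted v] by auto
    then show ?thesis using lr by (auto simp: singular_data_def)
  qed
  ultimately show ?thesis
    using inv z bl unfolding collapse_invariant_def v o by (auto simp: comp_assoc)
qed

lemma collapse_step_invariant:
  assumes "collapse_invariant F s" "collapse_cond s"
  shows "collapse_invariant F (collapse_step s)"
proof -
  obtain acc a ks c where s: "s = (acc, a, ks, c)" by (cases s)
  note inv = assms(1)[unfolded s]
  have red: "distinct_adj (slope_list a ks)" and int: "set (slope_list a ks) \<subseteq> \<int>"
    using inv by (auto simp: collapse_invariant_def proper_def reduced_def)
  show ?thesis
  proof (cases "a = 0")
    case True
    let ?ls = "map (\<lambda>(s, d). (s, 1::real, d)) ks"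
    have ds: "map (snd \<circ> snd) ?ls = map snd ks" by auto
    have next_slope: "next_slope ks \<noteq> 0" "next_slope ks \<in> \<int>"
      using int by (auto simp: next_slope_def split: list.split)
    have "blocks (next_slope ks # map snd ks) \<le> max 1 (blocks (0 # map snd ks))"
      using red True by (cases ks) (auto simp: next_slope_def blocks_def)
    moreover have "isolated_zeros (next_slope ks # map snd ks)"
      by (rule isolated_zeros_Cons[THEN iffD2, OF next_slope(1)
          distinct_adj_isolated_zeros[OF distinct_adj_ConsD[OF red]]])
    ultimately have "collapse_invariant F (inner 0 ?ls # acc, outer 0 (next_slope ks) ?ls c)"
      using next_slope int True ones_ok
      by (intro collapse_factor[OF inv, of ?ls "next_slope ks" 0 0 "length ks"])
        (auto simp: ds comp_def case_prod_beta zeros_Cons map_replicate_const)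
    then show ?thesis by (simp add: s collapse_step_def True)
  next
    case False
    let ?ls = "collapse_labels a ks"
    have z: "0 \<in> snd ` set ks" using assms(2) False by (auto simp: s collapse_cond_def)
    obtain i j where ij: "map (fst \<circ> snd) ?ls = replicate i 1 @ 0 # replicate j 1"
      using collapse_labels_weights[OF z, of a] by blast
    have ds: "set (map (snd \<circ> snd) ?ls) \<subseteq> \<int>"
      using int by (force dest!: collapse_labels_values)
    have iz: "isolated_zeros (a # map (snd \<circ> snd) ?ls)"
      using collapse_labels_isolated_zeros[of ks a] red False
      by (auto simp: isolated_zeros_Cons distinct_adj_Cons)
    have "collapse_invariant F (inner 1 ?ls # acc, outer 1 a ?ls c)"
    proof (rule collapse_factor[OF inv collapse_labels_fst collapse_labels_prod _ collapse_labels_ok])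
      show "1 # map (fst \<circ> snd) ?ls = replicate (Suc i) 1 @ 0 # replicate j 1" using ij by simp
      show "Suc (zeros (a # map (snd \<circ> snd) ?ls)) = zeros (slope_list a ks)"
        using collapse_labels_zeros[OF False z] False by (simp add: zeros_Cons)
      show "blocks (a # map (snd \<circ> snd) ?ls) \<le> max 1 (blocks (slope_list a ks))"
        using collapse_labels_blocks[OF False, of ks] by simp
    qed (use iz ds int in auto)
    then show ?thesis using False by (simp add: s collapse_step_def)
  qed
qed

lemma collapse_step_decreases:
  assumes "collapse_cond s"
  shows "(\<lambda>(acc, a, ks, c). zeros (slope_list a ks)) (collapse_step s)
    < (\<lambda>(acc, a, ks, c). zeros (slope_list a ks)) s"
proof -
  obtain acc a ks c where s: "s = (acc, a, ks, c)" by (cases s)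
  show ?thesis
  proof (cases "a = 0")
    case True
    let ?ls = "map (\<lambda>(s, d). (s, 1::real, d)) ks"
    obtain js where o: "outer 0 (next_slope ks) ?ls c = (next_slope ks, js, c)"
      by (simp add: outer_def)
    have "zeros (slope_list (next_slope ks) js) \<le> zeros (next_slope ks # map (snd \<circ> snd) ?ls)"
      unfolding slope_list_outer(3)[OF o] by (rule zeros_remdups_adj_le)
    also have "\<dots> < zeros (0 # map snd ks)"
      by (auto simp: zeros_Cons next_slope_def comp_def case_prod_beta split: list.split)
    finally show ?thesis by (simp add: s collapse_step_def True o)
  next
    case False
    let ?ls = "collapse_labels a ks"
    have z: "0 \<in> snd ` set ks" using assms(1) False by (auto simp: s collapse_cond_def)
    obtain js where o: "outer 1 a ?ls c = (a, js, c)" by (simp add: outer_def)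
    have "zeros (slope_list a js) \<le> zeros (a # map (snd \<circ> snd) ?ls)"
      unfolding slope_list_outer(3)[OF o] by (rule zeros_remdups_adj_le)
    also have "\<dots> < zeros (slope_list a ks)"
      using collapse_labels_zeros[OF False z] False by (simp add: zeros_Cons)
    finally show ?thesis using False by (simp add: s collapse_step_def o)
  qed
qed

lemma zeros_eq_0_iff: "zeros xs = 0 \<longleftrightarrow> 0 \<notin> set xs"
  by (auto simp: zeros_def filter_empty_conv)

lemma blocks_nonzero: "0 \<notin> set xs \<Longrightarrow> blocks xs = length (remdups_adj (map sgn xs))"
  unfolding blocks_def by (subst filter_id_conv[THEN iffD2]) auto

definition collapse :: "kinked \<Rightarrow> kinked list \<times> kinked" where
  "collapse F = while collapse_cond collapse_step ([], F)"

theorem collapse_correct: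
  assumes "proper a ks" "collapse (a, ks, c) = (ss, b, js, d)"
  shows "pl (a, ks, c) = pl (b, js, d) \<circ> compose (map pl ss)" "proper b js"
    "0 \<notin> set (slope_list b js)" "length ss = zeros (slope_list a ks)" "length js \<le> length ks"
    "blocks (slope_list b js) \<le> max 1 (blocks (slope_list a ks))" "\<forall>g\<in>set ss. singular_data g"
proof -
  have "collapse_invariant (a, ks, c) (ss, b, js, d) \<and> \<not> collapse_cond (ss, b, js, d)"
    unfolding assms(2)[symmetric] collapse_def
  proof (rule while_rule[where P = "collapse_invariant (a, ks, c)"
        and r = "measure (\<lambda>(acc, a, ks, c). zeros (slope_list a ks))"])
    show "collapse_invariant (a, ks, c) ([], a, ks, c)"
      using assms(1) by (simp add: collapse_invariant_def)
    show "(collapse_step s, s) \<in> measure (\<lambda>(acc, a, ks, c). zeros (slope_list a ks))"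
      if "collapse_cond s" for s
      using collapse_step_decreases[OF that] by simp
  qed (auto simp: collapse_step_invariant)
  moreover from this have "zeros (slope_list b js) = 0"
    unfolding zeros_eq_0_iff by (simp add: collapse_cond_def)
  ultimately show "pl (a, ks, c) = pl (b, js, d) \<circ> compose (map pl ss)" "proper b js"
    "0 \<notin> set (slope_list b js)" "length ss = zeros (slope_list a ks)" "length js \<le> length ks"
    "blocks (slope_list b js) \<le> max 1 (blocks (slope_list a ks))" "\<forall>g\<in>set ss. singular_data g"
    unfolding collapse_invariant_def collapse_cond_def by simp_all
qed

section \<open>Separating the signs from the absolute values of the slopes\<close>

definition sign_labels :: "(real \<times> real) list \<Rightarrow> (real \<times> real \<times> real) list" where
  "sign_labels ks = map (\<lambda>(t, b). (t, \<bar>b\<bar>, sgn b)) ks"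

lemma pm1_alternate:
  assumes "reduced a ks" "set (slope_list a ks) \<subseteq> {1, -1}"
  shows "ks = alternate a (map fst ks)"
  using assms
proof (induction ks arbitrary: a)
  case (Cons k ks)
  obtain t b where k: "k = (t, b)" by force
  then have "b = - a" "reduced b ks" "set (slope_list b ks) \<subseteq> {1, -1}"
    using Cons.prems by (auto simp: reduced_Cons)
  with Cons.IH show ?case by (simp add: k)
qed simp

text \<open>The kinks of the sign zigzag are the changes of sign of the slopes.\<close>

theorem sign_factor:
  assumes "proper a ks" "0 \<notin> set (slope_list a ks)"
    "inner \<bar>a\<bar> (sign_labels ks) = (u, vs, d)" "outer \<bar>a\<bar> (sgn a) (sign_labels ks) c = (b, js, c')"
  shows "pl (a, ks, c) = pl (b, js, c') \<circ> pl (u, vs, d)" "d = 0"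
    "proper u vs" "\<forall>x\<in>set (slope_list u vs). 0 < x" "length vs \<le> length ks"
    "b = 1 \<or> b = -1" "sorted_wrt (<) (map fst js)" "js = alternate b (map fst js)"
    "Suc (length js) = blocks (slope_list a ks)"
proof -
  let ?ls = "sign_labels ks"
  have fst_ls: "map fst ?ls = map fst ks" by (auto simp: sign_labels_def)
  have sorted: "sorted_wrt (<) (map fst ?ls)" unfolding fst_ls
    using assms(1) by (simp add: proper_def reduced_def)
  have nz: "a \<noteq> 0" "\<And>t b. (t, b) \<in> set ks \<Longrightarrow> b \<noteq> 0" using assms(2) by force+
  have ok: "collapse_ok (sgn a) ?ls"
    by (rule collapse_ok_pos) (use nz in \<open>auto simp: sign_labels_def\<close>)
  have prod: "map (\<lambda>(t, w, d). (t, d * w)) ?ls = ks"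
    by (auto simp: sign_labels_def sgn_mult_abs comp_def case_prod_beta intro!: map_idI)
  show "pl (a, ks, c) = pl (b, js, c') \<circ> pl (u, vs, d)"
    using outer_inner[OF sorted abs_ge_zero ok, of a c] unfolding prod assms(3,4) sgn_mult_abs .
  show "d = 0" using slope_list_inner(2)[OF assms(3)] .
  have b: "b = sgn a" using slope_list_outer(1)[OF assms(4)] .
  have u: "slope_list u vs = remdups_adj (map abs (slope_list a ks))"
    unfolding slope_list_inner(3)[OF assms(3)] by (simp add: sign_labels_def comp_def case_prod_beta)
  have j: "slope_list b js = remdups_adj (map sgn (slope_list a ks))"
    unfolding slope_list_outer(3)[OF assms(4)] by (simp add: sign_labels_def comp_def case_prod_beta)
  show "proper u vs"
    using reduced_inner[OF sorted assms(3)] assms(1) unfolding proper_def u by auto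
  show "\<forall>x\<in>set (slope_list u vs). 0 < x" unfolding u using nz by auto
  have "length (slope_list u vs) \<le> length (slope_list a ks)"
    unfolding u by (rule order_trans[OF remdups_adj_length]) simp
  then show "length vs \<le> length ks" by simp
  show "b = 1 \<or> b = -1" using nz by (simp add: b sgn_if)
  have red: "reduced b js" using reduced_outer[OF sorted abs_ge_zero ok assms(4)] .
  then show "sorted_wrt (<) (map fst js)" by (simp add: reduced_def)
  have "set (slope_list b js) \<subseteq> {1, -1}" unfolding j using nz by (auto simp: sgn_if)
  with red show "js = alternate b (map fst js)" by (rule pm1_alternate)
  have "blocks (slope_list a ks) = length (slope_list b js)"
    unfolding blocks_nonzero[OF assms(2)] j ..
  then show "Suc (length js) = blocks (slope_list a ks)" by simp
qed

text \<open>If only an affine function is left after collapsing, it is absorbed into the outermost singular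
  trinomial. If the slopes have only one sign, the zigzag would be affine as well, and the function
  itself is monotone.\<close>

definition decomposition :: "kinked \<Rightarrow> kinked list \<times> kinked list \<times> kinked list" where
  "decomposition F = (case collapse F of (ss, a, ks, c) \<Rightarrow>
     if ks = [] then
       (case ss of [] \<Rightarrow> ([], [], []) |
          s # r \<Rightarrow> ([], [], (a * fst s, map (\<lambda>(t, b). (t, a * b)) (fst (snd s)), c) # r))
     else
       (case outer \<bar>a\<bar> (sgn a) (sign_labels ks) c of (b, js, d) \<Rightarrow>
          if js = [] then ([], mono_decomposition (a, ks, c), ss)
          else (zigzag_decomposition b (map fst js) d,
            mono_decomposition (inner \<bar>a\<bar> (sign_labels ks)), ss)))"

theorem decomposition_correct:
  assumes "proper a ks" "ks \<noteq> [] \<or> a = 0 \<or> a = 1 \<and> c = 0"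
    "decomposition (a, ks, c) = (gs, hs, ss)"
  shows "pl (a, ks, c) = compose (map pl gs) \<circ> compose (map pl hs) \<circ> compose (map pl ss)"
    "\<forall>g\<in>set gs. proper_data g \<and> (pm1_binomial (pl g) \<or> pm1_trinomial (pl g))"
    "\<forall>h\<in>set hs. proper_data h \<and> (monotone_binomial (pl h) \<or> monotone_trinomial (pl h))"
    "\<forall>s\<in>set ss. proper_data s \<and> singular_monotone_trinomial (pl s)"
    "length (filter pm1_binomial (map pl gs)) + 2 * length (filter pm1_trinomial (map pl gs))
       \<le> blocks (slope_list a ks)"
    "length hs \<le> Suc (length ks)" "length ss = zeros (slope_list a ks)"
proof -
  have singular: "proper_data s \<and> singular_monotone_trinomial (pl s)" if "singular_data s" for s
  proof -
    obtain u vs where s: "s = (u, vs, 0)" using \<open>singular_data s\<close> by (cases s) (auto simp: singular_data_def)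
    with singular_data_scaled[of u vs 0 1] that show ?thesis by (simp add: case_prod_beta)
  qed
  obtain ss' b js d where col: "collapse (a, ks, c) = (ss', b, js, d)" by (cases "collapse (a, ks, c)") auto
  note C = collapse_correct[OF assms(1) col]
  have "pl (a, ks, c) = compose (map pl gs) \<circ> compose (map pl hs) \<circ> compose (map pl ss) \<and>
    (\<forall>g\<in>set gs. proper_data g \<and> (pm1_binomial (pl g) \<or> pm1_trinomial (pl g))) \<and>
    (\<forall>h\<in>set hs. proper_data h \<and> (monotone_binomial (pl h) \<or> monotone_trinomial (pl h))) \<and>
    (\<forall>s\<in>set ss. proper_data s \<and> singular_monotone_trinomial (pl s)) \<and>
    length (filter pm1_binomial (map pl gs)) + 2 * length (filter pm1_trinomial (map pl gs))
       \<le> blocks (slope_list a ks) \<and>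
    length hs \<le> Suc (length ks) \<and> length ss = zeros (slope_list a ks)"
  proof (cases "js = []")
    case affine: True
    show ?thesis
    proof (cases ss')
      case Nil
      then have "zeros (slope_list a ks) = 0" using C(4) by simp
      then have "\<not> collapse_cond ([], a, ks, c)"
        unfolding zeros_eq_0_iff by (simp add: collapse_cond_def)
      then have "collapse (a, ks, c) = ([], a, ks, c)" by (simp add: collapse_def while_unfold)
      then have "ks = []" "a \<noteq> 0" using col affine C(3) by auto
      then have "a = 1" "c = 0" using assms(2) by auto
      moreover have "gs = [] \<and> hs = [] \<and> ss = []"
        using assms(3) by (simp add: decomposition_def col affine Nil)
      ultimately show ?thesis using \<open>ks = []\<close> by (auto simp: zeros_def)
    next
      case (Cons s r)
      have "singular_data s" using C(7) Cons by simp
      then obtain u vs where s: "s = (u, vs, 0)" by (cases s) (auto simp: singular_data_def)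
      have gs: "gs = []" "hs = []" "ss = (b * u, map (\<lambda>(t, w). (t, b * w)) vs, d) # r"
        using assms(3) by (auto simp: decomposition_def col affine Cons s)
      have b: "b \<in> \<int>" "b \<noteq> 0" using C(2,3) by (auto simp: proper_def)
      have "pl (b, [], d) \<circ> pl (u, vs, 0) = pl (b * u, map (\<lambda>(t, w). (t, b * w)) vs, d)"
        by (auto simp: rise_scale)
      then have "pl (a, ks, c) = compose (map pl ss)"
        using C(1) by (simp only: affine Cons s gs list.map compose_Cons comp_assoc[symmetric])
      moreover have "proper (b * u) (map (\<lambda>(t, w). (t, b * w)) vs)"
        "singular_monotone_trinomial (pl (b * u, map (\<lambda>(t, w). (t, b * w)) vs, d))"
        using singular_data_scaled[OF _ b] \<open>singular_data s\<close> s by blast+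
      ultimately show ?thesis using gs C(4,7) singular by (auto simp: Cons)
    qed
  next
    case False
    obtain u vs where v: "inner \<bar>b\<bar> (sign_labels js) = (u, vs, 0)" by (simp add: inner_def)
    obtain e ls where o: "outer \<bar>b\<bar> (sgn b) (sign_labels js) d = (e, ls, d)" by (simp add: outer_def)
    note S = sign_factor[OF C(2,3) v o]
    have ss: "ss = ss'" and singular_ss: "\<forall>s\<in>set ss'. proper_data s \<and> singular_monotone_trinomial (pl s)"
      using assms(3) C(7) singular by (auto simp: decomposition_def col False o split: if_splits)
    show ?thesis
    proof (cases "ls = []")
      case True
      then have gs: "gs = []" "hs = mono_decomposition (b, js, d)"
        using assms(3) by (auto simp: decomposition_def col False o)
      have "length (remdups_adj (map sgn (slope_list b js))) = 1"
        using S(9) True unfolding blocks_nonzero[OF C(3)] by simp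
      then obtain y where "remdups_adj (map sgn (slope_list b js)) = [y]"
        unfolding One_nat_def length_Suc_conv by blast
      then have "set (map sgn (slope_list b js)) = {y}"
        by (metis remdups_adj_set list.set(1) list.set(2))
      then have sg: "sgn x = sgn b" if "x \<in> set (slope_list b js)" for x
        using that by auto
      have "one_sign (slope_list b js)"
      proof (cases "0 < b")
        case True
        then have "0 < x" if "x \<in> set (slope_list b js)" for x using sg[OF that] by (simp add: sgn_1_pos)
        then show ?thesis by (auto simp: one_sign_def)
      next
        case False
        then have "b < 0" using C(3) by auto
        then have "x < 0" if "x \<in> set (slope_list b js)" for x using sg[OF that] by (simp add: sgn_1_neg)
        then show ?thesis by (auto simp: one_sign_def)
      qed
      from mono_decomposition_correct[OF C(2) this, of d] False
      have "pl (b, js, d) = compose (map pl hs)" "length hs \<le> length js"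
        "\<forall>g\<in>set hs. proper_data g \<and> (monotone_binomial (pl g) \<or> monotone_trinomial (pl g))"
        unfolding gs by auto
      then show ?thesis using C(1,4,5) singular_ss by (auto simp: gs ss)
    next
      case zigzag: False
      then have gs: "gs = zigzag_decomposition e (map fst ls) d" "hs = mono_decomposition (u, vs, 0)"
        using assms(3) by (auto simp: decomposition_def col False o v)
      have "one_sign (slope_list u vs)" "0 < u" using S(4) by (auto simp: one_sign_def)
      from mono_decomposition_correct[OF S(3) this(1), of 0] this(2)
      have hs: "pl (u, vs, 0) = compose (map pl hs)" "length hs \<le> max 2 (length vs)"
        "\<forall>g\<in>set hs. proper_data g \<and> (monotone_binomial (pl g) \<or> monotone_trinomial (pl g))"
        unfolding gs(2) by auto
      from zigzag_decomposition_correct[OF S(6,7), of d] zigzag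
      have G: "pl (e, ls, d) = compose (map pl gs)"
        "\<forall>g\<in>set gs. proper_data g \<and> (pm1_binomial (pl g) \<or> pm1_trinomial (pl g))"
        "length (filter pm1_binomial (map pl gs)) + 2 * length (filter pm1_trinomial (map pl gs)) = length ls"
        unfolding gs(1) using S(8) by auto
      have "blocks (slope_list b js) \<le> blocks (slope_list a ks)"
        using C(6) S(9) zigzag by (cases ls) auto
      moreover have "1 \<le> length ks" using False C(5) by (cases ks) auto
      ultimately show ?thesis
        using C(1,4,5) S(1,5,9) hs G singular_ss by (auto simp: ss comp_assoc)
    qed
  qed
  then show "pl (a, ks, c) = compose (map pl gs) \<circ> compose (map pl hs) \<circ> compose (map pl ss)"
    "\<forall>g\<in>set gs. proper_data g \<and> (pm1_binomial (pl g) \<or> pm1_trinomial (pl g))"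
    "\<forall>h\<in>set hs. proper_data h \<and> (monotone_binomial (pl h) \<or> monotone_trinomial (pl h))"
    "\<forall>s\<in>set ss. proper_data s \<and> singular_monotone_trinomial (pl s)"
    "length (filter pm1_binomial (map pl gs)) + 2 * length (filter pm1_trinomial (map pl gs))
       \<le> blocks (slope_list a ks)"
    "length hs \<le> Suc (length ks)" "length ss = zeros (slope_list a ks)" by blast+
qed

section \<open>A calculus of computable functions\<close>

text \<open>The type determines the encoding. For triples of two lists and a number, and for lists of such
  triples, it agrees with the encodings of functions and of lists of functions.\<close>

class encodable =
  fixes encode :: "'a \<Rightarrow> datum"

instantiation real :: encodable
begin
definition encode_real :: "real \<Rightarrow> datum" where "encode_real = Number"
instance ..
end

instantiation prod :: (encodable, encodable) encodable
begin
definition encode_prod :: "'a \<times> 'b \<Rightarrow> datum" where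
  "encode_prod p = Cell (encode (fst p)) (encode (snd p))"
instance ..
end

instantiation list :: (encodable) encodable
begin
definition encode_list :: "'a list \<Rightarrow> datum" where
  "encode_list xs = list_datum (map encode xs)"
instance ..
end

lemma encode_simps [simp]:
  "encode (x::real) = Number x" "encode (a, b) = Cell (encode a) (encode b)"
  "encode ([] :: 'a::encodable list) = Empty" "encode (y # ys) = Cell (encode y) (encode ys)"
  by (simp_all add: encode_real_def encode_prod_def encode_list_def)

definition computable :: "('a::encodable \<Rightarrow> 'b::encodable) \<Rightarrow> bool" where
  "computable f \<longleftrightarrow> (\<exists>p. \<forall>x. run p (encode x) (encode (f x)))"

definition decidable :: "('a::encodable \<Rightarrow> bool) \<Rightarrow> bool" where
  "decidable P \<longleftrightarrow> computable (\<lambda>x. if P x then 1 else 0 :: real)"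

lemma computable_comp:
  assumes "computable f" "computable g"
  shows "computable (\<lambda>x. f (g x))"
proof -
  obtain p q where p: "\<And>x. run p (encode x) (encode (f x))" and q: "\<And>x. run q (encode x) (encode (g x))"
    using assms unfolding computable_def by blast
  have "run (Then q p) (encode x) (encode (f (g x)))" for x
    using q p by (rule run.intros(15))
  then show ?thesis unfolding computable_def by blast
qed

lemma computable_id: "computable (\<lambda>x. x)"
  unfolding computable_def using run.intros(1) by blast

lemma computable_zero: "computable (\<lambda>x. 0 :: real)"
  unfolding computable_def encode_simps using run.intros(2) by blast

lemma computable_one: "computable (\<lambda>x. 1 :: real)"
  unfolding computable_def encode_simps using run.intros(3) by blast

lemma computable_Nil: "computable (\<lambda>x. [])"
  unfolding computable_def encode_simps using run.intros(4) by blast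

lemma computable_Pair:
  assumes "computable f" "computable g"
  shows "computable (\<lambda>x. (f x, g x))"
proof -
  obtain p q where p: "\<And>x. run p (encode x) (encode (f x))" and q: "\<And>x. run q (encode x) (encode (g x))"
    using assms unfolding computable_def by blast
  then show ?thesis unfolding computable_def encode_simps using run.intros(5)[OF p q] by blast
qed

lemma computable_Cons:
  assumes "computable f" "computable g"
  shows "computable (\<lambda>x. f x # g x)"
proof -
  obtain p q where p: "\<And>x. run p (encode x) (encode (f x))" and q: "\<And>x. run q (encode x) (encode (g x))"
    using assms unfolding computable_def by blast
  then show ?thesis unfolding computable_def encode_simps using run.intros(5)[OF p q] by blast
qed

lemma computable_primitive:
  assumes "\<And>x. run p (encode x) (encode (h x))" "computable f"
  shows "computable (\<lambda>x. h (f x))"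
  by (rule computable_comp[OF _ assms(2)]) (use assms(1) computable_def in blast)

lemma computable_fst: "computable f \<Longrightarrow> computable (\<lambda>x. fst (f x))"
  by (rule computable_primitive[of First]) (simp_all add: encode_prod_def run.intros(6))

lemma computable_snd: "computable f \<Longrightarrow> computable (\<lambda>x. snd (f x))"
  by (rule computable_primitive[of Second]) (simp_all add: encode_prod_def run.intros(7))

lemma computable_arith:
  fixes f g :: "'a::encodable \<Rightarrow> real"
  assumes "computable f" "computable g"
  shows "computable (\<lambda>x. f x + g x)" "computable (\<lambda>x. f x - g x)" "computable (\<lambda>x. f x * g x)"
proof -
  note pair = computable_Pair[OF assms]
  have "run Plus (encode (p :: real \<times> real)) (encode (fst p + snd p))"
    "run Minus (encode p) (encode (fst p - snd p))" "run Times (encode p) (encode (fst p * snd p))" for p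
    by (simp_all add: encode_prod_def run.intros(11-13))
  from computable_primitive[OF this(1) pair] computable_primitive[OF this(2) pair]
    computable_primitive[OF this(3) pair]
  show "computable (\<lambda>x. f x + g x)" "computable (\<lambda>x. f x - g x)" "computable (\<lambda>x. f x * g x)"
    by simp_all
qed

lemma computable_if:
  assumes "decidable P" "computable f" "computable g"
  shows "computable (\<lambda>x. if P x then f x else g x)"
proof -
  obtain c p q where c: "\<And>x. run c (encode x) (Number (if P x then 1 else 0))"
    and p: "\<And>x. run p (encode x) (encode (f x))" and q: "\<And>x. run q (encode x) (encode (g x))"
    using assms unfolding decidable_def computable_def encode_simps by blast
  have "run (Branch c p q) (encode x) (encode (if P x then f x else g x))" for x
    using run.intros(16)[OF c[of x] _ p[of x]] run.intros(17)[OF c[of x] _ q[of x]] by auto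
  then show ?thesis unfolding computable_def by blast
qed

lemma decidable_less:
  fixes f g :: "'a::encodable \<Rightarrow> real"
  assumes "computable f" "computable g"
  shows "decidable (\<lambda>x. f x < g x)"
proof -
  obtain c where c: "\<And>x. run c (encode x) (Number (g x - f x))"
    using computable_arith(2)[OF assms(2,1)] unfolding computable_def encode_simps by blast
  have "run (Branch c One Zero) (encode x) (Number (if f x < g x then 1 else 0))" for x
    using run.intros(16)[OF c[of x] _ run.intros(3)] run.intros(17)[OF c[of x] _ run.intros(2)] by auto
  then show ?thesis unfolding decidable_def computable_def encode_simps by blast
qed

lemma decidable_if:
  assumes "decidable P" "decidable Q" "decidable R"
  shows "decidable (\<lambda>x. if P x then Q x else R x)"
proof -
  have "(\<lambda>x. if (if P x then Q x else R x) then 1 else 0 :: real)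
    = (\<lambda>x. if P x then if Q x then 1 else 0 else if R x then 1 else 0)" by auto
  then show ?thesis using computable_if[OF assms(1)] assms(2,3) unfolding decidable_def by auto
qed

lemma decidable_const: "decidable (\<lambda>x. b)"
  unfolding decidable_def by (cases b) (simp_all add: computable_one computable_zero)

lemma decidable_not:
  assumes "decidable P"
  shows "decidable (\<lambda>x. \<not> P x)"
proof -
  have "(\<lambda>x. \<not> P x) = (\<lambda>x. if P x then False else True)" by auto
  then show ?thesis using decidable_if[OF assms decidable_const decidable_const] by simp
qed

lemma decidable_eq:
  fixes f g :: "'a::encodable \<Rightarrow> real"
  assumes "computable f" "computable g"
  shows "decidable (\<lambda>x. f x = g x)"
proof -
  have "(\<lambda>x. f x = g x) = (\<lambda>x. if f x < g x then False else \<not> g x < f x)" by auto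
  then show ?thesis
    using decidable_if[OF decidable_less[OF assms] decidable_const decidable_not[OF decidable_less[OF assms(2,1)]]]
    by simp
qed

lemma decidable_le:
  fixes f g :: "'a::encodable \<Rightarrow> real"
  assumes "computable f" "computable g"
  shows "decidable (\<lambda>x. f x \<le> g x)"
  using decidable_not[OF decidable_less[OF assms(2,1)]] by (simp add: not_less)

lemma computable_const_real_uminus: "computable f \<Longrightarrow> computable (\<lambda>x. - f x :: real)"
  using computable_arith(2)[OF computable_zero, of f] by simp

lemma computable_min_max:
  fixes f g :: "'a::encodable \<Rightarrow> real"
  assumes "computable f" "computable g"
  shows "computable (\<lambda>x. min (f x) (g x))" "computable (\<lambda>x. max (f x) (g x))"
  unfolding min_def max_def by (intro computable_if decidable_le assms)+

lemma computable_abs_sgn: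
  fixes f :: "'a::encodable \<Rightarrow> real"
  assumes "computable f"
  shows "computable (\<lambda>x. \<bar>f x\<bar>)" "computable (\<lambda>x. sgn (f x))"
  unfolding abs_if sgn_if
  by (intro computable_if decidable_less decidable_eq computable_zero computable_one
      computable_const_real_uminus assms)+

lemma decidable_Nil:
  assumes "computable f"
  shows "decidable (\<lambda>x. f x = [])"
proof -
  have "run IsCell (encode xs) (encode (if xs = [] then 0 else 1 :: real))" for xs :: "'b list"
    using run.intros(8,9) by (cases xs) simp_all
  from computable_primitive[OF this assms]
  have "computable (\<lambda>x. if f x = [] then 0 else 1 :: real)" .
  moreover have "(\<lambda>x. if f x = [] then 0 else 1 :: real) = (\<lambda>x. if f x \<noteq> [] then 1 else 0)" by auto
  ultimately have "decidable (\<lambda>x. f x \<noteq> [])" unfolding decidable_def by (simp only:)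
  from decidable_not[OF this] show ?thesis by simp
qed

lemma computable_case_list:
  assumes "computable f" "computable g" "computable (\<lambda>p. h (fst p) (fst (snd p)) (snd (snd p)))"
  shows "computable (\<lambda>x. case f x of [] \<Rightarrow> g x | y # ys \<Rightarrow> h x y ys)"
proof -
  obtain c where c: "\<And>x. run c (encode x) (Number (if f x = [] then 1 else 0))"
    using decidable_Nil[OF assms(1)] unfolding decidable_def computable_def encode_simps by blast
  obtain p q r where p: "\<And>x. run p (encode x) (encode (f x))" and q: "\<And>x. run q (encode x) (encode (g x))"
    and r: "\<And>z. run r (encode z) (encode (h (fst z) (fst (snd z)) (snd (snd z))))"
    using assms unfolding computable_def by blast
  have "run (Branch c q (Then (Tuple Self p) r)) (encode x)
    (encode (case f x of [] \<Rightarrow> g x | y # ys \<Rightarrow> h x y ys))" for x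
  proof (cases "f x")
    case Nil
    then show ?thesis using run.intros(16)[OF c[of x] _ q[of x]] by simp
  next
    case (Cons y ys)
    have "run (Tuple Self p) (encode x) (encode (x, y, ys))"
      using run.intros(5)[OF run.intros(1) p[of x]] Cons by simp
    from run.intros(15)[OF this r] have "run (Then (Tuple Self p) r) (encode x) (encode (h x y ys))" by simp
    then show ?thesis using run.intros(17)[OF c[of x]] Cons by simp
  qed
  then show ?thesis unfolding computable_def by blast
qed

lemma decidable_case_list:
  assumes "computable f" "decidable P" "decidable (\<lambda>p. Q (fst p) (fst (snd p)) (snd (snd p)))"
  shows "decidable (\<lambda>x. case f x of [] \<Rightarrow> P x | y # ys \<Rightarrow> Q x y ys)"
proof -
  have eq: "(\<lambda>x. if (case f x of [] \<Rightarrow> P x | y # ys \<Rightarrow> Q x y ys) then 1 else 0 :: real)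
    = (\<lambda>x. case f x of [] \<Rightarrow> if P x then 1 else 0 | y # ys \<Rightarrow> if Q x y ys then 1 else 0)"
    by (auto split: list.split)
  show ?thesis unfolding decidable_def eq
    by (rule computable_case_list[OF assms(1) assms(2,3)[unfolded decidable_def]])
qed

text \<open>The measure ensures that the loop halts on every input, so that only total functions occur.\<close>

lemma computable_while:
  assumes "decidable b" "computable s" "computable f" "\<And>x. b x \<Longrightarrow> m (s x) < (m x :: nat)"
  shows "computable (\<lambda>x. while b s (f x))"
proof -
  obtain c where c: "\<And>x. run c (encode x) (Number (if b x then 1 else 0))"
    using assms(1) unfolding decidable_def computable_def encode_simps by blast
  obtain p where p: "\<And>x. run p (encode x) (encode (s x))"
    using assms(2) unfolding computable_def by blast
  have "run (While c p) (encode x) (encode (while b s x))" for x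
  proof (induction "m x" arbitrary: x rule: less_induct)
    case less
    show ?case
    proof (cases "b x")
      case True
      have "run (While c p) (encode (s x)) (encode (while b s (s x)))"
        by (rule less[OF assms(4)[OF True]])
      moreover have "0 < (if b x then 1 else 0 :: real)" using True by simp
      ultimately have "run (While c p) (encode x) (encode (while b s (s x)))"
        using run.intros(19)[OF c[of x] _ p[of x]] by blast
      then show ?thesis using True by (subst while_unfold) simp
    next
      case False
      then have "\<not> 0 < (if b x then 1 else 0 :: real)" by simp
      then have "run (While c p) (encode x) (encode x)" by (rule run.intros(18)[OF c])
      then show ?thesis using False by (subst while_unfold) simp
    qed
  qed
  then have "computable (while b s)" unfolding computable_def by blast
  from computable_comp[OF this assms(3)] show ?thesis .
qed

lemma computable_foldl:
  assumes "computable a" "computable xs" "computable (\<lambda>p. st (fst p) (fst (snd p)) (snd (snd p)))"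
  shows "computable (\<lambda>x. foldl (st x) (a x) (xs x))"
proof -
  let ?b = "\<lambda>s. snd (snd s) \<noteq> []"
  let ?s = "\<lambda>s. case snd (snd s) of [] \<Rightarrow> s | y # ys \<Rightarrow> (fst s, st (fst s) (fst (snd s)) y, ys)"
  have "while ?b ?s (x, b, ys) = (x, foldl (st x) b ys, [])" for x b ys
    by (induction ys arbitrary: b; subst while_unfold) simp_all
  then have eq: "(\<lambda>x. foldl (st x) (a x) (xs x)) = (\<lambda>x. fst (snd (while ?b ?s (x, a x, xs x))))"
    by simp
  have step: "computable (\<lambda>q. st (fst (fst q)) (fst (snd (fst q))) (fst (snd q)))"
    using computable_comp[OF assms(3), of "\<lambda>q. (fst (fst q), fst (snd (fst q)), fst (snd q))"]
    by (simp add: computable_Pair computable_fst computable_snd computable_id)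
  show ?thesis unfolding eq
  proof (intro computable_fst computable_snd computable_while[where m = "\<lambda>s. length (snd (snd s))"])
    show "decidable ?b" by (intro decidable_not decidable_Nil computable_snd computable_id)
    show "computable ?s"
      by (intro computable_case_list computable_Pair computable_fst computable_snd computable_id step)
    show "length (snd (snd (?s s))) < length (snd (snd s))" if "snd (snd s) \<noteq> []" for s
      using that by (auto split: list.split)
  qed (intro computable_Pair computable_id assms)
qed

lemma foldl_Cons_map: "foldl (\<lambda>a x. g x # a) ys xs = rev (map g xs) @ ys"
  by (induction xs arbitrary: ys) auto

lemma computable_rev:
  assumes "computable f"
  shows "computable (\<lambda>x. rev (f x))"
proof -
  have eq: "(\<lambda>x. rev (f x)) = (\<lambda>x. foldl (\<lambda>a y. y # a) [] (f x))"
    by (simp add: foldl_Cons_map[of "\<lambda>y. y"])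
  show ?thesis unfolding eq
    by (intro computable_foldl computable_Nil assms computable_Cons computable_fst computable_snd computable_id)
qed

lemma computable_map:
  assumes "computable xs" "computable (\<lambda>p. h (fst p) (snd p))"
  shows "computable (\<lambda>x. map (h x) (xs x))"
proof -
  have eq: "(\<lambda>x. map (h x) (xs x)) = (\<lambda>x. rev (foldl (\<lambda>a y. h x y # a) [] (xs x)))"
    by (simp add: foldl_Cons_map)
  have step: "computable (\<lambda>q. h (fst q) (snd (snd q)))"
    using computable_comp[OF assms(2), of "\<lambda>q. (fst q, snd (snd q))"]
    by (simp add: computable_Pair computable_fst computable_snd computable_id)
  show ?thesis unfolding eq
    by (intro step computable_rev computable_foldl computable_Nil assms(1) computable_Cons computable_fst computable_snd computable_id)
qed

lemma computable_append:
  assumes "computable f" "computable g"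
  shows "computable (\<lambda>x. f x @ g x)"
proof -
  have eq: "(\<lambda>x. f x @ g x) = (\<lambda>x. foldl (\<lambda>a y. y # a) (g x) (rev (f x)))"
    by (simp add: foldl_Cons_map[of "\<lambda>y. y"])
  show ?thesis unfolding eq
    by (intro computable_foldl computable_rev assms computable_Cons computable_fst computable_snd computable_id)
qed

text \<open>These rules decide computability by the form of a term. Functions with several arguments are
  considered as functions of a tuple.\<close>

lemmas computable_intros =
  computable_id computable_zero computable_one computable_Nil computable_Pair computable_Cons
  computable_fst computable_snd computable_arith computable_const_real_uminus computable_min_max
  computable_abs_sgn computable_if decidable_less decidable_eq decidable_le decidable_not decidable_Nil
  computable_case_list decidable_case_list decidable_const computable_foldl computable_rev
  computable_map computable_append

section \<open>The decompositions are computable\<close>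

lemma computable_comp2:
  assumes "computable (\<lambda>p. g (fst p) (snd p))" "computable a" "computable b"
  shows "computable (\<lambda>x. g (a x) (b x))"
  using computable_comp[OF assms(1) computable_Pair[OF assms(2,3)]] by simp

lemma computable_comp3:
  assumes "computable (\<lambda>p. g (fst p) (fst (snd p)) (snd (snd p)))" "computable a" "computable b" "computable c"
  shows "computable (\<lambda>x. g (a x) (b x) (c x))"
  using computable_comp[OF assms(1) computable_Pair[OF assms(2) computable_Pair[OF assms(3,4)]]] by simp

text \<open>The lemmas about \<open>foldl\<close> express the recursions over kinks by iterations with an accumulator.\<close>

lemma rise_foldl:
  "(case foldl (\<lambda>(s, a, x, y) (t, b). (s + a * (min y t - min x t), b, max x t, max y t)) (s, a, x, y) ks
    of (s, a, x, y) \<Rightarrow> s + a * (y - x)) = s + rise a ks x y"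
  by (induction ks arbitrary: s a x y) (auto simp: case_prod_beta algebra_simps)

lemma pl_foldl:
  "pl F x = (case foldl (\<lambda>(s, a, x, y) (t, b). (s + a * (min y t - min x t), b, max x t, max y t))
      (snd (snd F), fst F, 0, x) (fst (snd F)) of (s, a, x, y) \<Rightarrow> s + a * (y - x))"
  by (cases F) (simp add: rise_foldl)

lemma computable_pl:
  assumes "computable F" "computable y"
  shows "computable (\<lambda>x. pl (F x) (y x))"
  by (rule computable_comp2[OF _ assms], unfold pl_foldl case_prod_beta) (intro computable_intros)

lemma prune_foldl:
  "rev (fst (foldl (\<lambda>(r, a) (t, b). if b = a then (r, a) else ((t, b) # r, b)) (r, a) ks)) = rev r @ prune a ks"
  by (induction ks arbitrary: r a) auto

lemma computable_prune:
  assumes "computable a" "computable ks"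
  shows "computable (\<lambda>x. prune (a x) (ks x))"
proof -
  have eq: "prune a ks = rev (fst (foldl (\<lambda>(r, a) (t, b). if b = a then (r, a) else ((t, b) # r, b)) ([], a) ks))" for a ks
    by (simp add: prune_foldl)
  show ?thesis
    by (rule computable_comp2[OF _ assms], unfold eq case_prod_beta) (intro computable_intros)
qed

lemma computable_inner:
  assumes "computable u" "computable ls"
  shows "computable (\<lambda>x. inner (u x) (ls x))"
  by (rule computable_comp2[OF _ assms], unfold inner_def case_prod_beta)
    (intro computable_intros computable_prune)

lemma computable_outer:
  assumes "computable u" "computable b" "computable ls" "computable c"
  shows "computable (\<lambda>x. outer (u x) (b x) (ls x) (c x))"
proof -
  have "computable (\<lambda>p. outer (fst (fst p)) (snd (fst p)) (fst (snd p)) (snd (snd p)))"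
    by (unfold outer_def case_prod_beta)
      (intro computable_intros computable_prune computable_pl computable_inner)
  from computable_comp[OF this computable_Pair[OF computable_Pair[OF assms(1,2)] computable_Pair[OF assms(3,4)]]]
  show ?thesis by simp
qed

lemma computable_mono_decomposition: "computable mono_decomposition"
proof -
  have labels: "computable (\<lambda>x. peel_labels (ks x))" if "computable ks" for ks :: "'a::encodable \<Rightarrow> _"
    by (rule computable_comp[OF _ that], unfold peel_labels_def case_prod_beta) (intro computable_intros)
  have sign: "computable (\<lambda>x. peel_sign (ks x))" if "computable ks" for ks :: "'a::encodable \<Rightarrow> _"
    by (rule computable_comp[OF _ that], unfold peel_sign_def case_prod_beta) (intro computable_intros)
  have step: "computable mono_step"
    unfolding mono_step_def case_prod_beta
    by (intro computable_intros computable_inner computable_outer labels sign)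
  have cond: "mono_cond = (\<lambda>s. case fst (snd (snd s)) of [] \<Rightarrow> False | _ # r \<Rightarrow>
      (case r of [] \<Rightarrow> False | _ # r \<Rightarrow> r \<noteq> []))"
    by (auto simp: mono_cond_def fun_eq_iff split: list.split)
  have "decidable mono_cond" unfolding cond by (intro computable_intros)
  then have loop: "computable (\<lambda>x. while mono_cond mono_step (f x))" if "computable f"
    for f :: "'a::encodable \<Rightarrow> _"
    using step that mono_step_decreases by (rule computable_while)
  have eq: "mono_decomposition = (\<lambda>F. if fst (snd F) = []
      then (if fst F = 1 then [] else [(1, [(0, fst F)], 0), (fst F, [(0, 1)], 0)])
      else (case while mono_cond mono_step ([], F) of (acc, G) \<Rightarrow> G # acc))"
    by (auto simp: mono_decomposition_def mono_loop_def fun_eq_iff)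
  show ?thesis unfolding eq case_prod_beta by (intro computable_intros loop)
qed

lemma alternate_foldl:
  "rev (fst (foldl (\<lambda>(r, a) t. ((t, - a) # r, - a)) (r, a) ts)) = rev r @ alternate a ts"
  by (induction ts arbitrary: r a) auto

lemma computable_zigzag_decomposition:
  assumes "computable a" "computable ts" "computable c"
  shows "computable (\<lambda>x. zigzag_decomposition (a x) (ts x) (c x))"
proof -
  have alt: "computable (\<lambda>x. alternate (a x) (ts x))" if "computable a" "computable ts"
    for a :: "'d::encodable \<Rightarrow> real" and ts
  proof -
    have eq: "alternate a ts = rev (fst (foldl (\<lambda>(r, a) t. ((t, - a) # r, - a)) ([], a) ts))" for a ts
      by (simp add: alternate_foldl)
    show ?thesis
      by (rule computable_comp2[OF _ that], unfold eq case_prod_beta) (intro computable_intros)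
  qed
  have scond: "scan_cond = (\<lambda>s. case snd s of [] \<Rightarrow> False | p # us \<Rightarrow> (case us of [] \<Rightarrow> False | q # vs \<Rightarrow>
      (case vs of [] \<Rightarrow> False | r # ws \<Rightarrow> r - q < q - p)))"
    by (auto simp: scan_cond_def fun_eq_iff split: list.split)
  have "decidable scan_cond" unfolding scond by (intro computable_intros)
  moreover have "computable scan_step" unfolding scan_step_def case_prod_beta by (intro computable_intros)
  ultimately have loop: "computable (\<lambda>x. while scan_cond scan_step (f x))" if "computable f"
    for f :: "'d::encodable \<Rightarrow> _"
    using that
  proof (rule computable_while)
    show "length (snd (scan_step s)) < length (snd s)" if "scan_cond s" for s
      using that by (auto simp: scan_cond_def scan_step_def split: prod.splits list.splits)
  qed
  have scan: "computable (\<lambda>x. scan (ts x))" if "computable ts" for ts :: "'d::encodable \<Rightarrow> _"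
    unfolding scan_def using that by (intro loop computable_intros)
  have step: "computable zigzag_step"
    unfolding zigzag_step_def case_prod_beta fold_map_def
    by (intro computable_intros scan computable_pl)
  have cond: "zigzag_cond = (\<lambda>s. case snd s of [] \<Rightarrow> False | _ # r \<Rightarrow>
      (case r of [] \<Rightarrow> False | _ # r \<Rightarrow> r \<noteq> []))"
    by (auto simp: zigzag_cond_def fun_eq_iff split: list.split)
  have "decidable zigzag_cond" unfolding cond by (intro computable_intros)
  then have loop: "computable (\<lambda>x. while zigzag_cond zigzag_step (f x))" if "computable f"
    for f :: "'d::encodable \<Rightarrow> _"
    using step that zigzag_step_decreases by (rule computable_while)
  show ?thesis
    by (rule computable_comp3[OF _ assms], unfold zigzag_decomposition_def case_prod_beta)
      (intro computable_intros loop alt)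
qed

text \<open>The component \<open>z\<close> of the state is a flag: it becomes 1 at the first constant edge.\<close>

lemma ones_foldl:
  "z \<noteq> 0 \<Longrightarrow> rev (fst (foldl (\<lambda>(r, p, z) (t, b). if z = 0 then
       if b = 0 then ((t, 0, p) # r, p, 1) else ((t, 1, b) # r, b, 0)
     else ((t, 1, b) # r, p, z)) (r, p, z::real) ks)) = rev r @ map (\<lambda>(s, d). (s, 1, d)) ks"
  by (induction ks arbitrary: r) auto

lemma collapse_labels_foldl:
  "rev (fst (foldl (\<lambda>(r, p, z) (t, b). if z = 0 then
       if b = 0 then ((t, 0, p) # r, p, 1) else ((t, 1, b) # r, b, 0)
     else ((t, 1, b) # r, p, z)) (r, p, 0::real) ks)) = rev r @ collapse_labels p ks"
  by (induction ks arbitrary: r p) (auto simp: ones_foldl)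

lemma member_zero_foldl:
  "foldl (\<lambda>z b. if b = 0 then 1 else z) z xs = (if (0::real) \<in> set xs then 1 else z :: real)"
  by (induction xs arbitrary: z) auto

lemma computable_collapse: "computable collapse"
proof -
  have labels: "computable (\<lambda>x. collapse_labels (p x) (ks x))" if "computable p" "computable ks"
    for p :: "'a::encodable \<Rightarrow> real" and ks
  proof -
    have eq: "collapse_labels p ks = rev (fst (foldl (\<lambda>(r, p, z) (t, b). if z = 0 then
       if b = 0 then ((t, 0, p) # r, p, 1) else ((t, 1, b) # r, b, 0)
     else ((t, 1, b) # r, p, z)) ([], p, 0::real) ks))" for p ks
      by (simp add: collapse_labels_foldl)
    show ?thesis
      by (rule computable_comp2[OF _ that], unfold eq case_prod_beta) (intro computable_intros)
  qed
  have next_slope: "computable (\<lambda>x. next_slope (ks x))" if "computable ks" for ks :: "'a::encodable \<Rightarrow> _"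
    by (rule computable_comp[OF _ that], unfold next_slope_def case_prod_beta) (intro computable_intros)
  have step: "computable collapse_step"
    unfolding collapse_step_def case_prod_beta
    by (intro computable_intros computable_inner computable_outer labels next_slope)
  have cond: "collapse_cond = (\<lambda>s. foldl (\<lambda>z b. if b = 0 then 1 else z :: real) 0
      (fst (snd s) # map snd (fst (snd (snd s)))) = 1)"
    unfolding fun_eq_iff member_zero_foldl by (auto simp: collapse_cond_def)
  have "decidable collapse_cond" unfolding cond by (intro computable_intros)
  then have loop: "computable (\<lambda>x. while collapse_cond collapse_step (f x))" if "computable f"
    for f :: "'a::encodable \<Rightarrow> _"
    using step that collapse_step_decreases by (rule computable_while)
  show ?thesis unfolding collapse_def[abs_def] by (intro computable_intros loop)
qed

lemma computable_decomposition: "computable decomposition"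
proof -
  have labels: "computable (\<lambda>x. sign_labels (ks x))" if "computable ks" for ks :: "'a::encodable \<Rightarrow> _"
    by (rule computable_comp[OF _ that], unfold sign_labels_def case_prod_beta) (intro computable_intros)
  show ?thesis
    unfolding decomposition_def[abs_def] case_prod_beta
    by (intro computable_intros computable_inner computable_outer labels
        computable_comp[OF computable_collapse] computable_comp[OF computable_mono_decomposition]
        computable_zigzag_decomposition)
qed

text \<open>The conversion from separate lists of breaks and slopes. The empty list of slopes, which does not
  represent a function, gets an arbitrary value.\<close>

definition of_lists :: "real list \<times> real list \<times> real \<Rightarrow> kinked" where
  "of_lists = (\<lambda>(ts, as, c). case as of [] \<Rightarrow> (0, [], c) | a # r \<Rightarrow> (a, zip ts r, c))"

definition to_lists :: "kinked \<Rightarrow> real list \<times> real list \<times> real" where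
  "to_lists = (\<lambda>(a, ks, c). (map fst ks, slope_list a ks, c))"

lemma zip_foldl:
  "rev (fst (foldl (\<lambda>(r, as) t. case as of [] \<Rightarrow> (r, []) | a # bs \<Rightarrow> ((t, a) # r, bs)) (r, as) ts))
    = rev r @ zip ts as"
proof (induction ts arbitrary: r as)
  case (Cons t ts)
  then show ?case by (cases as) simp_all
qed simp

lemma computable_of_lists: "computable of_lists"
proof -
  have zip: "computable (\<lambda>x. zip (ts x) (as x))" if "computable ts" "computable as"
    for ts as :: "'a::encodable \<Rightarrow> real list"
  proof -
    have eq: "zip ts as = rev (fst (foldl (\<lambda>(r, as) t. case as of [] \<Rightarrow> (r, [])
      | a # bs \<Rightarrow> ((t, a) # r, bs)) ([], as) ts))" for ts as :: "real list"
      by (simp add: zip_foldl)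
    show ?thesis
      by (rule computable_comp2[OF _ that], unfold eq case_prod_beta) (intro computable_intros)
  qed
  show ?thesis unfolding of_lists_def case_prod_beta by (intro computable_intros zip)
qed

lemma computable_to_lists: "computable to_lists"
  unfolding to_lists_def case_prod_beta by (intro computable_intros)

lemma of_lists_to_lists [simp]: "of_lists (to_lists F) = F"
  by (cases F) (simp add: of_lists_def to_lists_def zip_map_fst_snd)

lemma function_datum_pl:
  assumes "proper a ks"
  shows "function_datum (pl (a, ks, c)) = encode (to_lists (a, ks, c))"
proof -
  have "map (\<lambda>a. Number (of_int a)) (slopes (pl (a, ks, c))) = map Number (slope_list a ks)"
    unfolding proper_slopes(2)[OF assms, of c, symmetric] map_map comp_def ..
  moreover have "breaks (pl (a, ks, c)) = map fst ks"
    using assms by (intro breaks_pl) (simp add: proper_def)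
  ultimately show ?thesis
    unfolding function_datum_def pl_0 to_lists_def prod.case encode_simps encode_list_def
    by (simp add: encode_real_def[abs_def])
qed

section \<open>Divisor chains along the slopes\<close>

text \<open>Off a finite set, the slope is \<open>P x * R x\<close> up to a constant sign, where \<open>P\<close> grows and \<open>R\<close> shrinks from left
  to right in the sense of divisibility. For a single prime this says that the total drop of its
  multiplicity along the slopes is at most the multiplicity at the left end.\<close>

definition divisor_chain_data ::
    "(real \<Rightarrow> real) \<Rightarrow> real set \<Rightarrow> (real \<Rightarrow> int) \<Rightarrow> (real \<Rightarrow> int) \<Rightarrow> int \<Rightarrow> bool" where
  "divisor_chain_data f S P R \<sigma> \<longleftrightarrow> finite S \<and> \<bar>\<sigma>\<bar> = 1 \<and> (\<forall>x. 0 < P x) \<and> (\<forall>x. 0 < R x) \<and>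
     (\<forall>x y. x \<le> y \<longrightarrow> P x dvd P y) \<and> (\<forall>x y. x \<le> y \<longrightarrow> R y dvd R x) \<and>
     (\<forall>x. x \<notin> S \<longrightarrow> (f has_real_derivative of_int (\<sigma> * (P x * R x))) (at x))"

definition divisor_chains :: "(real \<Rightarrow> real) \<Rightarrow> bool" where
  "divisor_chains f \<longleftrightarrow> (\<exists>S P R \<sigma>. divisor_chain_data f S P R \<sigma>)"

lemma one_kink_rise:
  "x \<le> t \<Longrightarrow> pl (a, [(t, b)], c) x = pl (a, [(t, b)], c) t + a * (x - t)"
  "t \<le> x \<Longrightarrow> pl (a, [(t, b)], c) x = pl (a, [(t, b)], c) t + b * (x - t)"
  using pl_diff[of a "[(t, b)]" c x t] by (simp_all add: min_absorb1 min_absorb2 max_absorb1 max_absorb2)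

text \<open>A binomial whose slopes have opposite signs takes the same value at two points on different sides of
  its kink.\<close>

lemma injective_binomial:
  assumes "rational_binomial g" "inj g"
  obtains a b t c where "0 < a * b" "g = pl (of_int a, [(t, of_int b)], c)"
proof -
  obtain b1 b2 where g: "binomial_of_slopes b1 b2 g" using assms(1) by (auto simp: rational_binomial_def)
  then obtain a b t c where ab: "{a, b} = {b1, b2}" "g = pl (of_int a, [(t, of_int b)], c)"
    using binomial_is_pl by metis
  have nz: "a \<noteq> 0" "b \<noteq> 0" using g ab(1) by (auto simp: binomial_of_slopes_def doubleton_eq_iff)
  have "0 < a * b"
  proof (rule ccontr)
    assume "\<not> 0 < a * b"
    then have neg: "a * b < 0" using nz by (simp add: not_less le_less)
    (* moving by the inverse of the absolute slope changes the value by exactly 1 on either side *)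
    let ?x = "t - 1 / \<bar>of_int a\<bar>" and ?y = "t + 1 / \<bar>of_int b\<bar>"
    have "of_int a * (?x - t) = of_int b * (?y - t)"
      using neg nz by (auto simp: mult_less_0_iff)
    moreover have "g ?x = g t + of_int a * (?x - t)" unfolding ab(2) by (rule one_kink_rise(1)) simp
    moreover have "g ?y = g t + of_int b * (?y - t)" unfolding ab(2) by (rule one_kink_rise(2)) simp
    ultimately have "g ?x = g ?y" by (simp only:)
    then have "?x = ?y" using assms(2) by (simp add: inj_eq)
    moreover have "?x < ?y" by (rule order_less_trans[of ?x t]) (use nz in auto)
    ultimately show False by (simp only: less_irrefl)
  qed
  with ab(2) that show thesis by blast
qed

lemma same_sign_kink:
  assumes "0 < a * b" "g = pl (of_int a, [(t, of_int b)], c)"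
  shows "surj g" "inj g" "mono g \<and> 0 < a \<and> 0 < b \<or> antimono g \<and> a < 0 \<and> b < 0"
proof -
  note step = one_kink_rise[where a = "of_int a" and b = "of_int b" and t = t and c = c, folded assms(2)]
  have sgn: "0 < a \<and> 0 < b \<or> a < 0 \<and> b < 0" using assms(1) by (simp add: zero_less_mult_iff)
  show "surj g"
  proof (rule surjI)
    fix y
    show "g (if (y - g t) / of_int a \<le> 0 then t + (y - g t) / of_int a else t + (y - g t) / of_int b) = y"
    proof (cases "(y - g t) / of_int a \<le> 0")
      case True
      then show ?thesis using step(1)[of "t + (y - g t) / of_int a"] sgn by auto
    next
      case False
      then have "0 \<le> (y - g t) / of_int b"
        using sgn by (auto simp: zero_le_divide_iff divide_le_0_iff)
      then show ?thesis using False step(2)[of "t + (y - g t) / of_int b"] sgn by auto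
    qed
  qed
  have pos: "strict_mono (pl (of_int a, [(t, of_int b)], c))" if "0 < a" "0 < b" for a b :: int and c
    by (rule pl_strict_mono) (use that in auto)
  show "inj g" and "mono g \<and> 0 < a \<and> 0 < b \<or> antimono g \<and> a < 0 \<and> b < 0"
  proof -
    have "inj g \<and> (mono g \<and> 0 < a \<and> 0 < b \<or> antimono g \<and> a < 0 \<and> b < 0)"
    proof (cases "0 < a")
      case True
      then have "strict_mono g" using pos sgn assms(2) by auto
      then show ?thesis using True sgn by (auto simp: strict_mono_mono strict_mono_imp_inj_on)
    next
      case False
      define h where "h = pl (of_int (- a), [(t, of_int (- b))], - c)"
      have h: "strict_mono h" unfolding h_def using False sgn by (intro pos) auto
      have g: "g x = - h x" for x by (simp add: h_def assms(2) algebra_simps)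
      have "inj g" using strict_mono_imp_inj_on[OF h] by (auto simp: inj_on_def g)
      moreover have "antimono g" using strict_mono_mono[OF h] by (auto simp: antimono_def mono_def g)
      ultimately show ?thesis using False sgn by auto
    qed
    then show "inj g" "mono g \<and> 0 < a \<and> 0 < b \<or> antimono g \<and> a < 0 \<and> b < 0" by auto
  qed
qed

text \<open>A binomial with slopes \<open>a, b\<close> has the chains \<open>1, \<bar>b\<bar>\<close> and \<open>\<bar>a\<bar>, 1\<close>. If it is decreasing, the
  points of the outer function are passed in reverse order, and its two chains change roles.\<close>

lemma divisor_chains_comp:
  assumes "divisor_chains f" "0 < a * b" "g = pl (of_int a, [(t, of_int b)], c)"
  shows "divisor_chains (f \<circ> g)"
proof -
  note g = same_sign_kink[OF assms(2,3)]
  obtain S P R \<sigma> where "divisor_chain_data f S P R \<sigma>"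
    using assms(1) unfolding divisor_chains_def by blast
  then have S: "finite S" "\<bar>\<sigma>\<bar> = 1" "\<And>x. 0 < P x" "\<And>x. 0 < R x"
    "\<And>x y. x \<le> y \<Longrightarrow> P x dvd P y" "\<And>x y. x \<le> y \<Longrightarrow> R y dvd R x"
    "\<And>x. x \<notin> S \<Longrightarrow> (f has_real_derivative of_int (\<sigma> * (P x * R x))) (at x)"
    unfolding divisor_chain_data_def by blast+
  define P' where "P' x = (if x < t then 1 else \<bar>b\<bar>)" for x
  define R' where "R' x = (if x < t then \<bar>a\<bar> else 1)" for x
  have PR': "0 < P' x" "0 < R' x" for x using assms(2) by (auto simp: P'_def R'_def)
  have chain': "P' x dvd P' y" "R' y dvd R' x" if "x \<le> y" for x y
    using that by (auto simp: P'_def R'_def)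
  have sgn: "sgn a = sgn b" "\<bar>sgn a\<bar> = 1" using g(3) by auto
  have deriv: "(g has_real_derivative of_int (sgn a * (P' x * R' x))) (at x)" if "x \<noteq> t" for x
  proof (cases "x < t")
    case True
    then have "(rise (of_int a) [(t, of_int b)] 0 has_real_derivative of_int a) (at x)"
      using rise_deriv[of "[(t, of_int b)]" 0 x "of_int a" 0] by simp
    moreover have "sgn a * \<bar>a\<bar> = a" by (rule sgn_mult_abs)
    ultimately show ?thesis using True by (simp only: assms(3) pl_has_deriv_iff P'_def R'_def if_True mult_1)
  next
    case False
    then have "(rise (of_int a) [(t, of_int b)] 0 has_real_derivative of_int b) (at x)"
      using rise_deriv[of "[(t, of_int b)]" 1 x "of_int a" 0] that by simp
    moreover have "sgn a * \<bar>b\<bar> = b" unfolding sgn(1) by (rule sgn_mult_abs)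
    ultimately show ?thesis using False by (simp only: assms(3) pl_has_deriv_iff P'_def R'_def if_False mult_1_right)
  qed
  have fin: "finite (insert t (g -` S))" using finite_vimageI[OF S(1) g(2)] by simp
  have D: "((f \<circ> g) has_real_derivative
      of_int ((\<sigma> * sgn a) * ((P (g x) * R (g x)) * (P' x * R' x)))) (at x)" if "x \<notin> insert t (g -` S)" for x
  proof -
    have "(f has_real_derivative of_int (\<sigma> * (P (g x) * R (g x)))) (at (g x))" using that S(7) by simp
    from DERIV_chain[OF this deriv[of x]] that show ?thesis by (simp add: mult_ac)
  qed
  have abs: "\<bar>\<sigma> * sgn a\<bar> = 1" using S(2) sgn(2) by (simp add: abs_mult)
  from g(3) show ?thesis
  proof
    assume "mono g \<and> 0 < a \<and> 0 < b"
    then have "g x \<le> g y" if "x \<le> y" for x y using that by (auto dest: monoD)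
    with S PR' chain' fin abs D
    have "divisor_chain_data (f \<circ> g) (insert t (g -` S)) (\<lambda>x. P (g x) * P' x) (\<lambda>x. R (g x) * R' x) (\<sigma> * sgn a)"
      unfolding divisor_chain_data_def by (auto simp: mult_dvd_mono mult_ac)
    then show ?thesis unfolding divisor_chains_def by blast
  next
    assume "antimono g \<and> a < 0 \<and> b < 0"
    then have "g y \<le> g x" if "x \<le> y" for x y using that by (auto dest: antimonoD)
    with S PR' chain' fin abs D
    have "divisor_chain_data (f \<circ> g) (insert t (g -` S)) (\<lambda>x. R (g x) * P' x) (\<lambda>x. P (g x) * R' x) (\<sigma> * sgn a)"
      unfolding divisor_chain_data_def by (auto simp: mult_dvd_mono mult_ac)
    then show ?thesis unfolding divisor_chains_def by blast
  qed
qed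

lemma compose_append: "compose (gs @ hs) = compose gs \<circ> compose hs"
  by (induction gs) (auto simp: comp_assoc)

text \<open>The innermost factor of an injective composition is injective, hence here also surjective; so the
  composition of the other factors is injective, too.\<close>

theorem divisor_chains_compose:
  assumes "\<forall>g\<in>set gs. rational_binomial g" "inj (compose gs)"
  shows "divisor_chains (compose gs)"
  using assms
proof (induction gs rule: rev_induct)
  case Nil
  have "divisor_chain_data (\<lambda>x. x) {} (\<lambda>_. 1) (\<lambda>_. 1) 1"
    unfolding divisor_chain_data_def by (auto intro!: derivative_eq_intros)
  then show ?case unfolding divisor_chains_def by (auto simp: id_def)
next
  case (snoc g gs)
  have c: "compose (gs @ [g]) = compose gs \<circ> g" by (simp add: compose_append)
  have "inj g" using snoc.prems(2) unfolding c by (rule inj_on_imageI2)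
  then obtain a b t k where g: "0 < a * b" "g = pl (of_int a, [(t, of_int b)], k)"
    using injective_binomial snoc.prems(1) by (metis in_set_conv_decomp)
  have "inj (compose gs)"
  proof (rule injI)
    fix x y assume "compose gs x = compose gs y"
    moreover obtain x' y' where "x = g x'" "y = g y'" using same_sign_kink(1)[OF g] by (metis surjD)
    ultimately show "x = y" using snoc.prems(2) unfolding c by (auto dest: injD)
  qed
  with snoc have "divisor_chains (compose gs)" by simp
  from divisor_chains_comp[OF this g] show ?case by (simp only: c)
qed

lemma ratio_denominator:
  assumes "0 < w"
  shows "snd (quotient_of (of_int u / of_int w)) = w div gcd u w"
proof -
  have "(of_int u / of_int w :: rat) = Fract u w" by (rule Fract_of_int_quotient[symmetric])
  moreover have "Rat.normalize (u, w) = (u div gcd u w, w div gcd u w)"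
    using assms by (simp add: Rat.normalize_def Let_def)
  ultimately show ?thesis by (simp only: quotient_of_Fract snd_conv)
qed

lemma ratio_denominator_dvd:
  assumes "0 < w"
  shows "snd (quotient_of (of_int u / of_int w)) dvd w"
  unfolding ratio_denominator[OF assms] by (rule dvdI[of _ _ "gcd u w"]) simp

text \<open>Between neighbouring edges, \<open>P\<close> is multiplied by some \<open>u\<close> and \<open>R\<close> is divided by some \<open>w\<close>. The ratio of the
  slopes is \<open>u / w\<close>, so its denominator divides \<open>w\<close>, and the product of all \<open>w\<close> divides \<open>R\<close> on the first
  edge.\<close>

theorem divisor_chains_dvd:
  assumes "divisor_chains f" "has_slopes f as" "\<forall>a\<in>set as. 1 \<le> a"
  shows "(\<Prod>i = 1..length as - 1. snd (quotient_of (of_int (as ! i) / of_int (as ! (i - 1))))) dvd as ! 0"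
proof -
  obtain S P R \<sigma> where "divisor_chain_data f S P R \<sigma>"
    using assms(1) unfolding divisor_chains_def by blast
  then have S: "finite S" "\<bar>\<sigma>\<bar> = 1" "\<And>x. 0 < P x" "\<And>x. 0 < R x"
    "\<And>x y. x \<le> y \<Longrightarrow> P x dvd P y" "\<And>x y. x \<le> y \<Longrightarrow> R y dvd R x"
    "\<And>x. x \<notin> S \<Longrightarrow> (f has_real_derivative of_int (\<sigma> * (P x * R x))) (at x)"
    unfolding divisor_chain_data_def by blast+
  let ?T = "breaks f"
  have sT: "sorted_wrt (<) ?T" by (simp add: breaks_def)
  have len: "length as = Suc (length ?T)" using assms(2) by (simp add: has_slopes_def)
  have "\<exists>x. x \<notin> S \<and> (0 < i \<longrightarrow> ?T ! (i - 1) < x) \<and> (i < length ?T \<longrightarrow> x < ?T ! i)" for i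
  proof -
    (* unbounded edges are cut off at distance 1 from their break *)
    let ?l = "if 0 < i then ?T ! (i - 1) else ?T ! i - 1"
    let ?r = "if i < length ?T then ?T ! i else ?l + 1"
    have "?l < ?r" using sorted_wrt_nth_less[OF sT, of "i - 1" i] by auto
    then have "infinite ({?l<..<?r} - S)" using S(1) by (simp del: if_split)
    then obtain x where "x \<in> {?l<..<?r} - S" using infinite_imp_nonempty by blast
    then show ?thesis by (intro exI[of _ x]) (auto split: if_splits)
  qed
  then obtain x where x: "\<And>i. x i \<notin> S" "\<And>i. 0 < i \<Longrightarrow> ?T ! (i - 1) < x i" "\<And>i. i < length ?T \<Longrightarrow> x i < ?T ! i"
    by metis
  have as: "as ! i = P (x i) * R (x i)" if "i < length as" for i
  proof -
    have "(f has_real_derivative of_int (as ! i)) (at (x i))"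
      using assms(2) x that unfolding has_slopes_def by auto
    then have "of_int (as ! i) = (of_int (\<sigma> * (P (x i) * R (x i))) :: real)"
      using S(7)[OF x(1)] by (rule DERIV_unique)
    then have "as ! i = \<sigma> * (P (x i) * R (x i))" by (simp only: of_int_eq_iff)
    moreover have "1 \<le> as ! i" using assms(3) that by auto
    moreover have "0 < P (x i) * R (x i)" using S(3,4) by simp
    moreover have "\<sigma> = 1 \<or> \<sigma> = -1" using S(2) by linarith
    ultimately show ?thesis by (elim disjE) simp_all
  qed
  have "(\<Prod>i = 1..m. snd (quotient_of (of_int (as ! i) / of_int (as ! (i - 1))))) * R (x m) dvd R (x 0)"
    if "m < length as" for m
    using that
  proof (induction m)
    case (Suc m)
    have "x m \<le> x (Suc m)" using x(3)[of m] x(2)[of "Suc m"] Suc.prems len by force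
    then obtain u w where uw: "P (x (Suc m)) = P (x m) * u" "R (x m) = R (x (Suc m)) * w"
      using S(5,6) by (meson dvdE)
    have w: "0 < w" using S(4)[of "x m"] S(4)[of "x (Suc m)"] unfolding uw(2) by (simp add: zero_less_mult_iff)
    define k where "k = P (x m) * R (x (Suc m))"
    have "0 < k" using S(3)[of "x m"] S(4)[of "x (Suc m)"] by (simp add: k_def)
    have "as ! Suc m = k * u" unfolding as[OF Suc.prems] k_def uw(1) by (simp only: mult_ac)
    moreover have "as ! m = k * w"
      unfolding as[OF Suc_lessD[OF Suc.prems]] k_def uw(2) by (simp only: mult_ac)
    ultimately have "(of_int (as ! Suc m) / of_int (as ! m) :: rat) = of_int u / of_int w"
      using \<open>0 < k\<close> by simp
    then have "snd (quotient_of (of_int (as ! Suc m) / of_int (as ! m))) * R (x (Suc m)) dvd R (x m)"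
      using ratio_denominator_dvd[OF w, of u] by (simp add: uw(2) mult.commute mult_dvd_mono)
    then have "(\<Prod>i = 1..Suc m. snd (quotient_of (of_int (as ! i) / of_int (as ! (i - 1))))) * R (x (Suc m))
      dvd (\<Prod>i = 1..m. snd (quotient_of (of_int (as ! i) / of_int (as ! (i - 1))))) * R (x m)"
      by (simp add: mult.assoc mult_dvd_mono)
    then show ?case using Suc by (meson Suc_lessD dvd_trans)
  qed simp
  from this[of "length as - 1"] have "(\<Prod>i = 1..length as - 1.
      snd (quotient_of (of_int (as ! i) / of_int (as ! (i - 1))))) dvd R (x 0)"
    using len dvd_mult_left by auto
  also have "R (x 0) dvd as ! 0" using as[of 0] len by simp
  finally show ?thesis .
qed

section \<open>Removing breaks by inner binomials\<close>

fun ratio_product :: "int \<Rightarrow> int list \<Rightarrow> int" where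
  "ratio_product a [] = 1"
| "ratio_product a (b # bs) = snd (quotient_of (of_int b / of_int a)) * ratio_product b bs"

lemma ratio_product_eq:
  "(\<Prod>i = 1..length (a # bs) - 1. snd (quotient_of (of_int ((a # bs) ! i) / of_int ((a # bs) ! (i - 1)))))
    = ratio_product a bs"
proof (induction bs arbitrary: a)
  case (Cons b bs)
  let ?q = "\<lambda>xs i. snd (quotient_of (of_int (xs ! i) / of_int (xs ! (i - 1) :: int)))"
  have "(\<Prod>i = 1..Suc (length bs). ?q (a # b # bs) i)
    = ?q (a # b # bs) 1 * (\<Prod>i = 1..length bs. ?q (a # b # bs) (Suc i))"
    by (subst prod.atLeast_Suc_atMost, simp, simp only: prod.shift_bounds_cl_Suc_ivl)
  also have "(\<Prod>i = 1..length bs. ?q (a # b # bs) (Suc i)) = (\<Prod>i = 1..length bs. ?q (b # bs) i)"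
    by (rule prod.cong) auto
  also have "(\<Prod>i = 1..length bs. ?q (b # bs) i) = ratio_product b bs"
    using Cons.IH[of b] by (simp only: length_Cons diff_Suc_1)
  finally show ?case by simp
qed simp

lemma reduced_ratio:
  fixes a b :: int
  assumes "0 < a" "0 < b"
  obtains p q m where "snd (quotient_of (of_int b / of_int a)) = q" "a = q * m" "b = p * m"
    "0 < p" "0 < q" "0 < m"
proof -
  let ?g = "gcd b a"
  have "snd (quotient_of (of_int b / of_int a)) = a div ?g"
    using assms(1) by (rule ratio_denominator)
  moreover have g: "0 < ?g" using assms by simp
  moreover have ab: "a = a div ?g * ?g" "b = b div ?g * ?g" by simp_all
  moreover have "0 < a div ?g" "0 < b div ?g"
    using assms g by (simp_all add: pos_imp_zdiv_pos_iff zdvd_imp_le)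
  ultimately show thesis using that by blast
qed

lemma ratio_product_scale:
  "p \<noteq> 0 \<Longrightarrow> ratio_product (p * a) (map ((*) p) bs) = ratio_product a bs"
  by (induction bs arbitrary: a) auto

text \<open>Write \<open>a = q * m\<close> and \<open>b = u * m\<close> with \<open>q\<close> the denominator of \<open>b / a\<close>. Cancelling \<open>q\<close>, the hypothesis
  passes from \<open>a\<close> to \<open>m\<close> and so to its multiple \<open>b\<close>.\<close>

lemma ratio_product_dvd_all:
  assumes "p * ratio_product a bs dvd a" "\<forall>x\<in>set (a # bs). 1 \<le> x"
  shows "\<forall>x\<in>set (a # bs). p dvd x"
  using assms
proof (induction bs arbitrary: a)
  case Nil
  then show ?case by simp
next
  case (Cons b bs)
  have "0 < a" "0 < b" using Cons.prems(2) by auto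
  then obtain u q m where r: "snd (quotient_of (of_int b / of_int a)) = q" "a = q * m" "b = u * m"
    "0 < q" "0 < m" using reduced_ratio by metis
  have "q * (p * ratio_product b bs) dvd q * m"
    using Cons.prems(1) r(1,2) by (simp add: mult_ac)
  then have "p * ratio_product b bs dvd m" using r(4) by simp
  then have "p * ratio_product b bs dvd b" unfolding r(3) by (rule dvd_mult)
  with Cons have "\<forall>x\<in>set (b # bs). p dvd x" by simp
  moreover have "p dvd a" using Cons.prems(1) by (meson dvd_mult_left)
  ultimately show ?case by simp
qed

definition int_kinks :: "(real \<times> int) list \<Rightarrow> (real \<times> real) list" where
  "int_kinks ks = map (\<lambda>(t, b). (t, of_int b)) ks"

text \<open>Let \<open>b / a = p / q\<close> for the first two slopes \<open>a = q * m\<close> and \<open>b = p * m\<close>. The inner binomial has the slopes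
  \<open>q, p\<close>, and the outer function has the slope \<open>m\<close> on both sides of the first break, which disappears.
  By \<open>ratio_product_dvd_all\<close> the other slopes are divisible by \<open>p\<close>, and dividing all of them by \<open>p\<close>
  changes neither their ratios nor their order.\<close>

theorem binomial_decomposition:
  assumes "reduced (of_int a) (int_kinks ks)" "ks \<noteq> []" "\<forall>x\<in>set (a # map snd ks). 1 \<le> x"
    "ratio_product a (map snd ks) dvd a"
  shows "\<exists>gs. pl (of_int a, int_kinks ks, c) = compose gs \<and> (\<forall>g\<in>set gs. rational_binomial g) \<and>
    (sorted_wrt (>) (a # map snd ks) \<longrightarrow> (\<forall>g\<in>set gs. tropical_binomial g))"
  using assms
proof (induction "length ks" arbitrary: a ks c rule: less_induct)
  case less
  have binomial: "rational_binomial (pl (of_int a, [(t, of_int b)], c)) \<and>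
    (b < a \<longrightarrow> tropical_binomial (pl (of_int a, [(t, of_int b)], c)))"
    if "1 \<le> a" "1 \<le> b" "a \<noteq> b" for a b :: int and t c
  proof -
    have "rational_binomial (pl (of_int a, [(t, of_int b)], c))"
      using binomial_pl[of a b t c] that unfolding rational_binomial_def by auto
    moreover have "tropical_binomial (pl (of_int a, [(t, of_int b)], c))" if "b < a"
    proof -
      obtain \<alpha> \<beta> where "pl (of_int a, [(t, of_int b)], c) = (\<lambda>x. if of_int b < (of_int a :: real)
        then min (of_int a * x + \<alpha>) (of_int b * x + \<beta>) else max (of_int a * x + \<alpha>) (of_int b * x + \<beta>))"
      proof -
        have "of_int a \<noteq> (of_int b :: real)" using \<open>b < a\<close> by simp
        from pl_line_pair[OF this, of t c] show thesis using that by blast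
      qed
      then show ?thesis using that \<open>1 \<le> b\<close> unfolding tropical_binomial_def by auto
    qed
    ultimately show ?thesis by blast
  qed
  obtain t b r where ks: "ks = (t, b) # r" using less.prems(2) by (cases ks) auto
  have ab: "1 \<le> a" "1 \<le> b" "a \<noteq> b" using less.prems(1,3) by (auto simp: ks int_kinks_def reduced_def)
  show ?case
  proof (cases "r = []")
    case True
    then have "int_kinks ks = [(t, of_int b)]" by (simp add: ks int_kinks_def)
    then show ?thesis using binomial[OF ab, of t c]
      by (intro exI[of _ "[pl (of_int a, [(t, of_int b)], c)]"]) (auto simp: ks)
  next
    case False
    obtain p q m where r: "snd (quotient_of (of_int b / of_int a)) = q" "a = q * m" "b = p * m"
      "0 < p" "0 < q" "0 < m"
    proof -
      have "0 < a" "0 < b" using ab by auto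
      from reduced_ratio[OF this] show thesis using that by blast
    qed
    have "q * ratio_product b (map snd r) dvd q * m"
      using less.prems(4) r(1,2) by (simp add: ks)
    then have Dm: "ratio_product b (map snd r) dvd m" using r(5) by simp
    then have "p * ratio_product b (map snd r) dvd b" unfolding r(3) by (rule mult_dvd_mono[OF dvd_refl])
    then have "\<forall>x\<in>set (b # map snd r). p dvd x"
      by (rule ratio_product_dvd_all) (use less.prems(3) ks in auto)
    then have div: "p * (snd k div p) = snd k" if "k \<in> set r" for k using that by auto
    define r' where "r' = map (\<lambda>(s, d). (s, d div p)) r"
    have r_eq: "r = map (\<lambda>(s, z). (s, p * z)) r'"
      unfolding r'_def map_map by (rule map_idI[symmetric]) (use div in \<open>force\<close>)
    let ?ls = "(t, of_int p :: real, of_int m :: real) # map (\<lambda>(s, z). (s, of_int p, of_int z)) r'"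
    define v where "v = pl (of_int q, [(t, of_int p)], 0)"
    have sorted: "sorted_wrt (<) (t # map fst r')"
      using less.prems(1) by (simp add: ks r_eq int_kinks_def reduced_def case_prod_beta comp_def)
    have fst_ls: "map fst ?ls = t # map fst r'" by (simp add: case_prod_beta comp_def)
    have sorted': "sorted (map fst ?ls)" unfolding fst_ls using sorted by (rule strict_sorted_imp_sorted)
    have v: "pl (of_int q, map (\<lambda>(t, w, d). (t, w)) ?ls, 0) = v"
    proof -
      have "prune (of_int p) (map (\<lambda>k. (fst k, of_int p)) r') = []"
        unfolding prune_Nil_iff by auto
      moreover have "p \<noteq> q" using ab(3) r(2,3) by auto
      ultimately have "prune (of_int q) (map (\<lambda>(t, w, d). (t, w)) ?ls) = [(t, of_int p)]"
        by (simp add: comp_def case_prod_beta)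
      moreover have "sorted (map fst (map (\<lambda>(t, w, d). (t, w)) ?ls))"
        unfolding map_fst_triple by (rule sorted')
      ultimately show ?thesis using pl_prune[of "map (\<lambda>(t, w, d). (t, w)) ?ls" "of_int q" 0]
        unfolding v_def by simp
    qed
    have vm: "strict_mono v" unfolding v_def by (rule pl_strict_mono) (use r in auto)
    define ks' where "ks' = map (\<lambda>(s, z). (v s, z)) r'"
    have "pl (of_int m * of_int q, map (\<lambda>(t, w, d). (t, d * w)) ?ls, c)
        = pl (of_int m, map (\<lambda>(t, w, d). (v t, d)) ?ls, c) \<circ> v"
    proof -
      have "0 \<le> (of_int q :: real)" using r(5) by simp
      moreover have "0 \<le> w" if "(s, w, d) \<in> set ?ls" for s w d
        using that r(4) by (auto simp: image_iff)
      ultimately show ?thesis using pl_factor[OF sorted', of "of_int q" "of_int m" c] unfolding v by blast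
    qed
    moreover have "map (\<lambda>(t, w, d). (t, d * w)) ?ls = int_kinks ks"
      by (simp add: ks r_eq int_kinks_def r(3) comp_def case_prod_beta mult.commute)
    moreover have "pl (of_int m, map (\<lambda>(t, w, d). (v t, d)) ?ls, c) = pl (of_int m, int_kinks ks', c)"
    proof -
      have map_eq: "map (\<lambda>(t, w, d). (v t, d)) ?ls = (v t, of_int m) # int_kinks ks'"
        by (simp add: ks'_def int_kinks_def comp_def case_prod_beta)
      have "sorted (map fst (map (\<lambda>(t, w, d). (v t, d)) ?ls))"
        unfolding map_fst_triple fst_ls using sorted strict_monoD[OF vm, THEN less_imp_le]
        by (auto simp: sorted_wrt_map intro!: strict_sorted_imp_sorted elim!: sorted_wrt_mono_rel[rotated])
      then have s: "sorted (map fst ((v t, of_int m) # int_kinks ks'))" unfolding map_eq .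
      then have "sorted (map fst (int_kinks ks'))" by simp
      from pl_prune[OF s, of "of_int m" c] pl_prune[OF this, of "of_int m" c]
      show ?thesis unfolding map_eq by simp
    qed
    ultimately have comp: "pl (of_int a, int_kinks ks, c) = pl (of_int m, int_kinks ks', c) \<circ> v"
      by (simp add: r(2) mult.commute)
    have snd_ks': "map snd ks' = map snd r'" by (simp add: ks'_def comp_def case_prod_beta)
    have slopes: "b # map snd r = map ((*) p) (m # map snd ks')"
      unfolding snd_ks' by (simp add: r(3) r_eq comp_def case_prod_beta)
    have red': "reduced (of_int m) (int_kinks ks')"
    proof -
      have "sorted_wrt (<) (map fst (int_kinks ks'))"
        using sorted strict_monoD[OF vm]
        by (auto simp: int_kinks_def ks'_def case_prod_beta comp_def sorted_wrt_map elim!: sorted_wrt_mono_rel[rotated])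
      moreover have "distinct_adj (map real_of_int (b # map snd r))"
        using less.prems(1) by (simp add: ks int_kinks_def reduced_def case_prod_beta comp_def)
      then have "distinct_adj (b # map snd r)" by (rule distinct_adj_mapD)
      then have "distinct_adj (m # map snd ks')" unfolding slopes by (rule distinct_adj_mapD)
      then have "distinct_adj (map real_of_int (m # map snd ks'))" by (rule distinct_adj_mapI) (auto simp: inj_on_def)
      ultimately show ?thesis by (simp add: reduced_def int_kinks_def case_prod_beta comp_def)
    qed
    have pos: "\<forall>x\<in>set (m # map snd ks'). 1 \<le> x"
    proof
      fix x assume "x \<in> set (m # map snd ks')"
      then have "p * x \<in> set (b # map snd r)" unfolding slopes by auto
      then have "1 \<le> p * x" using less.prems(3) ks by auto
      then have "0 < p * x" by simp
      then show "1 \<le> x" using r(4) by (simp add: zero_less_mult_iff)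
    qed
    have "ratio_product b (map snd r) = ratio_product m (map snd ks')"
      using slopes ratio_product_scale[of p m "map snd ks'"] r(4) by simp
    with Dm have "ratio_product m (map snd ks') dvd m" by simp
    moreover have "length ks' < length ks" by (simp add: ks ks'_def r'_def)
    moreover have "ks' \<noteq> []" using False by (simp add: ks'_def r'_def)
    ultimately obtain gs where gs: "pl (of_int m, int_kinks ks', c) = compose gs"
      "\<forall>g\<in>set gs. rational_binomial g"
      "sorted_wrt (>) (m # map snd ks') \<longrightarrow> (\<forall>g\<in>set gs. tropical_binomial g)"
      using less.hyps[of ks' m c] red' pos by blast
    have q: "1 \<le> q" "1 \<le> p" "q \<noteq> p" using r ab(3) by auto
    have dec: "sorted_wrt (>) (m # map snd ks') \<and> p < q" if "sorted_wrt (>) (a # map snd ks)"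
    proof -
      have "sorted_wrt (>) (map ((*) p) (m # map snd ks'))" using that unfolding slopes[symmetric] by (simp add: ks)
      then have "sorted_wrt (>) (m # map snd ks')"
        unfolding sorted_wrt_map using r(4) by simp
      moreover have "b < a" using that by (simp add: ks)
      ultimately show ?thesis using r by simp
    qed
    have "pl (of_int a, int_kinks ks, c) = compose (gs @ [v])"
      unfolding comp gs(1) compose_append by simp
    moreover have "rational_binomial v" "p < q \<longrightarrow> tropical_binomial v"
      using binomial[OF q, of t 0] unfolding v_def by auto
    ultimately show ?thesis using gs(2,3) dec
      by (intro exI[of _ "gs @ [v]"]) auto
  qed
qed

section \<open>The algorithms and the divisibility criterion\<close>

lemma functions_datum_pl:
  assumes "\<forall>g\<in>set gs. proper_data g"
  shows "functions_datum (map pl gs) = encode (map to_lists gs)"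
proof -
  have "function_datum (pl g) = encode (to_lists g)" if "g \<in> set gs" for g
    using function_datum_pl assms that by (cases g) (auto simp del: pl.simps)
  then show ?thesis by (simp add: functions_datum_def encode_list_def del: pl.simps cong: map_cong)
qed

lemma tropical_rational_kinks:
  assumes "tropical_rational f"
  obtains a ks where "proper a ks" "f = pl (a, ks, f 0)"
  using tropical_rational_is_pl[OF assms] unfolding proper_def by metis

lemma id_pl:
  assumes "proper a ks" "pl (a, ks, c) = id"
  shows "ks = []" "a = 1" "c = 0"
proof -
  have "tropical_roots (pl (a, ks, c)) = {}" unfolding assms(2) by (simp add: tropical_roots_def id_def)
  then show "ks = []" using tropical_roots_pl[of a ks c] assms(1) by (simp add: proper_def)
  have "pl (a, ks, c) 0 = 0" "pl (a, ks, c) 1 = 1" unfolding assms(2) by simp_all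
  then show "c = 0" "a = 1" using \<open>ks = []\<close> by simp_all
qed

lemma card_tropical_roots_pl:
  assumes "proper a ks"
  shows "card (tropical_roots (pl (a, ks, c))) = length ks" "tropical_roots (pl (a, ks, c)) \<noteq> {} \<longleftrightarrow> ks \<noteq> []"
proof -
  have red: "reduced a ks" using assms by (simp add: proper_def)
  then have "distinct (map fst ks)" by (simp add: reduced_def strict_sorted_iff)
  then have "card (set (map fst ks)) = length (map fst ks)" by (rule distinct_card)
  then show "card (tropical_roots (pl (a, ks, c))) = length ks"
    using tropical_roots_pl[OF red, of c] by simp
  show "tropical_roots (pl (a, ks, c)) \<noteq> {} \<longleftrightarrow> ks \<noteq> []"
    using tropical_roots_pl[OF red, of c] by simp
qed

theorem monotone_decomposition_algorithm:
  "\<exists>P. \<forall>f. tropical_rational f \<and> monotone_slopes (slopes f) \<and>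
       (f = id \<or> tropical_roots f \<noteq> {}) \<longrightarrow>
     (\<exists>gs. run P (function_datum f) (functions_datum gs) \<and>
        f = compose gs \<and>
        (\<forall>g\<in>set gs. monotone_binomial g \<or> monotone_trinomial g) \<and>
        length gs \<le> card (tropical_roots f))"
  (is "\<exists>P. \<forall>f. _ \<longrightarrow> ?claim P f")
proof -
  have "computable (\<lambda>x. map to_lists (mono_decomposition (of_lists x)))"
    by (intro computable_map computable_comp[OF computable_to_lists] computable_snd computable_id
        computable_comp[OF computable_mono_decomposition] computable_of_lists)
  then obtain P where P: "\<And>x. run P (encode x) (encode (map to_lists (mono_decomposition (of_lists x))))"
    unfolding computable_def by blast
  have "?claim P f" if f: "tropical_rational f" "monotone_slopes (slopes f)" "f = id \<or> tropical_roots f \<noteq> {}" for f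
  proof -
    obtain a ks where pr: "proper a ks" and f_eq: "f = pl (a, ks, f 0)"
      using tropical_rational_kinks[OF f(1)] by blast
    define c where "c = f 0"
    note f_pl = f_eq[folded c_def]
    define gs where "gs = mono_decomposition (a, ks, c)"
    have sg: "one_sign (slope_list a ks)"
      using f(2) unfolding f_pl monotone_slopes_iff proper_slopes(2)[OF pr] .
    have ne: "ks \<noteq> [] \<or> a = 1 \<and> c = 0"
      using f(3) card_tropical_roots_pl(2)[OF pr, of c] id_pl[OF pr, of c] unfolding f_pl by blast
    then have "ks \<noteq> [] \<or> 0 < a \<and> c = 0" by auto
    note D = mono_decomposition_correct[OF pr sg this, folded gs_def]
    have "length gs \<le> length ks"
      using D(2) ne by (cases "ks = []") (auto simp: gs_def mono_decomposition_def)
    moreover have "run P (function_datum f) (functions_datum (map pl gs))"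
      using P[of "to_lists (a, ks, c)"] D(4)
      unfolding f_pl function_datum_pl[OF pr] of_lists_to_lists gs_def[symmetric]
      by (subst functions_datum_pl) auto
    ultimately show ?thesis using D(1,4) card_tropical_roots_pl(1)[OF pr, of c]
      by (intro exI[of _ "map pl gs"]) (auto simp: f_pl[symmetric] simp del: pl.simps)
  qed
  then show ?thesis by blast
qed

lemma blocks_of_int: "blocks (map of_int as) = number_of_blocks as"
proof -
  have "filter (\<lambda>x. x \<noteq> 0) (map of_int as) = map (of_int :: int \<Rightarrow> real) (filter (\<lambda>x. x \<noteq> 0) as)"
    by (simp add: filter_map comp_def)
  moreover have "map sgn (map (of_int :: int \<Rightarrow> real) xs) = map of_int (map sgn xs)" for xs
    by (auto simp: sgn_if)
  moreover have "inj (of_int :: int \<Rightarrow> real)" by (simp add: inj_def)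
  ultimately show ?thesis unfolding blocks_def number_of_blocks_def
    by (simp only: remdups_adj_map_injective length_map)
qed

lemma zeros_of_int: "zeros (map of_int as) = length (filter (\<lambda>a. a = 0) as)"
  by (simp add: zeros_def filter_map comp_def)

theorem rational_decomposition_algorithm:
  "\<exists>P. \<forall>f. tropical_rational f \<and>
       (f = id \<or> (\<exists>c. f = (\<lambda>x. c)) \<or> tropical_roots f \<noteq> {}) \<longrightarrow>
     (\<exists>gs hs ss.
        run P (function_datum f)
          (Cell (functions_datum gs) (Cell (functions_datum hs) (functions_datum ss))) \<and>
        f = compose gs \<circ> compose hs \<circ> compose ss \<and>
        (\<forall>g\<in>set gs. pm1_binomial g \<or> pm1_trinomial g) \<and>
        (\<forall>h\<in>set hs. monotone_binomial h \<or> monotone_trinomial h) \<and>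
        (\<forall>s\<in>set ss. singular_monotone_trinomial s) \<and>
        length (filter pm1_binomial gs) + 2 * length (filter pm1_trinomial gs)
          \<le> number_of_blocks (slopes f) \<and>
        length hs \<le> length (slopes f) \<and>
        length ss = length (filter (\<lambda>a. a = 0) (slopes f)))"
  (is "\<exists>P. \<forall>f. _ \<longrightarrow> ?claim P f")
proof -
  define D where "D = (\<lambda>x. (map to_lists (fst (decomposition (of_lists x))),
    map to_lists (fst (snd (decomposition (of_lists x)))), map to_lists (snd (snd (decomposition (of_lists x))))))"
  have "computable D" unfolding D_def
    by (intro computable_Pair computable_map computable_comp[OF computable_to_lists] computable_fst computable_snd
        computable_id computable_comp[OF computable_decomposition] computable_of_lists)
  then obtain P where P: "\<And>x. run P (encode x) (encode (D x))"
    unfolding computable_def by blast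
  have "?claim P f"
    if f: "tropical_rational f" "f = id \<or> (\<exists>c. f = (\<lambda>x. c)) \<or> tropical_roots f \<noteq> {}" for f
  proof -
    obtain a ks where pr: "proper a ks" and f_eq: "f = pl (a, ks, f 0)"
      using tropical_rational_kinks[OF f(1)] by blast
    define c where "c = f 0"
    note f_pl = f_eq[folded c_def]
    have "a = 0" if "ks = []" "pl (a, ks, c) = (\<lambda>x. d)" for d
      using fun_cong[OF that(2), of 0] fun_cong[OF that(2), of 1] that(1) by simp
    then have ne: "ks \<noteq> [] \<or> a = 0 \<or> a = 1 \<and> c = 0"
      using f(2) card_tropical_roots_pl(2)[OF pr, of c] id_pl[OF pr, of c] unfolding f_pl by blast
    obtain gs hs ss where dec: "decomposition (a, ks, c) = (gs, hs, ss)" by (cases "decomposition (a, ks, c)") auto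
    note R = decomposition_correct[OF pr ne dec]
    have "D (to_lists (a, ks, c)) = (map to_lists gs, map to_lists hs, map to_lists ss)"
      by (simp add: D_def dec)
    moreover have "functions_datum (map pl gs) = encode (map to_lists gs)"
      "functions_datum (map pl hs) = encode (map to_lists hs)"
      "functions_datum (map pl ss) = encode (map to_lists ss)"
      by (rule functions_datum_pl, use R(2,3,4) in blast)+
    ultimately have "run P (function_datum f) (Cell (functions_datum (map pl gs))
        (Cell (functions_datum (map pl hs)) (functions_datum (map pl ss))))"
      using P[of "to_lists (a, ks, c)"] unfolding f_pl function_datum_pl[OF pr] by simp
    moreover have "number_of_blocks (slopes f) = blocks (slope_list a ks)"
      "length (filter (\<lambda>a. a = 0) (slopes f)) = zeros (slope_list a ks)"
      unfolding f_pl by (simp_all only: blocks_of_int[symmetric] zeros_of_int[symmetric] proper_slopes(2)[OF pr])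
    moreover have "length (slopes f) = Suc (length ks)" unfolding f_pl by (rule length_slopes_pl[OF pr])
    moreover have "f = compose (map pl gs) \<circ> compose (map pl hs) \<circ> compose (map pl ss)"
      using R(1) unfolding f_pl .
    ultimately show ?thesis using R(2-7)
      by (intro exI[of _ "map pl gs"] exI[of _ "map pl hs"] exI[of _ "map pl ss"])
        (simp only: set_map ball_simps length_map, blast)
  qed
  then show ?thesis by blast
qed

lemma ratio_denominator_product:
  assumes "slopes f = a # bs"
  shows "(\<Prod>i = 1..length (slopes f) - 1. ratio_denominator f i) = ratio_product a bs"
  unfolding ratio_denominator_def assms by (rule ratio_product_eq)

theorem divisibility_necessary:
  assumes "tropical_rational f" "\<forall>a\<in>set (slopes f). 1 \<le> a"
    "f = compose gs" "\<forall>g\<in>set gs. rational_binomial g"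
  shows "(\<Prod>i = 1..length (slopes f) - 1. ratio_denominator f i) dvd slopes f ! 0"
proof -
  obtain a ks where pr: "proper a ks" and f_eq: "f = pl (a, ks, f 0)"
    using tropical_rational_kinks[OF assms(1)] by blast
  have s: "has_slopes f (slopes f)" "map of_int (slopes f) = slope_list a ks"
    using proper_slopes[OF pr, of "f 0"] f_eq by simp_all
  have pos: "0 < x" if "x \<in> set (slope_list a ks)" for x
    using that assms(2) unfolding s(2)[symmetric] by (force simp: less_le_trans)
  have "strict_mono (pl (a, ks, f 0))"
  proof (rule pl_strict_mono)
    show "0 < a" by (rule pos) simp
    show "0 < b" if "(t, b) \<in> set ks" for t b by (rule pos) (use that in force)
  qed
  then have "strict_mono f" using f_eq by simp
  then have "inj (compose gs)" using assms(3) strict_mono_imp_inj_on by blast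
  from divisor_chains_compose[OF assms(4) this] have "divisor_chains f" using assms(3) by simp
  from divisor_chains_dvd[OF this s(1) assms(2)] show ?thesis unfolding ratio_denominator_def .
qed

theorem divisibility_sufficient:
  assumes "tropical_rational f" "\<forall>a\<in>set (slopes f). 1 \<le> a" "tropical_roots f \<noteq> {}"
    "(\<Prod>i = 1..length (slopes f) - 1. ratio_denominator f i) dvd slopes f ! 0"
  shows "\<exists>gs. f = compose gs \<and> (\<forall>g\<in>set gs. rational_binomial g) \<and>
    (sorted_wrt (>) (slopes f) \<longrightarrow> (\<forall>g\<in>set gs. tropical_binomial g))"
proof -
  obtain a ks where pr: "proper a ks" and f_eq: "f = pl (a, ks, f 0)"
    using tropical_rational_kinks[OF assms(1)] by blast
  have s: "map of_int (slopes f) = slope_list a ks"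
    using proper_slopes(2)[OF pr, of "f 0"] f_eq by simp
  then obtain a' bs where sl: "slopes f = a' # bs" by (cases "slopes f") auto
  define js where "js = zip (map fst ks) bs"
  have len: "length bs = length ks" using arg_cong[OF s, of length] by (simp add: sl)
  have a: "a = of_int a'" and bs: "map of_int bs = map snd ks" using s by (simp_all add: sl)
  have "int_kinks js = zip (map fst ks) (map of_int bs)"
    unfolding int_kinks_def js_def by (simp add: zip_map2)
  then have ks: "int_kinks js = ks" unfolding bs by (simp add: zip_map_fst_snd)
  have snd_js: "map snd js = bs" by (simp add: js_def len)
  have "ks \<noteq> []" using assms(3) card_tropical_roots_pl(2)[OF pr, of "f 0"] f_eq by simp
  then have "js \<noteq> []" using len by (auto simp: js_def)
  moreover have "reduced (of_int a') (int_kinks js)" using pr unfolding ks a[symmetric] by (simp add: proper_def)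
  moreover have "ratio_product a' (map snd js) dvd a'"
    using assms(4) unfolding ratio_denominator_product[OF sl] snd_js by (simp add: sl)
  ultimately show ?thesis
    using binomial_decomposition[of a' js "f 0"] assms(2) f_eq unfolding snd_js ks a[symmetric] sl by metis
qed

text \<open>An affine function needs a separate argument: the identity is the empty composition, and a slope
  greater than 1 is obtained from two binomials.\<close>

theorem rational_binomial_criterion:
  assumes f: "tropical_rational f" "\<forall>a\<in>set (slopes f). 1 \<le> a" "\<forall>b. b \<noteq> 0 \<longrightarrow> f \<noteq> (\<lambda>x. x + b)"
  shows "(\<exists>gs. f = compose gs \<and> (\<forall>g\<in>set gs. rational_binomial g)) \<longleftrightarrow>
    (\<Prod>i = 1..length (slopes f) - 1. ratio_denominator f i) dvd slopes f ! 0"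
proof -
  have "\<exists>gs. f = compose gs \<and> (\<forall>g\<in>set gs. rational_binomial g)" if "tropical_roots f = {}"
  proof -
    obtain a ks where pr: "proper a ks" and f_eq: "f = pl (a, ks, f 0)"
      using tropical_rational_kinks[OF f(1)] by blast
    have ks: "ks = []" using that card_tropical_roots_pl(2)[OF pr, of "f 0"] f_eq by simp
    have sl: "map of_int (slopes f) = [a]" using proper_slopes(2)[OF pr, of "f 0"] f_eq ks by simp
    then obtain n where n: "slopes f = [n]" by auto
    then have n': "a = of_int n" "1 \<le> n" using sl f(2) by auto
    show ?thesis
    proof (cases "n = 1")
      case True
      then have "f = (\<lambda>x. x + f 0)" by (subst f_eq) (auto simp: ks n')
      with f(3) have "f 0 = 0" by blast
      with \<open>f = (\<lambda>x. x + f 0)\<close> have "f = compose []" by (simp add: id_def)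
      then show ?thesis by (intro exI[of _ "[]"]) simp
    next
      case False
      have "f = compose [pl (1, [(0, a)], f 0), pl (a, [(0, 1)], 0)]"
        using linear_decomposition[of a "f 0"] f_eq n' ks by simp
      moreover have "rational_binomial (pl (1, [(0, a)], f 0))" "rational_binomial (pl (a, [(0, 1)], 0))"
        using binomial_pl[of 1 n 0 "f 0"] binomial_pl[of n 1 0 0] n' False
        unfolding rational_binomial_def by (auto simp del: pl.simps)
      ultimately show ?thesis by (intro exI[of _ "[pl (1, [(0, a)], f 0), pl (a, [(0, 1)], 0)]"]) auto
    qed
  qed
  then show ?thesis
    using divisibility_necessary[OF f(1,2)] divisibility_sufficient[OF f(1,2)] by blast
qed

theorem tropical_binomial_criterion:
  assumes f: "tropical_polynomial f" "sorted_wrt (>) (slopes f)" "\<forall>a\<in>set (slopes f). 1 \<le> a"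
    "f = id \<or> tropical_roots f \<noteq> {}"
  shows "(\<exists>gs. f = compose gs \<and> (\<forall>g\<in>set gs. tropical_binomial g)) \<longleftrightarrow>
    (\<Prod>i = 1..length (slopes f) - 1. ratio_denominator f i) dvd slopes f ! 0"
proof -
  have tropical: "rational_binomial g" if "tropical_binomial g" for g
  proof -
    obtain b c :: int and \<beta> \<gamma> :: real where bc: "c < b" "1 \<le> c"
      "g = (\<lambda>x. min (of_int b * x + \<beta>) (of_int c * x + \<gamma>))"
      using \<open>tropical_binomial g\<close> unfolding tropical_binomial_def by blast
    then have "b \<noteq> 0" "c \<noteq> 0" "b \<noteq> c" by auto
    with bc(3) show ?thesis unfolding rational_binomial_def binomial_of_slopes_def by blast
  qed
  note rat = tropical_polynomial_rational[OF f(1)]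
  have "\<exists>gs. f = compose gs \<and> (\<forall>g\<in>set gs. tropical_binomial g)" if "f = id"
    using that by (intro exI[of _ "[]"]) simp
  moreover have "\<exists>gs. f = compose gs \<and> (\<forall>g\<in>set gs. tropical_binomial g)"
    if "tropical_roots f \<noteq> {}" "(\<Prod>i = 1..length (slopes f) - 1. ratio_denominator f i) dvd slopes f ! 0"
    using divisibility_sufficient[OF rat f(3) that] f(2) by blast
  moreover have "(\<Prod>i = 1..length (slopes f) - 1. ratio_denominator f i) dvd slopes f ! 0"
    if "f = compose gs" "\<forall>g\<in>set gs. tropical_binomial g" for gs
    using divisibility_necessary[OF rat f(3) that(1)] that(2) tropical by blast
  ultimately show ?thesis using f(4) by blast
qed

theorem theorem3p1:
  "(\<exists>P. \<forall>f. tropical_rational f \<and> monotone_slopes (slopes f) \<and>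
       (f = id \<or> tropical_roots f \<noteq> {}) \<longrightarrow>
     (\<exists>gs. run P (function_datum f) (functions_datum gs) \<and>
        f = compose gs \<and>
        (\<forall>g\<in>set gs. monotone_binomial g \<or> monotone_trinomial g) \<and>
        length gs \<le> card (tropical_roots f))) \<and>
  (\<exists>P. \<forall>f. tropical_rational f \<and>
       (f = id \<or> (\<exists>c. f = (\<lambda>x. c)) \<or> tropical_roots f \<noteq> {}) \<longrightarrow>
     (\<exists>gs hs ss.
        run P (function_datum f)
          (Cell (functions_datum gs) (Cell (functions_datum hs) (functions_datum ss))) \<and>
        f = compose gs \<circ> compose hs \<circ> compose ss \<and>
        (\<forall>g\<in>set gs. pm1_binomial g \<or> pm1_trinomial g) \<and>
        (\<forall>h\<in>set hs. monotone_binomial h \<or> monotone_trinomial h) \<and>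
        (\<forall>s\<in>set ss. singular_monotone_trinomial s) \<and>
        length (filter pm1_binomial gs) + 2 * length (filter pm1_trinomial gs)
          \<le> number_of_blocks (slopes f) \<and>
        length hs \<le> length (slopes f) \<and>
        length ss = length (filter (\<lambda>a. a = 0) (slopes f)))) \<and>
  (\<forall>f. tropical_rational f \<and> (\<forall>a\<in>set (slopes f). a \<ge> 1) \<and>
       (\<forall>b. b \<noteq> 0 \<longrightarrow> f \<noteq> (\<lambda>x. x + b)) \<longrightarrow>
     ((\<exists>gs. f = compose gs \<and> (\<forall>g\<in>set gs. rational_binomial g)) \<longleftrightarrow>
      (\<Prod>i = 1..length (slopes f) - 1. ratio_denominator f i) dvd slopes f ! 0)) \<and>
  (\<forall>f. tropical_polynomial f \<and> sorted_wrt (>) (slopes f) \<and> (\<forall>a\<in>set (slopes f). a \<ge> 1) \<and>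
       (f = id \<or> tropical_roots f \<noteq> {}) \<longrightarrow>
     ((\<exists>gs. f = compose gs \<and> (\<forall>g\<in>set gs. tropical_binomial g)) \<longleftrightarrow>
      (\<Prod>i = 1..length (slopes f) - 1. ratio_denominator f i) dvd slopes f ! 0))"
proof (intro conjI monotone_decomposition_algorithm rational_decomposition_algorithm allI impI; elim conjE)
qed (rule rational_binomial_criterion tropical_binomial_criterion; assumption)+

end
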